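(* Let $\mathcal{T}$ be a $k$-linear, Hom-finite, Krull-Schmidt triangulated category, and let $H\in\mathcal{T}$ be a minimal linear generator with $H\cong\bigoplus_{i=1}^{2n-1}P_i$, the $P_i$ indecomposable, where $P_i\cong P_i[1]$ if and only if $i\equiv 0 \bmod 2$. Let $\Lambda_n$ be the graded endomorphism algebra of $H$. Then there is an isomorphism of graded $k$-algebras \[\Lambda_n\xrightarrow{\ \sim\ }kQ/I,\] where $Q$ is the graded quiver, and $I$ the ideal of $kQ$, described in the context.
   Context: $k$ is an algebraically closed field and $n\ge 1$. For a triangulated category $\mathcal{T}$ with suspension $[1]$, write $\mathcal{T}(X,Y)$ for the space of morphisms $X\to Y$. For $X\in\mathcal{T}$: $\langle X\rangle$ is the smallest thick subcategory containing $X$; $\langle X\rangle_1$ is the smallest additive full subcategory of $\mathcal{T}$ which contains $X$ and is closed under direct summands and the suspension functor $[1]$. $G$ is a classical generator if $\langle G\rangle=\mathcal{T}$. A linear generator is a classical generator $G$ such that: (G1) the set of isomorphism classes of indecomposable objects in $\langle G\rangle_1$ admits a total ordering defined by: $Q\le P$ if and only if $\mathcal{T}(P,Q)\cong k$; moreover, if $Q\le P$ and $Q\not\cong P$, then $\mathcal{T}(Q,P)=0$; (G2) $P\le P[1]$ for each indecomposable $P\in\langle G\rangle_1$; (G3) for indecomposables $P,Q\in\langle G\rangle_1$, $P\le Q\le P[1]$ implies that $Q$ is isomorphic to at least one of $P$ and $P[1]$; (G4) for indecomposables $R\le Q\le P$ in $\langle G\rangle_1$, any morphism from $P$ to $R$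 factors non-trivially through $Q$. A generator is minimal if no proper direct summand of it is a (classical) generator. The graded endomorphism algebra of $Y\in\mathcal{T}$ has degree $i$ part $\mathcal{T}(Y,Y[i])$ ($i\in\mathbb{Z}$), with product $g\cdot f:=g[i]\circ f$ for $f$ of degree $i$. $Q$ is the following graded quiver: vertices $Q_0=\{1,\dots,2n-1\}$; arrows $\delta_{a,a+1}\colon a\to a+1$ of degree $0$ for $1\le a\le 2n-2$; a loop $\alpha_a$ of degree $-1$ at every vertex $a$; and a loop $\beta_a$ of degree $1$ at every even vertex $a$. Paths are composed from left to right ($ab$ means first $a$ then $b$), and $\iota_a$ is the trivial idempotent path at $a$. Let $B\subset Q_0$ be the set of vertices $b$ with no loop $\beta_b$ (the odd vertices). $I$ is the ideal \[I:=\langle \alpha_a\beta_a-\iota_a,\ \beta_a\alpha_a-\iota_a,\ \alpha_b\delta_{b,b+1}-\delta_{b,b+1}\alpha_{b+1},\ \beta_a\delta_{a,a+1}\delta_{a+1,a+2}-\delta_{a,a+1}\delta_{a+1,a+2}\beta_{a+2}\rangle\] for $1\le a,b\le 2n-1$ and $a\notin B$ (over all indices for which the arrows appearing exist).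
   Formalization: The formal theorem adds that P_1,…,P_{2n-1} are numbered along the linear order of (G1), upwards or downwards; with only the parity condition the claim fails, e.g. for n=2 when the suspension-invariant summand is the largest. *)

theory Defs
  imports
    "HOL-Computational_Algebra.Polynomial"
    "HOL-Library.Poly_Mapping"
    "Graph_Theory.Arc_Walk"
    "HOL-Algebra.QuotRing"
    "HOL-Algebra.Module"
begin

section \<open>Linear triangulated categories\<close>

text \<open>
  All morphisms of a \<open>k\<close>-linear category live in one ambient \<open>k\<close>-vector space \<open>'m\<close> (for instance
  the direct sum of all morphism spaces), and \<open>mor T X Y\<close> is a
  subspace of it. In particular \<open>0\<close> is the zero morphism between any two objects.

  The suspension is an automorphism \<open>[1]\<close>; the record contains all of its powers: \<open>sh T i X\<close> is the
  object \<open>X[i]\<close>, and \<open>shm T i f\<close> is the morphism \<open>f[i]\<close>, for every integer \<open>i\<close>.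

  \<open>(X, Y, Z, f, g, h) \<in> tri T\<close> says that \<open>X \<rightarrow> Y \<rightarrow> Z \<rightarrow> X[1]\<close>, with maps \<open>f\<close>, \<open>g\<close>, \<open>h\<close>, is a
  distinguished triangle.
\<close>

record ('k, 'o, 'm) tcat =
  obj :: "'o set"
  mor :: "'o \<Rightarrow> 'o \<Rightarrow> 'm set"
  ident :: "'o \<Rightarrow> 'm"
  cmp :: "'m \<Rightarrow> 'm \<Rightarrow> 'm"  (infixl \<open>\<cdot>\<index>\<close> 70)
  scl :: "'k \<Rightarrow> 'm \<Rightarrow> 'm"
  sh :: "int \<Rightarrow> 'o \<Rightarrow> 'o"
  shm :: "int \<Rightarrow> 'm \<Rightarrow> 'm"
  tri :: "('o \<times> 'o \<times> 'o \<times> 'm \<times> 'm \<times> 'm) set"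

locale linear_category =
  fixes T :: "('k::field, 'o, 'm::ab_group_add) tcat" (structure)
  assumes vector_space_scl: "vector_space (scl T)"
    and subspace_mor: "\<lbrakk>X \<in> obj T; Y \<in> obj T\<rbrakk> \<Longrightarrow> Modules.module.subspace (scl T) (mor T X Y)"
    and ident_mor: "X \<in> obj T \<Longrightarrow> ident T X \<in> mor T X X"
    and cmp_mor: "\<lbrakk>X \<in> obj T; Y \<in> obj T; Z \<in> obj T; f \<in> mor T X Y; g \<in> mor T Y Z\<rbrakk>
      \<Longrightarrow> g \<cdot> f \<in> mor T X Z"
    and cmp_ident_left: "\<lbrakk>X \<in> obj T; Y \<in> obj T; f \<in> mor T X Y\<rbrakk> \<Longrightarrow> ident T Y \<cdot> f = f"
    and cmp_ident_right: "\<lbrakk>X \<in> obj T; Y \<in> obj T; f \<in> mor T X Y\<rbrakk> \<Longrightarrow> f \<cdot> ident T X = f"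
    and cmp_assoc: "\<lbrakk>W \<in> obj T; X \<in> obj T; Y \<in> obj T; Z \<in> obj T;
        f \<in> mor T W X; g \<in> mor T X Y; h \<in> mor T Y Z\<rbrakk> \<Longrightarrow> (h \<cdot> g) \<cdot> f = h \<cdot> (g \<cdot> f)"
    and cmp_add_left: "\<lbrakk>X \<in> obj T; Y \<in> obj T; Z \<in> obj T;
        f \<in> mor T X Y; g \<in> mor T Y Z; g' \<in> mor T Y Z\<rbrakk> \<Longrightarrow> (g + g') \<cdot> f = g \<cdot> f + g' \<cdot> f"
    and cmp_add_right: "\<lbrakk>X \<in> obj T; Y \<in> obj T; Z \<in> obj T;
        f \<in> mor T X Y; f' \<in> mor T X Y; g \<in> mor T Y Z\<rbrakk> \<Longrightarrow> g \<cdot> (f + f') = g \<cdot> f + g \<cdot> f'"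
    and cmp_scl_left: "\<lbrakk>X \<in> obj T; Y \<in> obj T; Z \<in> obj T; f \<in> mor T X Y; g \<in> mor T Y Z\<rbrakk>
      \<Longrightarrow> scl T r g \<cdot> f = scl T r (g \<cdot> f)"
    and cmp_scl_right: "\<lbrakk>X \<in> obj T; Y \<in> obj T; Z \<in> obj T; f \<in> mor T X Y; g \<in> mor T Y Z\<rbrakk>
      \<Longrightarrow> g \<cdot> scl T r f = scl T r (g \<cdot> f)"

definition iso_mor :: "('k, 'o, 'm) tcat \<Rightarrow> 'o \<Rightarrow> 'o \<Rightarrow> 'm \<Rightarrow> bool" where
  "iso_mor T X Y f \<longleftrightarrow>
     f \<in> mor T X Y \<and> (\<exists>g \<in> mor T Y X. g \<cdot>\<^bsub>T\<^esub> f = ident T X \<and> f \<cdot>\<^bsub>T\<^esub> g = ident T Y)"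

definition iso_obj :: "('k, 'o, 'm) tcat \<Rightarrow> 'o \<Rightarrow> 'o \<Rightarrow> bool" where
  "iso_obj T X Y \<longleftrightarrow> X \<in> obj T \<and> Y \<in> obj T \<and> (\<exists>f. iso_mor T X Y f)"

definition zero_obj :: "('k, 'o, 'm::zero) tcat \<Rightarrow> 'o \<Rightarrow> bool" where
  "zero_obj T Z \<longleftrightarrow> Z \<in> obj T \<and> (\<forall>X \<in> obj T. mor T X Z = {0} \<and> mor T Z X = {0})"

text \<open>\<open>X\<close> is (isomorphic to) the direct sum of the finite family \<open>Y\<^sub>i\<close>, \<open>i \<in> S\<close>, as a biproduct.\<close>

definition direct_sum ::
  "('k, 'o, 'm::comm_monoid_add) tcat \<Rightarrow> 'o \<Rightarrow> 'i set \<Rightarrow> ('i \<Rightarrow> 'o) \<Rightarrow> bool" where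
  "direct_sum T X S Y \<longleftrightarrow> X \<in> obj T \<and> finite S \<and> (\<forall>i \<in> S. Y i \<in> obj T) \<and>
     (\<exists>inc prj. (\<forall>i \<in> S. inc i \<in> mor T (Y i) X \<and> prj i \<in> mor T X (Y i)) \<and>
        (\<forall>i \<in> S. \<forall>j \<in> S. prj j \<cdot>\<^bsub>T\<^esub> inc i = (if i = j then ident T (Y i) else 0)) \<and>
        (\<Sum>i \<in> S. inc i \<cdot>\<^bsub>T\<^esub> prj i) = ident T X)"

abbreviation direct_sum2 :: "('k, 'o, 'm::comm_monoid_add) tcat \<Rightarrow> 'o \<Rightarrow> 'o \<Rightarrow> 'o \<Rightarrow> bool" where
  "direct_sum2 T X A B \<equiv> direct_sum T X (UNIV :: bool set) (\<lambda>b. if b then A else B)"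

definition indecomposable :: "('k, 'o, 'm::comm_monoid_add) tcat \<Rightarrow> 'o \<Rightarrow> bool" where
  "indecomposable T X \<longleftrightarrow> X \<in> obj T \<and> \<not> zero_obj T X \<and>
     (\<forall>A B. direct_sum2 T X A B \<longrightarrow> zero_obj T A \<or> zero_obj T B)"

locale triangulated_category = linear_category T
  for T :: "('k::field, 'o, 'm::ab_group_add) tcat" (structure) +
  \<comment> \<open>additivity; the empty family gives a zero object\<close>
  assumes ex_direct_sum:
      "\<And>(m::nat) Y. (\<And>i. i < m \<Longrightarrow> Y i \<in> obj T) \<Longrightarrow> \<exists>X. direct_sum T X {..<m} Y"
  \<comment> \<open>the powers of the suspension\<close>
    and sh_obj: "X \<in> obj T \<Longrightarrow> sh T i X \<in> obj T"
    and shm_mor: "\<lbrakk>X \<in> obj T; Y \<in> obj T; f \<in> mor T X Y\<rbrakk> \<Longrightarrow> shm T i f \<in> mor T (sh T i X) (sh T i Y)"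
    and shm_ident: "X \<in> obj T \<Longrightarrow> shm T i (ident T X) = ident T (sh T i X)"
    and shm_cmp: "\<lbrakk>X \<in> obj T; Y \<in> obj T; Z \<in> obj T; f \<in> mor T X Y; g \<in> mor T Y Z\<rbrakk>
      \<Longrightarrow> shm T i (g \<cdot> f) = shm T i g \<cdot> shm T i f"
    and shm_add: "\<lbrakk>X \<in> obj T; Y \<in> obj T; f \<in> mor T X Y; f' \<in> mor T X Y\<rbrakk>
      \<Longrightarrow> shm T i (f + f') = shm T i f + shm T i f'"
    and shm_scl: "\<lbrakk>X \<in> obj T; Y \<in> obj T; f \<in> mor T X Y\<rbrakk>
      \<Longrightarrow> shm T i (scl T r f) = scl T r (shm T i f)"
    and sh_0: "X \<in> obj T \<Longrightarrow> sh T 0 X = X"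
    and sh_add: "X \<in> obj T \<Longrightarrow> sh T (i + j) X = sh T i (sh T j X)"
    and shm_0: "\<lbrakk>X \<in> obj T; Y \<in> obj T; f \<in> mor T X Y\<rbrakk> \<Longrightarrow> shm T 0 f = f"
    and shm_comp: "\<lbrakk>X \<in> obj T; Y \<in> obj T; f \<in> mor T X Y\<rbrakk>
      \<Longrightarrow> shm T (i + j) f = shm T i (shm T j f)"
  \<comment> \<open>distinguished triangles\<close>
    and tri_wf: "(X, Y, Z, f, g, h) \<in> tri T \<Longrightarrow>
      X \<in> obj T \<and> Y \<in> obj T \<and> Z \<in> obj T \<and>
      f \<in> mor T X Y \<and> g \<in> mor T Y Z \<and> h \<in> mor T Z (sh T 1 X)"
    and tri_iso: "\<lbrakk>(X, Y, Z, f, g, h) \<in> tri T; X' \<in> obj T; Y' \<in> obj T; Z' \<in> obj T;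
        f' \<in> mor T X' Y'; g' \<in> mor T Y' Z'; h' \<in> mor T Z' (sh T 1 X');
        iso_mor T X X' a; iso_mor T Y Y' b; iso_mor T Z Z' c;
        b \<cdot> f = f' \<cdot> a; c \<cdot> g = g' \<cdot> b; shm T 1 a \<cdot> h = h' \<cdot> c\<rbrakk>
      \<Longrightarrow> (X', Y', Z', f', g', h') \<in> tri T"
    and tri_ident: "\<lbrakk>X \<in> obj T; zero_obj T Z\<rbrakk> \<Longrightarrow> (X, X, Z, ident T X, 0, 0) \<in> tri T"
    and tri_cone: "\<lbrakk>X \<in> obj T; Y \<in> obj T; f \<in> mor T X Y\<rbrakk> \<Longrightarrow> \<exists>Z g h. (X, Y, Z, f, g, h) \<in> tri T"
    and tri_rotate: "\<lbrakk>X \<in> obj T; Y \<in> obj T; Z \<in> obj T;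
        f \<in> mor T X Y; g \<in> mor T Y Z; h \<in> mor T Z (sh T 1 X)\<rbrakk>
      \<Longrightarrow> (X, Y, Z, f, g, h) \<in> tri T \<longleftrightarrow> (Y, Z, sh T 1 X, g, h, - shm T 1 f) \<in> tri T"
    and tri_fill: "\<lbrakk>(X, Y, Z, f, g, h) \<in> tri T; (X', Y', Z', f', g', h') \<in> tri T;
        a \<in> mor T X X'; b \<in> mor T Y Y'; b \<cdot> f = f' \<cdot> a\<rbrakk>
      \<Longrightarrow> \<exists>c \<in> mor T Z Z'. c \<cdot> g = g' \<cdot> b \<and> shm T 1 a \<cdot> h = h' \<cdot> c"
    and tri_octahedral: "\<lbrakk>(X, Y, U, f, u, u') \<in> tri T; (Y, Z, V, g, v, v') \<in> tri T;
        (X, Z, W, g \<cdot> f, w, w') \<in> tri T\<rbrakk>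
      \<Longrightarrow> \<exists>a b. (U, W, V, a, b, shm T 1 u \<cdot> v') \<in> tri T \<and>
          a \<cdot> u = w \<cdot> g \<and> w' \<cdot> a = u' \<and> b \<cdot> w = v \<and> v' \<cdot> b = shm T 1 f \<cdot> w'"

definition hom_finite :: "('k::field, 'o, 'm::ab_group_add) tcat \<Rightarrow> bool" where
  "hom_finite T \<longleftrightarrow> (\<forall>X \<in> obj T. \<forall>Y \<in> obj T.
     \<exists>B. finite B \<and> B \<subseteq> mor T X Y \<and> Modules.module.span (scl T) B = mor T X Y)"

text \<open>The endomorphism ring of \<open>X\<close> is local: it is nonzero, and the sum of two non-units is a non-unit.\<close>

definition local_end :: "('k, 'o, 'm::ab_group_add) tcat \<Rightarrow> 'o \<Rightarrow> bool" where
  "local_end T X \<longleftrightarrow> ident T X \<noteq> 0 \<and>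
     (\<forall>f \<in> mor T X X. \<forall>g \<in> mor T X X.
        \<not> iso_mor T X X f \<longrightarrow> \<not> iso_mor T X X g \<longrightarrow> \<not> iso_mor T X X (f + g))"

definition krull_schmidt :: "('k, 'o, 'm::ab_group_add) tcat \<Rightarrow> bool" where
  "krull_schmidt T \<longleftrightarrow> (\<forall>X \<in> obj T. \<exists>(m::nat) Y.
     direct_sum T X {..<m} Y \<and> (\<forall>i < m. local_end T (Y i)))"


section \<open>Linear generators\<close>

text \<open>Full subcategories are given by their sets of objects.\<close>

definition closed_summands :: "('k, 'o, 'm::comm_monoid_add) tcat \<Rightarrow> 'o set \<Rightarrow> bool" where
  "closed_summands T S \<longleftrightarrow> (\<forall>X A B. X \<in> S \<and> direct_sum2 T X A B \<longrightarrow> A \<in> S)"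

definition thick :: "('k, 'o, 'm::comm_monoid_add) tcat \<Rightarrow> 'o set \<Rightarrow> bool" where
  "thick T S \<longleftrightarrow> S \<subseteq> obj T \<and> S \<noteq> {} \<and> (\<forall>X \<in> S. \<forall>i. sh T i X \<in> S) \<and>
     (\<forall>X Y Z f g h. (X, Y, Z, f, g, h) \<in> tri T \<longrightarrow>
        (X \<in> S \<and> Y \<in> S \<longrightarrow> Z \<in> S) \<and> (Y \<in> S \<and> Z \<in> S \<longrightarrow> X \<in> S) \<and> (X \<in> S \<and> Z \<in> S \<longrightarrow> Y \<in> S)) \<and>
     closed_summands T S"

definition thick_closure :: "('k, 'o, 'm::comm_monoid_add) tcat \<Rightarrow> 'o \<Rightarrow> 'o set" where
  "thick_closure T X = \<Inter>{S. thick T S \<and> X \<in> S}"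

text \<open>\<open>add_closure T X\<close> is $\langle X\rangle_1$.\<close>

definition additive_subcat :: "('k, 'o, 'm::comm_monoid_add) tcat \<Rightarrow> 'o set \<Rightarrow> bool" where
  "additive_subcat T S \<longleftrightarrow> S \<subseteq> obj T \<and>
     (\<forall>(m::nat) Y X. (\<forall>i < m. Y i \<in> S) \<and> direct_sum T X {..<m} Y \<longrightarrow> X \<in> S)"

definition add_closure :: "('k, 'o, 'm::comm_monoid_add) tcat \<Rightarrow> 'o \<Rightarrow> 'o set" where
  "add_closure T X =
     \<Inter>{S. additive_subcat T S \<and> closed_summands T S \<and> (\<forall>Y \<in> S. sh T 1 Y \<in> S) \<and> X \<in> S}"

definition classical_generator :: "('k, 'o, 'm::comm_monoid_add) tcat \<Rightarrow> 'o \<Rightarrow> bool" where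
  "classical_generator T G \<longleftrightarrow> G \<in> obj T \<and> thick_closure T G = obj T"

text \<open>\<open>gen_le T Q P\<close> is the relation \<open>Q \<le> P\<close>: the space of morphisms from \<open>P\<close> to \<open>Q\<close> is isomorphic
  to \<open>k\<close> as a vector space.\<close>

definition gen_le :: "('k::field, 'o, 'm::ab_group_add) tcat \<Rightarrow> 'o \<Rightarrow> 'o \<Rightarrow> bool" where
  "gen_le T Q P \<longleftrightarrow> (\<exists>\<phi> :: 'm \<Rightarrow> 'k. bij_betw \<phi> (mor T P Q) UNIV \<and>
     (\<forall>f \<in> mor T P Q. \<forall>g \<in> mor T P Q. \<phi> (f + g) = \<phi> f + \<phi> g) \<and>
     (\<forall>c. \<forall>f \<in> mor T P Q. \<phi> (scl T c f) = c * \<phi> f))"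

definition iso_class :: "('k, 'o, 'm) tcat \<Rightarrow> 'o \<Rightarrow> 'o set" where
  "iso_class T X = {Y. iso_obj T X Y}"

definition ind_objs :: "('k, 'o, 'm::comm_monoid_add) tcat \<Rightarrow> 'o \<Rightarrow> 'o set" where
  "ind_objs T G = {P \<in> add_closure T G. indecomposable T P}"

text \<open>
  In the last clause the morphism \<open>f\<close> is nonzero: the zero morphism factors through every object, but
  never as a composite of nonzero morphisms.
\<close>

definition linear_generator :: "('k::field, 'o, 'm::ab_group_add) tcat \<Rightarrow> 'o \<Rightarrow> bool" where
  "linear_generator T G \<longleftrightarrow> classical_generator T G \<and>
     linear_order_on (iso_class T ` ind_objs T G)
       {(iso_class T Q, iso_class T P) | Q P. Q \<in> ind_objs T G \<and> P \<in> ind_objs T G \<and> gen_le T Q P} \<and>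
     (\<forall>Q \<in> ind_objs T G. \<forall>P \<in> ind_objs T G.
        gen_le T Q P \<and> \<not> iso_obj T Q P \<longrightarrow> mor T Q P = {0}) \<and>
     (\<forall>P \<in> ind_objs T G. gen_le T P (sh T 1 P)) \<and>
     (\<forall>P \<in> ind_objs T G. \<forall>Q \<in> ind_objs T G.
        gen_le T P Q \<and> gen_le T Q (sh T 1 P) \<longrightarrow> iso_obj T Q P \<or> iso_obj T Q (sh T 1 P)) \<and>
     (\<forall>R \<in> ind_objs T G. \<forall>Q \<in> ind_objs T G. \<forall>P \<in> ind_objs T G.
        gen_le T R Q \<and> gen_le T Q P \<longrightarrow>
        (\<forall>f \<in> mor T P R. f \<noteq> 0 \<longrightarrow>
          (\<exists>h \<in> mor T P Q. \<exists>g \<in> mor T Q R. h \<noteq> 0 \<and> g \<noteq> 0 \<and> f = g \<cdot>\<^bsub>T\<^esub> h)))"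

definition minimal_generator :: "('k, 'o, 'm::comm_monoid_add) tcat \<Rightarrow> 'o \<Rightarrow> bool" where
  "minimal_generator T G \<longleftrightarrow> classical_generator T G \<and>
     (\<forall>A B. direct_sum2 T G A B \<and> \<not> zero_obj T B \<longrightarrow> \<not> classical_generator T A)"

text \<open>
  The indecomposables \<open>P\<^sub>1, \<dots>, P\<^sub>m\<close> are listed along the linear order, upwards or downwards.
  The order of the summands matters: from indecomposables \<open>X\<^sub>1 \<le> X\<^sub>2 \<le> X\<^sub>3\<close> of which only \<open>X\<^sub>3\<close> is
  isomorphic to its suspension one obtains a different graded endomorphism algebra than when only \<open>X\<^sub>2\<close> is.
\<close>

definition listed_in_order ::
  "('k::field, 'o, 'm::ab_group_add) tcat \<Rightarrow> nat \<Rightarrow> (nat \<Rightarrow> 'o) \<Rightarrow> bool" where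
  "listed_in_order T m P \<longleftrightarrow>
     (\<forall>i j. 1 \<le> i \<and> i < j \<and> j \<le> m \<longrightarrow> gen_le T (P i) (P j)) \<or>
     (\<forall>i j. 1 \<le> i \<and> i < j \<and> j \<le> m \<longrightarrow> gen_le T (P j) (P i))"


section \<open>Graded algebras\<close>

text \<open>\<open>hpart A d\<close> is the homogeneous part of degree \<open>d\<close>.\<close>

record ('k, 'a) graded_algebra = "('k, 'a) module" +
  hpart :: "int \<Rightarrow> 'a set"

definition graded_algebra_isos ::
  "('k, 'a) graded_algebra \<Rightarrow> ('k, 'b) graded_algebra \<Rightarrow> ('a \<Rightarrow> 'b) set" where
  "graded_algebra_isos A B = {\<phi> \<in> ring_iso A B.
     (\<forall>c. \<forall>x \<in> carrier A. \<phi> (c \<odot>\<^bsub>A\<^esub> x) = c \<odot>\<^bsub>B\<^esub> \<phi> x) \<and>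
     (\<forall>d. \<phi> ` hpart A d = hpart B d)}"

definition quotient_algebra ::
  "('k, 'a) graded_algebra \<Rightarrow> 'a set \<Rightarrow> ('k, 'a set) graded_algebra" where
  "quotient_algebra A I =
     \<lparr>carrier = carrier (A Quot I), mult = mult (A Quot I), one = one (A Quot I),
      zero = zero (A Quot I), add = add (A Quot I),
      smult = (\<lambda>c X. \<Union>x \<in> X. I +>\<^bsub>A\<^esub> (c \<odot>\<^bsub>A\<^esub> x)),
      hpart = (\<lambda>d. (\<lambda>x. I +>\<^bsub>A\<^esub> x) ` hpart A d)\<rparr>"

text \<open>
  An element \<open>u\<close> of the graded endomorphism algebra of \<open>Y\<close> is a finitely supported family of morphisms
  \<open>u\<^sub>i : Y \<rightarrow> Y[i]\<close>, and \<open>u v\<close> is determined by \<open>u\<^sub>j v\<^sub>i = u\<^sub>j[i] \<circ> v\<^sub>i\<close>.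
\<close>

definition graded_end_algebra ::
  "('k, 'o, 'm::ab_group_add) tcat \<Rightarrow> 'o \<Rightarrow> ('k, int \<Rightarrow>\<^sub>0 'm) graded_algebra" where
  "graded_end_algebra T Y =
     \<lparr>carrier = {u. \<forall>i. Poly_Mapping.lookup u i \<in> mor T Y (sh T i Y)},
      mult = (\<lambda>u v. \<Sum>j \<in> Poly_Mapping.keys u. \<Sum>i \<in> Poly_Mapping.keys v.
         Poly_Mapping.single (j + i) (shm T i (Poly_Mapping.lookup u j) \<cdot>\<^bsub>T\<^esub> Poly_Mapping.lookup v i)),
      one = Poly_Mapping.single 0 (ident T Y),
      zero = 0, add = (+),
      smult = (\<lambda>c. Poly_Mapping.map (scl T c)),
      hpart = (\<lambda>d. {Poly_Mapping.single d f | f. f \<in> mor T Y (sh T d Y)})\<rparr>"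


section \<open>Path algebras\<close>

text \<open>
  A graded quiver is a directed multigraph \<open>G\<close> with a degree for each arc. A path is a triple
  \<open>(u, p, v)\<close> where \<open>p\<close> is the list of arcs of a walk from \<open>u\<close> to \<open>v\<close>, in the order in which they
  are traversed; the trivial path at \<open>v\<close> is \<open>(v, [], v)\<close>.
\<close>

type_synonym ('v, 'a) qpath = "'v \<times> 'a list \<times> 'v"

definition qpaths :: "('v, 'a) pre_digraph \<Rightarrow> ('v, 'a) qpath set" where
  "qpaths G = {(u, p, v). pre_digraph.awalk G u p v}"

definition path_degree :: "('a \<Rightarrow> int) \<Rightarrow> ('v, 'a) qpath \<Rightarrow> int" where
  "path_degree dg = (\<lambda>(u, p, v). sum_list (map dg p))"

definition path_algebra ::
  "('v, 'a) pre_digraph \<Rightarrow> ('a \<Rightarrow> int) \<Rightarrow> ('k::comm_ring_1, ('v, 'a) qpath \<Rightarrow>\<^sub>0 'k) graded_algebra" where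
  "path_algebra G dg =
     \<lparr>carrier = {x. Poly_Mapping.keys x \<subseteq> qpaths G},
      mult = (\<lambda>x y. \<Sum>(u, p, v) \<in> Poly_Mapping.keys x. \<Sum>(u', q, w) \<in> Poly_Mapping.keys y.
         if v = u' then Poly_Mapping.single (u, p @ q, w)
             (Poly_Mapping.lookup x (u, p, v) * Poly_Mapping.lookup y (u', q, w))
         else 0),
      one = (\<Sum>v \<in> verts G. Poly_Mapping.single (v, [], v) 1),
      zero = 0, add = (+),
      smult = (\<lambda>c. Poly_Mapping.map ((*) c)),
      hpart = (\<lambda>d. {x. Poly_Mapping.keys x \<subseteq> {p \<in> qpaths G. path_degree dg p = d}})\<rparr>"


subsection \<open>The quiver and its relations\<close>

datatype arrow = Delta nat | Alpha nat | Beta nat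

text \<open>\<open>Delta a\<close> is the arrow from \<open>a\<close> to \<open>a + 1\<close>.\<close>

fun arrow_tail :: "arrow \<Rightarrow> nat" where
  "arrow_tail (Delta a) = a" | "arrow_tail (Alpha a) = a" | "arrow_tail (Beta a) = a"

fun arrow_head :: "arrow \<Rightarrow> nat" where
  "arrow_head (Delta a) = a + 1" | "arrow_head (Alpha a) = a" | "arrow_head (Beta a) = a"

fun arrow_degree :: "arrow \<Rightarrow> int" where
  "arrow_degree (Delta a) = 0" | "arrow_degree (Alpha a) = -1" | "arrow_degree (Beta a) = 1"

definition quiverQ :: "nat \<Rightarrow> (nat, arrow) pre_digraph" where
  "quiverQ n =
     \<lparr>verts = {1..2 * n - 1},
      arcs = Delta ` {1..2 * n - 2} \<union> Alpha ` {1..2 * n - 1} \<union> Beta ` {a \<in> {1..2 * n - 1}. even a},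
      tail = arrow_tail, head = arrow_head\<rparr>"

abbreviation kQ :: "nat \<Rightarrow> ('k::comm_ring_1, (nat, arrow) qpath \<Rightarrow>\<^sub>0 'k) graded_algebra" where
  "kQ n \<equiv> path_algebra (quiverQ n) arrow_degree"

abbreviation pth :: "nat \<Rightarrow> arrow list \<Rightarrow> nat \<Rightarrow> (nat, arrow) qpath \<Rightarrow>\<^sub>0 'k::comm_ring_1" where
  "pth u p v \<equiv> Poly_Mapping.single (u, p, v) 1"

definition relations :: "nat \<Rightarrow> ((nat, arrow) qpath \<Rightarrow>\<^sub>0 'k::comm_ring_1) set" where
  "relations n =
     {pth a [Alpha a, Beta a] a - pth a [] a | a. 1 \<le> a \<and> a \<le> 2 * n - 1 \<and> even a} \<union>
     {pth a [Beta a, Alpha a] a - pth a [] a | a. 1 \<le> a \<and> a \<le> 2 * n - 1 \<and> even a} \<union>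
     {pth b [Alpha b, Delta b] (b + 1) - pth b [Delta b, Alpha (b + 1)] (b + 1)
        | b. 1 \<le> b \<and> b + 1 \<le> 2 * n - 1} \<union>
     {pth a [Beta a, Delta a, Delta (a + 1)] (a + 2) - pth a [Delta a, Delta (a + 1), Beta (a + 2)] (a + 2)
        | a. 1 \<le> a \<and> a + 2 \<le> 2 * n - 1 \<and> even a}"

definition idealI :: "nat \<Rightarrow> ((nat, arrow) qpath \<Rightarrow>\<^sub>0 'k::comm_ring_1) set" where
  "idealI n = Idl\<^bsub>kQ n\<^esub> (relations n)"

end

theory Submission
  imports Defs
begin

text \<open>
  Write \<open>N = 2n - 1\<close> and number the summands so that \<open>P\<^sub>1 \<le> \<dots> \<le> P\<^sub>N\<close>; a list in the opposite
  order is reversed by \<open>i \<mapsto> 2n - i\<close>, which preserves parity. The order \<open>\<le>\<close> extends to all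
  (also negative) shifts of indecomposables of \<open>\<langle>H\<rangle>\<^sub>1\<close>, and on these it is a preorder, antisymmetric
  up to isomorphism and invariant under the suspension. Since \<open>P\<^sub>c \<cong> P\<^sub>c[1]\<close> for even \<open>c\<close>, the space
  of morphisms \<open>P\<^sub>b \<rightarrow> P\<^sub>a[d]\<close> is one-dimensional if \<open>a < b\<close>, or \<open>a = b\<close> and \<open>a\<close> is even or \<open>d \<le> 0\<close>
  (\<open>path_type a b d\<close>), and it is zero otherwise (\<open>le_of_path_type\<close>, \<open>mor_zero_of_not_path_type\<close>).
  By (G4), composites of nonzero morphisms between these spaces are nonzero (\<open>cmp_nonzero\<close>).

  Left multiplication by a nonzero morphism is therefore a bijection between the lines on which it
  acts. Fix a generator \<open>\<alpha>\<close> of the morphisms \<open>P\<^sub>1 \<rightarrow> P\<^sub>1[-1]\<close> and a nonzero morphism \<open>P\<^sub>b \<rightarrow> P\<^sub>1\<close> for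
  each \<open>b\<close>. All other lines are normalised by comparing with \<open>P\<^sub>1\<close>, and this gives basis vectors
  \<open>E a b d : P\<^sub>b \<rightarrow> P\<^sub>a[d]\<close> such that \<open>E a b d \<cdot> E b c e = E a c (d + e)\<close> with no scalar
  (\<open>ex_multiplicative_basis\<close>). So the graded endomorphism algebra has a basis indexed by the triples
  of path type, with the multiplication of a thin category.

  The types of paths in the quiver are exactly these triples, where \<open>d\<close> is the degree. Since
  \<open>E a b d \<cdot> E b c e\<close> is the composite \<open>P\<^sub>c \<rightarrow> P\<^sub>b[e] \<rightarrow> P\<^sub>a[d + e]\<close>, its indices are concatenated like paths.
  Sending a path from \<open>a\<close> to \<open>b\<close> of degree \<open>d\<close> to \<open>E a b d\<close>, which goes from \<open>P\<^sub>b\<close> to \<open>P\<^sub>a[d]\<close>,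
  therefore defines a surjective homomorphism \<open>\<Theta>\<close> of graded algebras. It kills the relations, because both sides of each have the same type. Conversely, modulo the relations
  each path is equal to a normal form that depends only on its type (\<open>eqv_normal_path\<close>), and the images of
  distinct normal forms are linearly independent; so the kernel is the ideal of relations
  (\<open>kernel_idealI\<close>).
\<close>

section \<open>The path algebra is a ring\<close>

lemma poly_mapping_single_induct [consumes 1, case_names zero single add]:
  assumes "Poly_Mapping.keys x \<subseteq> S"
    and "Q 0"
    and "\<And>s c. s \<in> S \<Longrightarrow> Q (Poly_Mapping.single s c)"
    and "\<And>x y. \<lbrakk>Poly_Mapping.keys x \<subseteq> S; Poly_Mapping.keys y \<subseteq> S; Q x; Q y\<rbrakk> \<Longrightarrow> Q (x + y)"
  shows "Q (x :: 'a \<Rightarrow>\<^sub>0 'b::comm_monoid_add)"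
proof -
  have "Poly_Mapping.keys (\<Sum>s\<in>F. Poly_Mapping.single s (c s)) \<subseteq> S \<and>
      Q (\<Sum>s\<in>F. Poly_Mapping.single s (c s))"
    if "finite F" "F \<subseteq> S" for F and c :: "'a \<Rightarrow> 'b"
    using that
  proof (induction F rule: finite_induct)
    case empty
    then show ?case using assms(2) by simp
  next
    case (insert s F)
    then show ?case
      using keys_add[of "Poly_Mapping.single s (c s)" "\<Sum>s\<in>F. Poly_Mapping.single s (c s)"]
      by (auto intro!: assms(3,4) split: if_splits)
  qed
  moreover have "x = (\<Sum>s\<in>Poly_Mapping.keys x. Poly_Mapping.single s (Poly_Mapping.lookup x s))"
    by (rule poly_mapping_eqI)
      (auto simp: lookup_sum lookup_single when_def in_keys_iff)
  ultimately show ?thesis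
    using assms(1) by (metis finite_keys)
qed

text \<open>The product of \<open>c s\<close> and \<open>t\<close> for paths \<open>s\<close>, \<open>t\<close> and a scalar \<open>c\<close>: concatenation if \<open>t\<close> starts where
  \<open>s\<close> ends, and zero otherwise.\<close>

definition path_prod :: "('v, 'a) qpath \<Rightarrow> ('v, 'a) qpath \<Rightarrow> 'k \<Rightarrow> ('v, 'a) qpath \<Rightarrow>\<^sub>0 'k::zero" where
  "path_prod s t c = (if snd (snd s) = fst t
     then Poly_Mapping.single (fst s, fst (snd s) @ fst (snd t), snd (snd t)) c else 0)"

lemma path_prod_simps [simp]:
  "path_prod (u, p, v) (u', q, w) c = (if v = u' then Poly_Mapping.single (u, p @ q, w) c else 0)"
  "path_prod s t 0 = 0"
  by (simp_all add: path_prod_def)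

lemma path_prod_add: "path_prod s t (c + c') = path_prod s t c + path_prod s t c'"
  by (simp add: path_prod_def single_add)

lemma path_algebra_sel:
  "carrier (path_algebra G dg) = {x. Poly_Mapping.keys x \<subseteq> qpaths G}"
  "zero (path_algebra G dg) = 0"
  "add (path_algebra G dg) = (+)"
  "one (path_algebra G dg) = (\<Sum>v \<in> verts G. Poly_Mapping.single (v, [], v) 1)"
  "smult (path_algebra G dg) = (\<lambda>c. Poly_Mapping.map ((*) c))"
  "hpart (path_algebra G dg) d = {x. Poly_Mapping.keys x \<subseteq> {p \<in> qpaths G. path_degree dg p = d}}"
  by (simp_all add: path_algebra_def)

text \<open>Summing over arbitrary finite sets that contain the supports makes the bilinearity of the
  product immediate.\<close>

lemma path_algebra_mult:
  assumes "finite S" "Poly_Mapping.keys x \<subseteq> S" "finite S'" "Poly_Mapping.keys y \<subseteq> S'"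
  shows "x \<otimes>\<^bsub>path_algebra G dg\<^esub> y =
    (\<Sum>s\<in>S. \<Sum>t\<in>S'. path_prod s t (Poly_Mapping.lookup x s * Poly_Mapping.lookup y t))"
proof -
  have "x \<otimes>\<^bsub>path_algebra G dg\<^esub> y = (\<Sum>s\<in>Poly_Mapping.keys x. \<Sum>t\<in>Poly_Mapping.keys y.
      path_prod s t (Poly_Mapping.lookup x s * Poly_Mapping.lookup y t))"
    by (auto simp: path_algebra_def path_prod_def split_def intro!: sum.cong)
  also have "\<dots> = (\<Sum>s\<in>Poly_Mapping.keys x. \<Sum>t\<in>S'.
      path_prod s t (Poly_Mapping.lookup x s * Poly_Mapping.lookup y t))"
    using assms by (intro sum.cong refl sum.mono_neutral_left) (auto simp: in_keys_iff)
  also have "\<dots> = (\<Sum>s\<in>S. \<Sum>t\<in>S'.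
      path_prod s t (Poly_Mapping.lookup x s * Poly_Mapping.lookup y t))"
    using assms by (intro sum.mono_neutral_left) (auto simp: in_keys_iff)
  finally show ?thesis .
qed

lemma path_algebra_mult_add_left:
  "(x + x') \<otimes>\<^bsub>path_algebra G dg\<^esub> y = x \<otimes>\<^bsub>path_algebra G dg\<^esub> y + x' \<otimes>\<^bsub>path_algebra G dg\<^esub> y"
proof -
  have "z \<otimes>\<^bsub>path_algebra G dg\<^esub> y = (\<Sum>s\<in>Poly_Mapping.keys x \<union> Poly_Mapping.keys x'.
      \<Sum>t\<in>Poly_Mapping.keys y. path_prod s t (Poly_Mapping.lookup z s * Poly_Mapping.lookup y t))"
    if "z \<in> {x, x', x + x'}" for z
    using that keys_add[of x x'] by (intro path_algebra_mult) auto
  then show ?thesis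
    by (simp add: lookup_add distrib_right path_prod_add sum.distrib)
qed

lemma path_algebra_mult_add_right:
  "x \<otimes>\<^bsub>path_algebra G dg\<^esub> (y + y') = x \<otimes>\<^bsub>path_algebra G dg\<^esub> y + x \<otimes>\<^bsub>path_algebra G dg\<^esub> y'"
proof -
  have "x \<otimes>\<^bsub>path_algebra G dg\<^esub> z = (\<Sum>s\<in>Poly_Mapping.keys x.
      \<Sum>t\<in>Poly_Mapping.keys y \<union> Poly_Mapping.keys y'.
        path_prod s t (Poly_Mapping.lookup x s * Poly_Mapping.lookup z t))"
    if "z \<in> {y, y', y + y'}" for z
    using that keys_add[of y y'] by (intro path_algebra_mult) auto
  then show ?thesis
    by (simp add: lookup_add distrib_left path_prod_add sum.distrib)
qed

lemma path_algebra_mult_zero [simp]: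
  "0 \<otimes>\<^bsub>path_algebra G dg\<^esub> y = 0" "x \<otimes>\<^bsub>path_algebra G dg\<^esub> 0 = 0"
  by (simp_all add: path_algebra_mult[OF finite_keys order_refl finite_keys order_refl])

lemma path_algebra_mult_sum_left:
  "(\<Sum>i\<in>S. x i) \<otimes>\<^bsub>path_algebra G dg\<^esub> y = (\<Sum>i\<in>S. x i \<otimes>\<^bsub>path_algebra G dg\<^esub> y)"
  by (induction S rule: infinite_finite_induct) (simp_all add: path_algebra_mult_add_left)

lemma path_algebra_mult_sum_right:
  "x \<otimes>\<^bsub>path_algebra G dg\<^esub> (\<Sum>i\<in>S. y i) = (\<Sum>i\<in>S. x \<otimes>\<^bsub>path_algebra G dg\<^esub> y i)"
  by (induction S rule: infinite_finite_induct) (simp_all add: path_algebra_mult_add_right)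

lemma path_algebra_mult_single:
  "Poly_Mapping.single s c \<otimes>\<^bsub>path_algebra G dg\<^esub> Poly_Mapping.single t c' = path_prod s t (c * c')"
  by (subst path_algebra_mult[where S = "{s}" and S' = "{t}"]) auto

lemma (in wf_digraph) path_algebra_mult_closed:
  assumes "Poly_Mapping.keys x \<subseteq> qpaths G" "Poly_Mapping.keys y \<subseteq> qpaths G"
  shows "Poly_Mapping.keys (x \<otimes>\<^bsub>path_algebra G dg\<^esub> y) \<subseteq> qpaths G"
  using assms(1)
proof (induction x rule: poly_mapping_single_induct)
  case (single s c)
  from assms(2) show ?case
  proof (induction y rule: poly_mapping_single_induct)
    case (single t c')
    then show ?case
      using \<open>s \<in> qpaths G\<close>
      by (cases s; cases t) (auto simp: path_algebra_mult_single qpaths_def split: if_splits)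
  next
    case (add y y')
    then show ?case
      unfolding path_algebra_mult_add_right
      by (intro order_trans[OF keys_add] Un_least)
  qed simp
next
  case (add x x')
  then show ?case
    unfolding path_algebra_mult_add_left
    by (intro order_trans[OF keys_add] Un_least)
qed simp

lemma path_algebra_mult_assoc:
  "(x \<otimes>\<^bsub>path_algebra G dg\<^esub> y) \<otimes>\<^bsub>path_algebra G dg\<^esub> z = x \<otimes>\<^bsub>path_algebra G dg\<^esub> (y \<otimes>\<^bsub>path_algebra G dg\<^esub> z)"
proof (induction x rule: poly_mapping_single_induct[OF subset_UNIV])
  case (2 s c)
  show ?case
  proof (induction y rule: poly_mapping_single_induct[OF subset_UNIV])
    case (2 t c')
    show ?case
    proof (induction z rule: poly_mapping_single_induct[OF subset_UNIV])
      case (2 r c'')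
      show ?case
        by (cases s; cases t; cases r) (simp add: path_algebra_mult_single mult.assoc)
    qed (simp_all add: path_algebra_mult_add_right)
  qed (simp_all add: path_algebra_mult_add_left path_algebra_mult_add_right)
qed (simp_all add: path_algebra_mult_add_left)

lemma (in wf_digraph) ring_path_algebra:
  assumes "finite (verts G)"
  shows "ring (path_algebra G dg :: ('k::comm_ring_1, _) graded_algebra)"
proof -
  let ?A = "path_algebra G dg :: ('k, _) graded_algebra"
  have one: "Poly_Mapping.keys (\<one>\<^bsub>?A\<^esub>) \<subseteq> qpaths G"
    unfolding path_algebra_sel
    by (rule order_trans[OF keys_sum]) (auto simp: qpaths_def awalk_Nil_iff)
  have vert: "fst s \<in> verts G \<and> snd (snd s) \<in> verts G" if "s \<in> qpaths G" for s
    using that by (auto simp: qpaths_def)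
  have one_l: "\<one>\<^bsub>?A\<^esub> \<otimes>\<^bsub>?A\<^esub> x = x" if "Poly_Mapping.keys x \<subseteq> qpaths G" for x
    using that
  proof (induction x rule: poly_mapping_single_induct)
    case (single s c)
    then show ?case
      using vert[of s] assms
      by (cases s) (simp add: path_algebra_sel path_algebra_mult_sum_left path_algebra_mult_single)
  qed (simp_all add: path_algebra_mult_add_right)
  have one_r: "x \<otimes>\<^bsub>?A\<^esub> \<one>\<^bsub>?A\<^esub> = x" if "Poly_Mapping.keys x \<subseteq> qpaths G" for x
    using that
  proof (induction x rule: poly_mapping_single_induct)
    case (single s c)
    then show ?case
      using vert[of s] assms
      by (cases s) (simp add: path_algebra_sel path_algebra_mult_sum_right path_algebra_mult_single)
  qed (simp_all add: path_algebra_mult_add_left)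
  show ?thesis
  proof (rule ringI)
    show "abelian_group ?A"
    proof (rule abelian_groupI)
      fix x y assume "x \<in> carrier ?A" "y \<in> carrier ?A"
      then show "x \<oplus>\<^bsub>?A\<^esub> y \<in> carrier ?A"
        using keys_add[of x y] by (auto simp: path_algebra_sel)
    next
      fix x assume "x \<in> carrier ?A"
      then show "\<exists>y\<in>carrier ?A. y \<oplus>\<^bsub>?A\<^esub> x = \<zero>\<^bsub>?A\<^esub>"
        by (intro bexI[of _ "- x"]) (auto simp: path_algebra_sel)
    qed (auto simp: path_algebra_sel ac_simps)
    show "monoid ?A"
      using one
      by (intro monoidI)
        (simp_all add: path_algebra_sel(1) one_l one_r path_algebra_mult_closed path_algebra_mult_assoc)
  qed (simp_all add: path_algebra_sel(3) path_algebra_mult_add_left path_algebra_mult_add_right)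
qed

lemma lookup_map_zero:
  "f 0 = 0 \<Longrightarrow> Poly_Mapping.lookup (Poly_Mapping.map f x) s = f (Poly_Mapping.lookup x s)"
  by (simp add: Poly_Mapping.map.rep_eq when_def)

section \<open>Paths in the quiver modulo the relations\<close>

lemma quiverQ_sel [simp]:
  "verts (quiverQ n) = {1..2 * n - 1}"
  "tail (quiverQ n) = arrow_tail" "head (quiverQ n) = arrow_head"
  by (simp_all add: quiverQ_def)

lemma arcs_quiverQ [simp]:
  "Delta a \<in> arcs (quiverQ n) \<longleftrightarrow> 1 \<le> a \<and> a + 1 \<le> 2 * n - 1"
  "Alpha a \<in> arcs (quiverQ n) \<longleftrightarrow> 1 \<le> a \<and> a \<le> 2 * n - 1"
  "Beta a \<in> arcs (quiverQ n) \<longleftrightarrow> 1 \<le> a \<and> a \<le> 2 * n - 1 \<and> even a"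
  by (auto simp: quiverQ_def)

interpretation quiverQ: wf_digraph "quiverQ n" for n
  by standard (auto simp: quiverQ_def)

lemma ring_kQ: "ring (kQ n :: ('k::comm_ring_1, _) graded_algebra)"
  by (rule quiverQ.ring_path_algebra) simp

text \<open>The triples (source, target, degree) that are realised by paths. A path never goes back to a smaller
  vertex, and a path of positive degree needs an even vertex, which exists between \<open>a\<close> and \<open>b\<close>
  unless \<open>a = b\<close> is odd.\<close>

definition path_type :: "nat \<Rightarrow> nat \<Rightarrow> int \<Rightarrow> bool" where
  "path_type a b d \<longleftrightarrow> a \<le> b \<and> (d \<le> 0 \<or> a < b \<or> even a)"

lemma path_type_comp: "path_type a b d \<Longrightarrow> path_type b c e \<Longrightarrow> path_type a c (d + e)"
  by (cases "a = b"; cases "b = c") (auto simp: path_type_def)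

lemma path_type_awalk:
  "quiverQ.awalk n a p b \<Longrightarrow> path_type a b (sum_list (map arrow_degree p))"
proof (induction p arbitrary: a)
  case Nil
  then show ?case by (auto simp: path_type_def quiverQ.awalk_Nil_iff)
next
  case (Cons x p)
  then have "path_type (arrow_head x) b (sum_list (map arrow_degree p))"
    by (auto simp: quiverQ.awalk_Cons_iff)
  moreover have "path_type a (arrow_head x) (arrow_degree x)"
    using Cons.prems by (cases x) (auto simp: quiverQ.awalk_Cons_iff path_type_def)
  ultimately show ?case
    using path_type_comp by fastforce
qed

text \<open>The path \<open>a \<rightarrow> a + 1 \<rightarrow> \<dots> \<rightarrow> b\<close>; it is trivial for \<open>a = b\<close>.\<close>

definition deltas :: "nat \<Rightarrow> nat \<Rightarrow> arrow list" where
  "deltas a b = map Delta [a..<b]"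

text \<open>The normal form of the paths from \<open>a\<close> to \<open>b\<close> of degree \<open>d\<close>: loops of only one kind occur, the
  loops \<open>\<alpha>\<close> at \<open>a\<close> if \<open>d \<le> 0\<close>, and the loops \<open>\<beta>\<close> at the first even vertex from \<open>a\<close> on if \<open>d > 0\<close>.\<close>

definition normal_path :: "nat \<Rightarrow> nat \<Rightarrow> int \<Rightarrow> arrow list" where
  "normal_path a b d =
     (if d \<le> 0 then replicate (nat (- d)) (Alpha a) @ deltas a b
      else if even a then replicate (nat d) (Beta a) @ deltas a b
      else Delta a # replicate (nat d) (Beta (a + 1)) @ deltas (a + 1) b)"

lemma awalk_deltas:
  assumes "1 \<le> a" "b \<le> 2 * n - 1" "a \<le> b"
  shows "quiverQ.awalk n a (deltas a b) b"
  using assms(3,1,2)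
proof (induction rule: inc_induct)
  case base
  then show ?case by (simp add: deltas_def quiverQ.awalk_Nil_iff)
next
  case (step a)
  then show ?case
    by (simp add: deltas_def upt_rec[of a] quiverQ.awalk_Cons_iff)
qed

lemma deltas_Cons: "a < b \<Longrightarrow> deltas a b = Delta a # deltas (a + 1) b"
  by (simp add: deltas_def upt_rec[of a])

lemma awalk_replicate_loop:
  assumes "quiverQ.awalk n a [x] a"
  shows "quiverQ.awalk n a (replicate k x) a"
  using assms by (induction k) (auto simp: quiverQ.awalk_simps)

lemma awalk_loop_deltas:
  assumes "quiverQ.awalk n a [x] a" "a \<le> b" "b \<le> 2 * n - 1"
  shows "quiverQ.awalk n a (replicate k x @ deltas a b) b"
  using assms awalk_deltas[of a b n] quiverQ.awalk_hd_in_verts[OF assms(1)]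
  by (intro quiverQ.awalk_appendI[OF awalk_replicate_loop]) auto

lemma awalk_Alpha_deltas:
  assumes "1 \<le> a" "a \<le> b" "b \<le> 2 * n - 1"
  shows "quiverQ.awalk n a (replicate k (Alpha a) @ deltas a b) b"
  using assms by (intro awalk_loop_deltas) (auto simp: quiverQ.awalk_simps)

lemma awalk_Beta_deltas:
  assumes "1 \<le> a" "a \<le> b" "b \<le> 2 * n - 1" "even a"
  shows "quiverQ.awalk n a (replicate k (Beta a) @ deltas a b) b"
  using assms by (intro awalk_loop_deltas) (auto simp: quiverQ.awalk_simps)

lemma awalk_normal_path:
  assumes "1 \<le> a" "b \<le> 2 * n - 1" "path_type a b d"
  shows "quiverQ.awalk n a (normal_path a b d) b"
proof -
  have "even a \<or> even (a + 1)" by simp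
  then show ?thesis
    using assms awalk_Alpha_deltas[of a b n] awalk_Beta_deltas[of _ b n]
    by (auto simp: normal_path_def path_type_def quiverQ.awalk_Cons_iff)
qed

lemma degree_normal_path:
  "sum_list (map arrow_degree (normal_path a b d)) = d"
proof -
  have "sum_list (map arrow_degree (deltas a b)) = 0" for a b
    by (auto simp: deltas_def comp_def intro!: sum_list_0)
  then show ?thesis
    by (simp add: normal_path_def sum_list_replicate)
qed

text \<open>An ideal in which the relations hold.\<close>

locale quiver_relations =
  fixes n :: nat and I :: "((nat, arrow) qpath \<Rightarrow>\<^sub>0 'k::comm_ring_1) set"
  assumes ideal_I: "ideal I (kQ n)"
    and relations_I: "relations n \<subseteq> I"
begin

text \<open>Two paths from \<open>u\<close> to \<open>v\<close> are equal modulo the ideal.\<close>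

definition eqv :: "nat \<Rightarrow> nat \<Rightarrow> arrow list \<Rightarrow> arrow list \<Rightarrow> bool" where
  "eqv u v p q \<longleftrightarrow> pth u p v - pth u q v \<in> I"

lemma I_add: "x \<in> I \<Longrightarrow> y \<in> I \<Longrightarrow> x + y \<in> I"
  using additive_subgroup.a_closed[OF ideal.axioms(1)[OF ideal_I], of x y]
  by (simp add: path_algebra_sel)

lemma I_zero: "0 \<in> I"
  using additive_subgroup.zero_closed[OF ideal.axioms(1)[OF ideal_I]]
  by (simp add: path_algebra_sel)

lemma I_mult:
  assumes "x \<in> I" "y \<in> carrier (kQ n)"
  shows "x \<otimes>\<^bsub>kQ n\<^esub> y \<in> I" "y \<otimes>\<^bsub>kQ n\<^esub> x \<in> I"
  using ideal.I_r_closed[OF ideal_I assms] ideal.I_l_closed[OF ideal_I assms] by auto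

lemma pth_carrier: "quiverQ.awalk n u p v \<Longrightarrow> Poly_Mapping.single (u, p, v) c \<in> carrier (kQ n)"
  by (auto simp: path_algebra_sel qpaths_def)

lemma pth_mult:
  "pth u p v \<otimes>\<^bsub>kQ n\<^esub> (pth v q w :: _ \<Rightarrow>\<^sub>0 'k) = pth u (p @ q) w"
  by (simp add: path_algebra_mult_single)

text \<open>Scalars act as multiplication by multiples of the identity, which is the sum of the trivial
  paths.\<close>

lemma I_scale:
  assumes "x \<in> I" shows "Poly_Mapping.map ((*) c) x \<in> I"
proof -
  let ?c = "\<Sum>v\<in>verts (quiverQ n). Poly_Mapping.single (v, [], v) c"
  have c: "?c \<in> carrier (kQ n)"
    unfolding path_algebra_sel
    using keys_sum[of "\<lambda>v. Poly_Mapping.single (v, [], v) c" "verts (quiverQ n)"]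
    by (fastforce simp: qpaths_def quiverQ.awalk_Nil_iff split: if_splits)
  have "Poly_Mapping.keys x \<subseteq> qpaths (quiverQ n)"
    using additive_subgroup.a_subset[OF ideal.axioms(1)[OF ideal_I]] assms
    by (auto simp: path_algebra_sel)
  then have "Poly_Mapping.map ((*) c) x = ?c \<otimes>\<^bsub>kQ n\<^esub> x"
  proof (induction x rule: poly_mapping_single_induct)
    case (single s c')
    then have "fst s \<in> verts (quiverQ n)"
      by (auto simp: qpaths_def)
    then show ?case
      by (cases s) (simp add: path_algebra_mult_sum_left path_algebra_mult_single)
  next
    case (add x y)
    have "Poly_Mapping.map ((*) c) (x + y) = Poly_Mapping.map ((*) c) x + Poly_Mapping.map ((*) c) y"
      by (rule poly_mapping_eqI) (simp add: lookup_add distrib_left lookup_map_zero)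
    with add show ?case by (simp add: path_algebra_mult_add_right)
  qed (simp add: poly_mapping_eq_iff fun_eq_iff lookup_map_zero)
  with I_mult(2)[OF assms c] show ?thesis by simp
qed

lemma I_uminus: "x \<in> I \<Longrightarrow> - x \<in> I"
proof -
  assume "x \<in> I"
  moreover have "- x = Poly_Mapping.map ((*) (- 1)) x"
    by (rule poly_mapping_eqI) (simp add: lookup_map_zero)
  ultimately show ?thesis using I_scale by metis
qed

lemma eqv_refl [simp]: "eqv u v p p"
  by (simp add: eqv_def I_zero)

lemma eqv_sym: "eqv u v p q \<Longrightarrow> eqv u v q p"
  unfolding eqv_def using I_uminus by fastforce

lemma eqv_trans [trans]: "eqv u v p q \<Longrightarrow> eqv u v q r \<Longrightarrow> eqv u v p r"
  unfolding eqv_def using I_add by fastforce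

lemma eqv_context:
  assumes "eqv a b p q" "quiverQ.awalk n u r a" "quiverQ.awalk n b s v"
  shows "eqv u v (r @ p @ s) (r @ q @ s)"
proof -
  let ?r = "pth u r a :: _ \<Rightarrow>\<^sub>0 'k" and ?s = "pth b s v :: _ \<Rightarrow>\<^sub>0 'k"
  let ?x = "pth a p b - pth a q b :: _ \<Rightarrow>\<^sub>0 'k"
  have diff: "x \<otimes>\<^bsub>kQ n\<^esub> (y - z) = x \<otimes>\<^bsub>kQ n\<^esub> y - x \<otimes>\<^bsub>kQ n\<^esub> z"
    "(y - z) \<otimes>\<^bsub>kQ n\<^esub> x = y \<otimes>\<^bsub>kQ n\<^esub> x - z \<otimes>\<^bsub>kQ n\<^esub> x" for x y z :: "_ \<Rightarrow>\<^sub>0 'k"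
    using path_algebra_mult_add_right[where x = x and y = "y - z" and y' = z]
      path_algebra_mult_add_left[where x = "y - z" and x' = z and y = x]
    by (simp_all add: eq_diff_eq flip: path_algebra_mult_add_right path_algebra_mult_add_left)
  have "?r \<otimes>\<^bsub>kQ n\<^esub> (?x \<otimes>\<^bsub>kQ n\<^esub> ?s) \<in> I"
    using assms by (intro I_mult pth_carrier) (simp_all add: eqv_def)
  then show ?thesis
    by (simp add: diff pth_mult eqv_def)
qed

lemma eqv_Cons:
  assumes "eqv (arrow_head x) b p q" "x \<in> arcs (quiverQ n)" "quiverQ.awalk n (arrow_head x) p b"
  shows "eqv (arrow_tail x) b (x # p) (x # q)"
proof -
  have "quiverQ.awalk n (arrow_tail x) [x] (arrow_head x)"
    using quiverQ.arc_implies_awalk[OF assms(2)] by simp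
  moreover have "quiverQ.awalk n b [] b"
    using assms(3) by (auto simp: quiverQ.awalk_Nil_iff)
  ultimately show ?thesis
    using eqv_context[OF assms(1), of "arrow_tail x" "[x]" "[]" b] by simp
qed

lemma eqv_append:
  assumes "eqv u a p q" "quiverQ.awalk n u p a" "quiverQ.awalk n a s v"
  shows "eqv u v (p @ s) (q @ s)"
proof -
  have "quiverQ.awalk n u [] u"
    using assms(2) by (auto simp: quiverQ.awalk_Nil_iff)
  then show ?thesis
    using eqv_context[OF assms(1) _ assms(3), of u "[]"] by simp
qed

lemma eqv_loop_power:
  assumes d: "quiverQ.awalk n u d v" and x: "quiverQ.awalk n u [x] u" and y: "quiverQ.awalk n v [y] v"
    and xy: "eqv u v (x # d) (d @ [y])"
  shows "eqv u v (replicate k x @ d) (d @ replicate k y)"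
proof (induction k)
  case (Suc k)
  have xu: "arrow_head x = u" "arrow_tail x = u" "x \<in> arcs (quiverQ n)"
    using x by (auto simp: quiverQ.awalk_simps)
  have "quiverQ.awalk n u (replicate k x @ d) v"
    by (rule quiverQ.awalk_appendI[OF awalk_replicate_loop[OF x] d])
  then have "eqv u v (x # replicate k x @ d) (x # d @ replicate k y)"
    using eqv_Cons[of x v "replicate k x @ d" "d @ replicate k y"] Suc xu by auto
  also have "x # d @ replicate k y = (x # d) @ replicate k y" by simp
  also have "eqv u v \<dots> ((d @ [y]) @ replicate k y)"
    using xu d by (intro eqv_append[OF xy] awalk_replicate_loop[OF y])
      (auto simp: quiverQ.awalk_Cons_iff)
  finally show ?case by simp
qed simp

lemma eqv_relations:
  shows "1 \<le> a \<Longrightarrow> a \<le> 2 * n - 1 \<Longrightarrow> even a \<Longrightarrow> eqv a a [Alpha a, Beta a] []"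
    and "1 \<le> a \<Longrightarrow> a \<le> 2 * n - 1 \<Longrightarrow> even a \<Longrightarrow> eqv a a [Beta a, Alpha a] []"
    and "1 \<le> a \<Longrightarrow> a + 1 \<le> 2 * n - 1 \<Longrightarrow>
      eqv a (a + 1) [Alpha a, Delta a] [Delta a, Alpha (a + 1)]"
    and "1 \<le> a \<Longrightarrow> a + 2 \<le> 2 * n - 1 \<Longrightarrow> even a \<Longrightarrow>
      eqv a (a + 2) [Beta a, Delta a, Delta (a + 1)] [Delta a, Delta (a + 1), Beta (a + 2)]"
  unfolding eqv_def by (rule subsetD[OF relations_I], force simp: relations_def)+

lemma eqv_Alpha_Delta:
  assumes "1 \<le> a" "a < b" "b \<le> 2 * n - 1"
  shows "eqv a b (replicate k (Alpha a) @ deltas a b)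
    (Delta a # replicate k (Alpha (a + 1)) @ deltas (a + 1) b)"
proof -
  have x: "quiverQ.awalk n a [Alpha a] a" "quiverQ.awalk n (a + 1) [Alpha (a + 1)] (a + 1)"
    and d: "quiverQ.awalk n a [Delta a] (a + 1)"
    using assms by (auto simp: quiverQ.awalk_simps)
  have "eqv a b ((replicate k (Alpha a) @ [Delta a]) @ deltas (a + 1) b)
    (([Delta a] @ replicate k (Alpha (a + 1))) @ deltas (a + 1) b)"
  proof (rule eqv_append)
    show "eqv a (a + 1) (replicate k (Alpha a) @ [Delta a]) ([Delta a] @ replicate k (Alpha (a + 1)))"
      using assms eqv_relations(3)[of a] by (intro eqv_loop_power x d) auto
    show "quiverQ.awalk n a (replicate k (Alpha a) @ [Delta a]) (a + 1)"
      by (rule quiverQ.awalk_appendI[OF awalk_replicate_loop[OF x(1)] d])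
    show "quiverQ.awalk n (a + 1) (deltas (a + 1) b) b"
      using assms by (intro awalk_deltas) auto
  qed
  then show ?thesis
    using assms by (simp add: deltas_Cons)
qed

lemma eqv_Beta_Delta:
  assumes "1 \<le> a" "a + 1 < b" "b \<le> 2 * n - 1" "even a"
  shows "eqv a b (replicate k (Beta a) @ deltas a b)
    (Delta a # Delta (a + 1) # replicate k (Beta (a + 2)) @ deltas (a + 2) b)"
proof -
  let ?d = "[Delta a, Delta (a + 1)]"
  have x: "quiverQ.awalk n a [Beta a] a" "quiverQ.awalk n (a + 2) [Beta (a + 2)] (a + 2)"
    and d: "quiverQ.awalk n a ?d (a + 2)"
    using assms by (auto simp: quiverQ.awalk_simps)
  have "eqv a b ((replicate k (Beta a) @ ?d) @ deltas (a + 2) b)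
    ((?d @ replicate k (Beta (a + 2))) @ deltas (a + 2) b)"
  proof (rule eqv_append)
    show "eqv a (a + 2) (replicate k (Beta a) @ ?d) (?d @ replicate k (Beta (a + 2)))"
      using assms eqv_relations(4)[of a] by (intro eqv_loop_power x d) auto
    show "quiverQ.awalk n a (replicate k (Beta a) @ ?d) (a + 2)"
      by (rule quiverQ.awalk_appendI[OF awalk_replicate_loop[OF x(1)] d])
    show "quiverQ.awalk n (a + 2) (deltas (a + 2) b) b"
      using assms by (intro awalk_deltas) auto
  qed
  then show ?thesis
    using assms by (simp add: deltas_Cons)
qed

lemma eqv_cancel:
  assumes "eqv a a [x, y] []" "quiverQ.awalk n a [x, y] a" "quiverQ.awalk n a p b"
  shows "eqv a b (x # y # p) p"
  using eqv_append[OF assms] by simp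

text \<open>Normal forms are closed, modulo the ideal, under multiplication by an arrow on the left.\<close>

lemma eqv_Cons_normal_path:
  assumes x: "x \<in> arcs (quiverQ n)" and b: "b \<le> 2 * n - 1" and t: "path_type (arrow_head x) b d"
  shows "eqv (arrow_tail x) b (x # normal_path (arrow_head x) b d)
    (normal_path (arrow_tail x) b (arrow_degree x + d))"
proof (cases x)
  case (Delta a)
  have a: "1 \<le> a" "a < b"
    using x t by (auto simp: Delta path_type_def)
  show ?thesis
  proof (cases "d \<le> 0")
    case True
    then show ?thesis
      using eqv_sym[OF eqv_Alpha_Delta[OF a b]] by (simp add: Delta normal_path_def)
  next
    case False
    show ?thesis
    proof (cases "even a")
      case True
      then have "a + 1 < b"
        using False t a by (auto simp: Delta path_type_def intro: Suc_lessI)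
      then show ?thesis
        using eqv_sym[OF eqv_Beta_Delta[OF a(1) _ b True]] True False
        by (simp add: Delta normal_path_def)
    qed (use False in \<open>simp add: Delta normal_path_def\<close>)
  qed
next
  case (Alpha a)
  have a: "1 \<le> a" "a \<le> b"
    using x t by (auto simp: Alpha path_type_def)
  show ?thesis
  proof (cases "d \<le> 0")
    case True
    then have "nat (1 - d) = Suc (nat (- d))" by simp
    with True show ?thesis by (simp add: Alpha normal_path_def)
  next
    case False
    define k where "k = nat (d - 1)"
    have k: "nat d = Suc k" "nat (d - 1) = k" "d \<ge> 1"
      using False by (auto simp: k_def)
    have cancel: "eqv c b (Alpha c # Beta c # replicate k (Beta c) @ deltas c b)
       (replicate k (Beta c) @ deltas c b)" if "even c" "a \<le> c" "c \<le> b" for c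
      using that a b
      by (intro eqv_cancel[OF eqv_relations(1) _ awalk_Beta_deltas]) (auto simp: quiverQ.awalk_simps)
    show ?thesis
    proof (cases "even a")
      case True
      then show ?thesis
        using cancel[of a] a k by (auto simp: Alpha normal_path_def)
    next
      case False
      let ?p = "replicate k (Beta (a + 1)) @ deltas (a + 1) b"
      have ab: "a < b"
        using False t k by (auto simp: Alpha path_type_def)
      have p: "quiverQ.awalk n (a + 1) (Beta (a + 1) # ?p) b"
        using awalk_Beta_deltas[of "a + 1" b n "Suc k"] ab b False a by simp
      have "eqv a b ([Alpha a, Delta a] @ Beta (a + 1) # ?p) ([Delta a, Alpha (a + 1)] @ Beta (a + 1) # ?p)"
        using a ab b by (intro eqv_append[OF eqv_relations(3) _ p]) (auto simp: quiverQ.awalk_simps)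
      also have "[Delta a, Alpha (a + 1)] @ Beta (a + 1) # ?p = Delta a # Alpha (a + 1) # Beta (a + 1) # ?p"
        by simp
      also have "eqv a b \<dots> (Delta a # ?p)"
        using eqv_Cons[of "Delta a" b "Alpha (a + 1) # Beta (a + 1) # ?p" ?p] cancel[of "a + 1"] a ab b p False
        by (simp add: quiverQ.awalk_Cons_iff)
      also have "Delta a # ?p = normal_path a b (d - 1)"
        using False ab k by (auto simp: normal_path_def deltas_Cons)
      finally show ?thesis
        using False k by (simp add: Alpha normal_path_def)
    qed
  qed
next
  case (Beta a)
  have a: "1 \<le> a" "a \<le> b" "even a"
    using x t by (auto simp: Beta path_type_def)
  show ?thesis
  proof (cases "d < 0")
    case True
    define k where "k = nat (- 1 - d)"
    have k: "nat (- d) = Suc k" "nat (- 1 - d) = k"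
      using True by (auto simp: k_def)
    have "eqv a b (Beta a # Alpha a # replicate k (Alpha a) @ deltas a b)
       (replicate k (Alpha a) @ deltas a b)"
      using a b
      by (intro eqv_cancel[OF eqv_relations(2) _ awalk_Alpha_deltas]) (auto simp: quiverQ.awalk_simps)
    then show ?thesis
      using True by (simp add: Beta normal_path_def k)
  next
    case False
    then have "nat (1 + d) = Suc (nat d)" by simp
    with False a show ?thesis by (cases "d = 0") (auto simp: Beta normal_path_def)
  qed
qed

lemma eqv_normal_path:
  "quiverQ.awalk n a p b \<Longrightarrow> eqv a b p (normal_path a b (sum_list (map arrow_degree p)))"
proof (induction p arbitrary: a)
  case Nil
  then show ?case by (simp add: quiverQ.awalk_Nil_iff normal_path_def deltas_def)
next
  case (Cons x p)
  let ?d = "sum_list (map arrow_degree p)"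
  have x: "x \<in> arcs (quiverQ n)" "a = arrow_tail x" and p: "quiverQ.awalk n (arrow_head x) p b"
    using Cons.prems by (auto simp: quiverQ.awalk_Cons_iff)
  have "eqv a b (x # p) (x # normal_path (arrow_head x) b ?d)"
    using eqv_Cons[OF Cons.IH[OF p] x(1) p] x(2) by simp
  also have "eqv a b \<dots> (normal_path a b (arrow_degree x + ?d))"
    using eqv_Cons_normal_path[OF x(1) _ path_type_awalk[OF p]] x(2) quiverQ.awalk_last_in_verts[OF p]
    by simp
  finally show ?case by simp
qed

end

section \<open>One-dimensional morphism spaces\<close>

context linear_category
begin

interpretation vs: vector_space "scl T"
  by (rule vector_space_scl)

lemma mor_zero [simp]: "X \<in> obj T \<Longrightarrow> Y \<in> obj T \<Longrightarrow> 0 \<in> mor T X Y"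
  using vs.subspace_0[OF subspace_mor] by blast

lemma mor_add: "X \<in> obj T \<Longrightarrow> Y \<in> obj T \<Longrightarrow> f \<in> mor T X Y \<Longrightarrow> g \<in> mor T X Y \<Longrightarrow> f + g \<in> mor T X Y"
  using vs.subspace_add[OF subspace_mor] by blast

lemma mor_scl: "X \<in> obj T \<Longrightarrow> Y \<in> obj T \<Longrightarrow> f \<in> mor T X Y \<Longrightarrow> scl T c f \<in> mor T X Y"
  using vs.subspace_scale[OF subspace_mor] by blast

lemma mor_diff: "X \<in> obj T \<Longrightarrow> Y \<in> obj T \<Longrightarrow> f \<in> mor T X Y \<Longrightarrow> g \<in> mor T X Y \<Longrightarrow> f - g \<in> mor T X Y"
  using vs.subspace_diff[OF subspace_mor] by blast

lemma mor_sum: "X \<in> obj T \<Longrightarrow> Y \<in> obj T \<Longrightarrow> (\<And>i. i \<in> S \<Longrightarrow> f i \<in> mor T X Y) \<Longrightarrow> (\<Sum>i\<in>S. f i) \<in> mor T X Y"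
  using vs.subspace_sum[OF subspace_mor] by blast

lemma scl_simps [simp]: "scl T 0 f = 0" "scl T 1 f = f" "scl T c 0 = 0"
  by auto

lemma scl_eq_0_iff: "scl T c f = 0 \<longleftrightarrow> c = 0 \<or> f = 0"
  by (rule vs.scale_eq_0_iff)

lemma scl_add_left: "scl T (c + d) f = scl T c f + scl T d f"
  by (rule vs.scale_left_distrib)

lemma scl_add_right: "scl T c (f + g) = scl T c f + scl T c g"
  by (rule vs.scale_right_distrib)

lemma scl_scl: "scl T c (scl T d f) = scl T (c * d) f"
  by (rule vs.scale_scale)

lemma scl_cancel: "f \<noteq> 0 \<Longrightarrow> scl T c f = scl T d f \<Longrightarrow> c = d"
  by simp

lemma cmp_zero_left: "X \<in> obj T \<Longrightarrow> Y \<in> obj T \<Longrightarrow> Z \<in> obj T \<Longrightarrow> f \<in> mor T X Y \<Longrightarrow> 0 \<cdot> f = 0"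
  using cmp_scl_left[of X Y Z f 0 0] by simp

lemma cmp_zero_right: "X \<in> obj T \<Longrightarrow> Y \<in> obj T \<Longrightarrow> Z \<in> obj T \<Longrightarrow> g \<in> mor T Y Z \<Longrightarrow> g \<cdot> 0 = 0"
  using cmp_scl_right[of X Y Z 0 g 0] by simp

lemma cmp_sum_left:
  assumes "X \<in> obj T" "Y \<in> obj T" "Z \<in> obj T" "f \<in> mor T X Y" "\<And>i. i \<in> S \<Longrightarrow> g i \<in> mor T Y Z"
  shows "(\<Sum>i\<in>S. g i) \<cdot> f = (\<Sum>i\<in>S. g i \<cdot> f)"
  using assms(5)
proof (induction S rule: infinite_finite_induct)
  case (insert i S)
  then show ?case
    using cmp_add_left[of X Y Z f "g i" "\<Sum>i\<in>S. g i"] assms(1-4) by (simp add: mor_sum)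
qed (simp_all add: cmp_zero_left[OF assms(1-4)])

lemma cmp_sum_right:
  assumes "X \<in> obj T" "Y \<in> obj T" "Z \<in> obj T" "g \<in> mor T Y Z" "\<And>i. i \<in> S \<Longrightarrow> f i \<in> mor T X Y"
  shows "g \<cdot> (\<Sum>i\<in>S. f i) = (\<Sum>i\<in>S. g \<cdot> f i)"
  using assms(5)
proof (induction S rule: infinite_finite_induct)
  case (insert i S)
  then show ?case
    using cmp_add_right[of X Y Z "f i" "\<Sum>i\<in>S. f i" g] assms(1-4) by (simp add: mor_sum)
qed (simp_all add: cmp_zero_right[OF assms(1-4)])

text \<open>The space of morphisms from \<open>X\<close> to \<open>Y\<close> is one-dimensional. This is \<open>gen_le T Y X\<close>, expressed
  without a choice of coordinate.\<close>

definition one_dim :: "'o \<Rightarrow> 'o \<Rightarrow> bool" where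
  "one_dim X Y \<longleftrightarrow> (\<exists>f\<in>mor T X Y. f \<noteq> 0 \<and> (\<forall>g\<in>mor T X Y. \<exists>c. g = scl T c f))"

lemma one_dim_multiple:
  assumes "one_dim X Y" "f \<in> mor T X Y" "f \<noteq> 0" "g \<in> mor T X Y"
  obtains c where "g = scl T c f"
proof -
  obtain h c c' where "f = scl T c h" "g = scl T c' h"
    using assms unfolding one_dim_def by blast
  then have "g = scl T (c' / c) f"
    using assms(3) by (auto simp: scl_scl scl_eq_0_iff)
  with that show thesis .
qed

lemma gen_le_iff_one_dim:
  assumes X: "X \<in> obj T" and Y: "Y \<in> obj T"
  shows "gen_le T Y X \<longleftrightarrow> one_dim X Y"
proof
  assume "gen_le T Y X"
  then obtain \<phi> :: "_ \<Rightarrow> 'k" where \<phi>: "bij_betw \<phi> (mor T X Y) UNIV"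
    and add: "\<And>f g. f \<in> mor T X Y \<Longrightarrow> g \<in> mor T X Y \<Longrightarrow> \<phi> (f + g) = \<phi> f + \<phi> g"
    and scl: "\<And>c f. f \<in> mor T X Y \<Longrightarrow> \<phi> (scl T c f) = c * \<phi> f"
    unfolding gen_le_def by blast
  obtain f where f: "f \<in> mor T X Y" "\<phi> f = 1"
    using \<phi> by (metis UNIV_I bij_betw_imp_surj_on image_iff)
  have "\<phi> 0 = 0"
    using scl[OF f(1), of 0] by simp
  with f have "f \<noteq> 0" by auto
  moreover have "g = scl T (\<phi> g) f" if "g \<in> mor T X Y" for g
    using inj_onD[OF bij_betw_imp_inj_on[OF \<phi>], of g "scl T (\<phi> g) f"] that scl f X Y
    by (simp add: mor_scl)
  ultimately show "one_dim X Y"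
    using f(1) unfolding one_dim_def by blast
next
  assume "one_dim X Y"
  then obtain f where f: "f \<in> mor T X Y" "f \<noteq> 0" "\<And>g. g \<in> mor T X Y \<Longrightarrow> \<exists>c. g = scl T c f"
    unfolding one_dim_def by blast
  then obtain \<phi> where \<phi>: "\<And>g. g \<in> mor T X Y \<Longrightarrow> g = scl T (\<phi> g) f"
    by metis
  have scl: "\<phi> (scl T c f) = c" for c
    using \<phi>[OF mor_scl[OF X Y f(1)], of c] f(2) scl_cancel by metis
  have "bij_betw \<phi> (mor T X Y) UNIV"
    by (rule bij_betwI[where g = "\<lambda>c. scl T c f"]) (use \<phi> scl f X Y in \<open>auto simp: mor_scl\<close>)
  moreover have "\<phi> (g + h) = \<phi> g + \<phi> h" if "g \<in> mor T X Y" "h \<in> mor T X Y" for g h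
    using \<phi>[OF that(1)] \<phi>[OF that(2)] scl[of "\<phi> g + \<phi> h"] by (simp add: scl_add_left)
  moreover have "\<phi> (scl T c g) = c * \<phi> g" if "g \<in> mor T X Y" for c g
    using \<phi>[OF that] scl[of "c * \<phi> g"] by (metis scl_scl)
  ultimately show "gen_le T Y X"
    unfolding gen_le_def by blast
qed

lemma iso_obj_refl: "X \<in> obj T \<Longrightarrow> iso_obj T X X"
  unfolding iso_obj_def iso_mor_def
  using ident_mor cmp_ident_left[of X X "ident T X"] by blast

lemma iso_obj_sym: "iso_obj T X Y \<Longrightarrow> iso_obj T Y X"
  unfolding iso_obj_def iso_mor_def by blast

lemma iso_obj_trans:
  assumes "iso_obj T X Y" "iso_obj T Y Z"
  shows "iso_obj T X Z"
proof -
  have obj: "X \<in> obj T" "Y \<in> obj T" "Z \<in> obj T"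
    using assms by (auto simp: iso_obj_def)
  obtain f f' where f: "f \<in> mor T X Y" "f' \<in> mor T Y X" "f' \<cdot> f = ident T X" "f \<cdot> f' = ident T Y"
    using assms(1) by (auto simp: iso_obj_def iso_mor_def)
  obtain g g' where g: "g \<in> mor T Y Z" "g' \<in> mor T Z Y" "g' \<cdot> g = ident T Y" "g \<cdot> g' = ident T Z"
    using assms(2) by (auto simp: iso_obj_def iso_mor_def)
  have "(f' \<cdot> g') \<cdot> (g \<cdot> f) = f' \<cdot> ((g' \<cdot> g) \<cdot> f)"
    using obj f(1,2) g(1,2) by (simp add: cmp_assoc[where X = Z] cmp_assoc[where X = Y] cmp_mor cmp_assoc)
  then have "(f' \<cdot> g') \<cdot> (g \<cdot> f) = ident T X"
    using obj f g by (simp add: cmp_ident_left)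
  moreover have "(g \<cdot> f) \<cdot> (f' \<cdot> g') = g \<cdot> ((f \<cdot> f') \<cdot> g')"
    using obj f(1,2) g(1,2) cmp_assoc[of Z X Y Z "f' \<cdot> g'" f g] cmp_assoc[of Z Y X Y g' f' f]
    by (simp add: cmp_mor[of Z Y X])
  then have "(g \<cdot> f) \<cdot> (f' \<cdot> g') = ident T Z"
    using obj f g by (simp add: cmp_ident_left)
  ultimately show ?thesis
    using obj cmp_mor[of X Y Z f g] cmp_mor[of Z Y X g' f'] f g
    unfolding iso_obj_def iso_mor_def by blast
qed

lemma iso_class_eq_iff:
  "X \<in> obj T \<Longrightarrow> iso_class T X = iso_class T Y \<longleftrightarrow> iso_obj T X Y"
  unfolding iso_class_def
  by (metis (no_types, lifting) Collect_cong iso_obj_refl iso_obj_sym iso_obj_trans mem_Collect_eq)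

lemma one_dim_iso_source:
  assumes "one_dim X Y" "iso_obj T X X'" "Y \<in> obj T"
  shows "one_dim X' Y"
proof -
  have obj: "X \<in> obj T" "X' \<in> obj T"
    using assms by (auto simp: iso_obj_def)
  obtain a b where a: "a \<in> mor T X X'" "b \<in> mor T X' X" "b \<cdot> a = ident T X" "a \<cdot> b = ident T X'"
    using assms(2) by (auto simp: iso_obj_def iso_mor_def)
  obtain f where f: "f \<in> mor T X Y" "f \<noteq> 0" "\<And>g. g \<in> mor T X Y \<Longrightarrow> \<exists>c. g = scl T c f"
    using assms(1) unfolding one_dim_def by blast
  have inv: "(g \<cdot> b) \<cdot> a = g" if "g \<in> mor T X Y" for g
    using that obj a assms(3) by (simp add: cmp_assoc[of X X' X Y] cmp_ident_right[of X Y])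
  have inv': "(g \<cdot> a) \<cdot> b = g" if "g \<in> mor T X' Y" for g
    using that obj a assms(3) by (simp add: cmp_assoc[of X' X X' Y] cmp_ident_right[of X' Y])
  have "f \<cdot> b \<noteq> 0"
    using inv[OF f(1)] f(2) cmp_zero_left[of X X' Y a] obj a assms(3) by auto
  moreover have "\<exists>c. g = scl T c (f \<cdot> b)" if g: "g \<in> mor T X' Y" for g
  proof -
    obtain c where "g \<cdot> a = scl T c f"
      using f(3) cmp_mor[of X X' Y a g] g a obj assms(3) by blast
    then show ?thesis
      using inv'[OF g] cmp_scl_left[of X' X Y b f c] f(1) a obj assms(3) by metis
  qed
  ultimately show ?thesis
    using cmp_mor[of X' X Y b f] f(1) a obj assms(3) unfolding one_dim_def by blast
qed

lemma one_dim_iso_target: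
  assumes "one_dim X Y" "iso_obj T Y Y'" "X \<in> obj T"
  shows "one_dim X Y'"
proof -
  have obj: "Y \<in> obj T" "Y' \<in> obj T"
    using assms by (auto simp: iso_obj_def)
  obtain a b where a: "a \<in> mor T Y Y'" "b \<in> mor T Y' Y" "b \<cdot> a = ident T Y" "a \<cdot> b = ident T Y'"
    using assms(2) by (auto simp: iso_obj_def iso_mor_def)
  obtain f where f: "f \<in> mor T X Y" "f \<noteq> 0" "\<And>g. g \<in> mor T X Y \<Longrightarrow> \<exists>c. g = scl T c f"
    using assms(1) unfolding one_dim_def by blast
  have inv: "b \<cdot> (a \<cdot> g) = g" if "g \<in> mor T X Y" for g
    using that obj a assms(3) by (simp add: cmp_assoc[of X Y Y' Y, symmetric] cmp_ident_left[of X Y])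
  have inv': "a \<cdot> (b \<cdot> g) = g" if "g \<in> mor T X Y'" for g
    using that obj a assms(3) by (simp add: cmp_assoc[of X Y' Y Y', symmetric] cmp_ident_left[of X Y'])
  have "a \<cdot> f \<noteq> 0"
    using inv[OF f(1)] f(2) cmp_zero_right[of X Y' Y b] obj a assms(3) by auto
  moreover have "\<exists>c. g = scl T c (a \<cdot> f)" if g: "g \<in> mor T X Y'" for g
  proof -
    obtain c where "b \<cdot> g = scl T c f"
      using f(3) cmp_mor[of X Y' Y g b] g a obj assms(3) by blast
    then show ?thesis
      using inv'[OF g] cmp_scl_right[of X Y Y' f a c] f(1) a obj assms(3) by metis
  qed
  ultimately show ?thesis
    using cmp_mor[of X Y Y' f a] f(1) a obj assms(3) unfolding one_dim_def by blast
qed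

lemma gen_le_iso:
  assumes "gen_le T Y X" "iso_obj T X X'" "iso_obj T Y Y'"
  shows "gen_le T Y' X'"
proof -
  have "X \<in> obj T" "X' \<in> obj T" "Y \<in> obj T" "Y' \<in> obj T"
    using assms by (auto simp: iso_obj_def)
  then show ?thesis
    using assms one_dim_iso_source one_dim_iso_target by (metis gen_le_iff_one_dim)
qed

lemma direct_sum_reindex:
  assumes "bij_betw r A S" "direct_sum T X S Y"
  shows "direct_sum T X A (\<lambda>i. Y (r i))"
proof -
  obtain inc prj where
    mor: "\<And>i. i \<in> S \<Longrightarrow> inc i \<in> mor T (Y i) X" "\<And>i. i \<in> S \<Longrightarrow> prj i \<in> mor T X (Y i)"
    and orth: "\<And>i j. i \<in> S \<Longrightarrow> j \<in> S \<Longrightarrow> prj j \<cdot> inc i = (if i = j then ident T (Y i) else 0)"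
    and sum: "(\<Sum>i\<in>S. inc i \<cdot> prj i) = ident T X"
    using assms(2) unfolding direct_sum_def by blast
  have r: "r i \<in> S" if "i \<in> A" for i
    using assms(1) that by (auto simp: bij_betw_def)
  have inj: "r i = r j \<longleftrightarrow> i = j" if "i \<in> A" "j \<in> A" for i j
    using assms(1) that by (auto simp: bij_betw_def inj_on_def)
  have "(\<Sum>i\<in>A. inc (r i) \<cdot> prj (r i)) = ident T X"
    using sum.reindex_bij_betw[OF assms(1), of "\<lambda>i. inc i \<cdot> prj i"] sum by simp
  moreover have "finite A"
    using assms bij_betw_finite unfolding direct_sum_def by blast
  ultimately show ?thesis
    using assms(2) mor orth r inj unfolding direct_sum_def
    by (intro conjI exI[of _ "\<lambda>i. inc (r i)"] exI[of _ "\<lambda>i. prj (r i)"]) auto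
qed

end

section \<open>Summands and shifts\<close>

context triangulated_category
begin

lemma ex_direct_sum_finite:
  assumes "finite S" "\<And>i. i \<in> S \<Longrightarrow> Y i \<in> obj T"
  shows "\<exists>X. direct_sum T X S Y"
proof -
  obtain r where r: "bij_betw r {..<card S} S"
    using assms(1) ex_bij_betw_nat_finite atLeast0LessThan by metis
  then obtain X where "direct_sum T X {..<card S} (\<lambda>i. Y (r i))"
    using ex_direct_sum[of "card S" "\<lambda>i. Y (r i)"] assms(2) by (auto simp: bij_betw_def)
  moreover have "bij_betw (the_inv_into {..<card S} r) S {..<card S}"
    by (rule bij_betw_the_inv_into[OF r])
  ultimately have X: "direct_sum T X S (\<lambda>i. Y (r (the_inv_into {..<card S} r i)))"
    by (rule direct_sum_reindex[rotated])
  have "r (the_inv_into {..<card S} r i) = i" if "i \<in> S" for i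
    using r that by (simp add: bij_betw_def f_the_inv_into_f)
  then have "direct_sum T X S (\<lambda>i. Y (r (the_inv_into {..<card S} r i))) = direct_sum T X S Y"
    unfolding direct_sum_def by (simp cong: conj_cong)
  with X show ?thesis by blast
qed

text \<open>A member of a finite biproduct decomposition has a complement, namely a direct sum of the
  remaining members.\<close>

lemma direct_sum2_complement:
  assumes "direct_sum T X S Y" "s \<in> S"
  shows "\<exists>B. direct_sum2 T X (Y s) B"
proof -
  obtain inc prj where
    mor: "\<And>i. i \<in> S \<Longrightarrow> inc i \<in> mor T (Y i) X" "\<And>i. i \<in> S \<Longrightarrow> prj i \<in> mor T X (Y i)"
    and orth: "\<And>i j. i \<in> S \<Longrightarrow> j \<in> S \<Longrightarrow> prj j \<cdot> inc i = (if i = j then ident T (Y i) else 0)"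
    and sum: "(\<Sum>i\<in>S. inc i \<cdot> prj i) = ident T X"
    and obj: "X \<in> obj T" "\<And>i. i \<in> S \<Longrightarrow> Y i \<in> obj T" and fin: "finite S"
    using assms(1) unfolding direct_sum_def by blast
  define R where "R = S - {s}"
  have R: "finite R" "\<And>i. i \<in> R \<Longrightarrow> i \<in> S" "s \<notin> R"
    using fin by (auto simp: R_def)
  obtain B where "direct_sum T B R Y"
    using ex_direct_sum_finite[of R Y] R obj by blast
  then obtain inc' prj' where B: "B \<in> obj T" and
    mor': "\<And>i. i \<in> R \<Longrightarrow> inc' i \<in> mor T (Y i) B" "\<And>i. i \<in> R \<Longrightarrow> prj' i \<in> mor T B (Y i)"
    and orth': "\<And>i j. i \<in> R \<Longrightarrow> j \<in> R \<Longrightarrow> prj' j \<cdot> inc' i = (if i = j then ident T (Y i) else 0)"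
    and sum': "(\<Sum>i\<in>R. inc' i \<cdot> prj' i) = ident T B"
    unfolding direct_sum_def by blast
  define J where "J = (\<Sum>i\<in>R. inc i \<cdot> prj' i)"
  define K where "K = (\<Sum>i\<in>R. inc' i \<cdot> prj i)"
  have terms: "inc i \<cdot> prj' i \<in> mor T B X" "inc' i \<cdot> prj i \<in> mor T X B" if "i \<in> R" for i
    using that R(2) mor mor' obj B by (auto intro: cmp_mor[where Y = "Y i"])
  have J: "J \<in> mor T B X" and K: "K \<in> mor T X B"
    using terms obj B by (auto simp: J_def K_def intro: mor_sum)
  have prjJ: "prj j \<cdot> J = (if j \<in> R then prj' j else 0)" if j: "j \<in> S" for j
  proof -
    have "prj j \<cdot> J = (\<Sum>i\<in>R. prj j \<cdot> (inc i \<cdot> prj' i))"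
      unfolding J_def using terms j mor obj B by (intro cmp_sum_right[where Y = X and X = B and Z = "Y j"]) auto
    also have "\<dots> = (\<Sum>i\<in>R. if i = j then prj' i else 0)"
    proof (intro sum.cong refl)
      fix i assume i: "i \<in> R"
      have "prj j \<cdot> (inc i \<cdot> prj' i) = (prj j \<cdot> inc i) \<cdot> prj' i"
        using cmp_assoc[OF B obj(2)[OF R(2)[OF i]] obj(1) obj(2)[OF j] mor'(2)[OF i] mor(1)[OF R(2)[OF i]] mor(2)[OF j]]
        by simp
      also have "\<dots> = (if i = j then prj' i else 0)"
        using orth[OF R(2)[OF i] j] cmp_ident_left[OF B obj(2)[OF R(2)[OF i]] mor'(2)[OF i]]
          cmp_zero_left[OF B obj(2)[OF R(2)[OF i]] obj(2)[OF j] mor'(2)[OF i]]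
        by auto
      finally show "prj j \<cdot> (inc i \<cdot> prj' i) = (if i = j then prj' i else 0)" .
    qed
    finally show ?thesis using R(1) by (simp add: sum.delta)
  qed
  have prjK: "prj' j \<cdot> K = prj j" if j: "j \<in> R" for j
  proof -
    have "prj' j \<cdot> K = (\<Sum>i\<in>R. prj' j \<cdot> (inc' i \<cdot> prj i))"
      unfolding K_def using terms j R(2) mor' obj B by (intro cmp_sum_right[where Y = B and X = X and Z = "Y j"]) auto
    also have "\<dots> = (\<Sum>i\<in>R. if i = j then prj i else 0)"
    proof (intro sum.cong refl)
      fix i assume i: "i \<in> R"
      have "prj' j \<cdot> (inc' i \<cdot> prj i) = (prj' j \<cdot> inc' i) \<cdot> prj i"
        using cmp_assoc[OF obj(1) obj(2)[OF R(2)[OF i]] B obj(2)[OF R(2)[OF j]] mor(2)[OF R(2)[OF i]] mor'(1)[OF i] mor'(2)[OF j]]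
        by simp
      also have "\<dots> = (if i = j then prj i else 0)"
        using orth'[OF i j] cmp_ident_left[OF obj(1) obj(2)[OF R(2)[OF i]] mor(2)[OF R(2)[OF i]]]
          cmp_zero_left[OF obj(1) obj(2)[OF R(2)[OF i]] obj(2)[OF R(2)[OF j]] mor(2)[OF R(2)[OF i]]]
        by auto
      finally show "prj' j \<cdot> (inc' i \<cdot> prj i) = (if i = j then prj i else 0)" .
    qed
    finally show ?thesis using R(1) j by (simp add: sum.delta)
  qed
  have Kinc: "K \<cdot> inc s = 0"
  proof -
    have "K \<cdot> inc s = (\<Sum>i\<in>R. (inc' i \<cdot> prj i) \<cdot> inc s)"
      unfolding K_def using terms assms(2) mor obj B by (intro cmp_sum_left[where Y = X and X = "Y s" and Z = B]) auto
    also have "\<dots> = (\<Sum>i\<in>R. 0)"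
    proof (intro sum.cong refl)
      fix i assume i: "i \<in> R"
      have "(inc' i \<cdot> prj i) \<cdot> inc s = inc' i \<cdot> (prj i \<cdot> inc s)"
        using cmp_assoc[OF obj(2)[OF assms(2)] obj(1) obj(2)[OF R(2)[OF i]] B mor(1)[OF assms(2)] mor(2)[OF R(2)[OF i]] mor'(1)[OF i]]
        by simp
      also have "\<dots> = 0"
        using orth[OF assms(2) R(2)[OF i]] i R(3)
          cmp_zero_right[OF obj(2)[OF assms(2)] obj(2)[OF R(2)[OF i]] B mor'(1)[OF i]]
        by auto
      finally show "(inc' i \<cdot> prj i) \<cdot> inc s = 0" .
    qed
    finally show ?thesis by simp
  qed
  have KJ: "K \<cdot> J = ident T B"
  proof -
    have "K \<cdot> J = (\<Sum>i\<in>R. (inc' i \<cdot> prj i) \<cdot> J)"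
      unfolding K_def using terms obj B J by (intro cmp_sum_left[where Y = X and X = B and Z = B]) auto
    also have "\<dots> = (\<Sum>i\<in>R. inc' i \<cdot> prj' i)"
    proof (intro sum.cong refl)
      fix i assume i: "i \<in> R"
      show "(inc' i \<cdot> prj i) \<cdot> J = inc' i \<cdot> prj' i"
        using cmp_assoc[OF B obj(1) obj(2)[OF R(2)[OF i]] B J mor(2)[OF R(2)[OF i]] mor'(1)[OF i]]
          prjJ[OF R(2)[OF i]] i by simp
    qed
    finally show ?thesis using sum' by simp
  qed
  have JK: "J \<cdot> K = (\<Sum>i\<in>R. inc i \<cdot> prj i)"
  proof -
    have "J \<cdot> K = (\<Sum>i\<in>R. (inc i \<cdot> prj' i) \<cdot> K)"
      unfolding J_def using terms obj B K by (intro cmp_sum_left[where Y = B and X = X and Z = X]) auto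
    also have "\<dots> = (\<Sum>i\<in>R. inc i \<cdot> prj i)"
    proof (intro sum.cong refl)
      fix i assume i: "i \<in> R"
      show "(inc i \<cdot> prj' i) \<cdot> K = inc i \<cdot> prj i"
        using cmp_assoc[OF obj(1) B obj(2)[OF R(2)[OF i]] obj(1) K mor'(2)[OF i] mor(1)[OF R(2)[OF i]]]
          prjK[OF i] by simp
    qed
    finally show ?thesis .
  qed
  have id: "inc s \<cdot> prj s + J \<cdot> K = ident T X"
    using sum assms(2) fin by (simp add: JK R_def sum.remove)
  have "direct_sum2 T X (Y s) B"
    unfolding direct_sum_def
    using obj B assms(2) mor J K orth[OF assms(2,2)] prjJ[OF assms(2)] R(3) Kinc KJ id
    by (intro conjI exI[of _ "\<lambda>b. if b then inc s else J"] exI[of _ "\<lambda>b. if b then prj s else K"])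
      (auto simp: UNIV_bool add.commute)
  then show ?thesis by blast
qed

lemma summand_in_add_closure:
  assumes "direct_sum T X S Y" "s \<in> S"
  shows "Y s \<in> add_closure T X"
  using direct_sum2_complement[OF assms] unfolding add_closure_def closed_summands_def by blast

lemma add_closure_sh: "X \<in> add_closure T G \<Longrightarrow> sh T 1 X \<in> add_closure T G"
  unfolding add_closure_def by blast

lemma sh_inverse [simp]: "X \<in> obj T \<Longrightarrow> sh T (- i) (sh T i X) = X" "X \<in> obj T \<Longrightarrow> sh T i (sh T (- i) X) = X"
  using sh_add[of X "- i" i] sh_add[of X i "- i"] by (simp_all add: sh_0)

lemma shm_inverse:
  assumes "X \<in> obj T" "Y \<in> obj T" "f \<in> mor T X Y"
  shows "shm T (- i) (shm T i f) = f" "shm T i (shm T (- i) f) = f"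
  using shm_comp[OF assms, of "- i" i] shm_comp[OF assms, of i "- i"] shm_0[OF assms] by simp_all

lemma shm_surj:
  assumes "X \<in> obj T" "Y \<in> obj T" "f \<in> mor T (sh T i X) (sh T i Y)"
  obtains g where "g \<in> mor T X Y" "f = shm T i g"
  using shm_mor[OF _ _ assms(3), of "- i"] shm_inverse(2)[OF _ _ assms(3), of i] assms that
  by (auto simp: sh_obj)

lemma shm_zero [simp]: "shm T i 0 = 0"
proof -
  obtain X where X: "X \<in> obj T"
    using ex_direct_sum[of 0 "\<lambda>_. undefined"] by (auto simp: direct_sum_def)
  then show ?thesis
    using shm_scl[OF X X mor_zero[OF X X], of i 0] by simp
qed

lemma shm_eq_0_iff: "X \<in> obj T \<Longrightarrow> Y \<in> obj T \<Longrightarrow> f \<in> mor T X Y \<Longrightarrow> shm T i f = 0 \<longleftrightarrow> f = 0"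
  using shm_inverse(1) shm_zero by metis

lemma shm_sum:
  assumes "X \<in> obj T" "Y \<in> obj T" "\<And>i. i \<in> S \<Longrightarrow> f i \<in> mor T X Y"
  shows "shm T d (\<Sum>i\<in>S. f i) = (\<Sum>i\<in>S. shm T d (f i))"
  using assms(3)
  by (induction S rule: infinite_finite_induct) (simp_all add: shm_add[OF assms(1,2)] mor_sum assms(1,2))

lemma mor_sh_zero:
  assumes "X \<in> obj T" "Y \<in> obj T" "mor T X Y = {0}"
  shows "mor T (sh T i X) (sh T i Y) = {0}"
proof -
  have "f = 0" if "f \<in> mor T (sh T i X) (sh T i Y)" for f
    using shm_surj[OF assms(1,2) that] assms(3) by auto
  then show ?thesis
    using mor_zero[OF sh_obj sh_obj, OF assms(1,2)] by blast
qed

lemma one_dim_sh: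
  assumes "X \<in> obj T" "Y \<in> obj T" "one_dim X Y"
  shows "one_dim (sh T i X) (sh T i Y)"
proof -
  obtain f where f: "f \<in> mor T X Y" "f \<noteq> 0" "\<And>g. g \<in> mor T X Y \<Longrightarrow> \<exists>c. g = scl T c f"
    using assms(3) unfolding one_dim_def by blast
  have "\<exists>c. g = scl T c (shm T i f)" if "g \<in> mor T (sh T i X) (sh T i Y)" for g
    using shm_surj[OF assms(1,2) that] f(3) shm_scl[OF assms(1,2) f(1)] by metis
  then show ?thesis
    using shm_mor[OF assms(1,2) f(1)] f(2) shm_eq_0_iff[OF assms(1,2) f(1)] unfolding one_dim_def by blast
qed

lemma gen_le_sh:
  assumes "X \<in> obj T" "Y \<in> obj T"
  shows "gen_le T (sh T i Y) (sh T i X) \<longleftrightarrow> gen_le T Y X"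
  using assms one_dim_sh[of X Y i] one_dim_sh[of "sh T i X" "sh T i Y" "- i"]
  by (auto simp: gen_le_iff_one_dim sh_obj)

lemma iso_obj_sh:
  assumes "iso_obj T X Y"
  shows "iso_obj T (sh T i X) (sh T i Y)"
proof -
  have obj: "X \<in> obj T" "Y \<in> obj T"
    using assms by (auto simp: iso_obj_def)
  obtain f f' where f: "f \<in> mor T X Y" "f' \<in> mor T Y X" "f' \<cdot> f = ident T X" "f \<cdot> f' = ident T Y"
    using assms by (auto simp: iso_obj_def iso_mor_def)
  then show ?thesis
    using obj shm_mor[of X Y f i] shm_mor[of Y X f' i] shm_cmp[of X Y X f f' i] shm_cmp[of Y X Y f' f i]
    unfolding iso_obj_def iso_mor_def by (auto simp: sh_obj shm_ident)
qed

lemma zero_obj_sh: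
  assumes "zero_obj T Z"
  shows "zero_obj T (sh T i Z)"
  unfolding zero_obj_def
proof (intro conjI ballI)
  have Z: "Z \<in> obj T" using assms by (simp add: zero_obj_def)
  then show "sh T i Z \<in> obj T" by (rule sh_obj)
  fix X assume X: "X \<in> obj T"
  then have "mor T (sh T (- i) X) Z = {0}" "mor T Z (sh T (- i) X) = {0}"
    using assms sh_obj unfolding zero_obj_def by blast+
  then show "mor T X (sh T i Z) = {0}" "mor T (sh T i Z) X = {0}"
    using mor_sh_zero[of "sh T (- i) X" Z i] mor_sh_zero[of Z "sh T (- i) X" i] X Z
    by (simp_all add: sh_obj)
qed

lemma direct_sum2_sh:
  assumes "direct_sum2 T X A B"
  shows "direct_sum2 T (sh T i X) (sh T i A) (sh T i B)"
proof -
  let ?Y = "\<lambda>b. if b then A else B"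
  obtain inc prj where
    mor: "\<And>b. inc b \<in> mor T (?Y b) X" "\<And>b. prj b \<in> mor T X (?Y b)"
    and orth: "\<And>b c. prj c \<cdot> inc b = (if b = c then ident T (?Y b) else 0)"
    and sum: "(\<Sum>b\<in>UNIV. inc b \<cdot> prj b) = ident T X"
    and obj: "X \<in> obj T" "\<And>b. ?Y b \<in> obj T"
    using assms unfolding direct_sum_def ball_UNIV by blast
  have Y: "(if b then sh T i A else sh T i B) = sh T i (?Y b)" for b
    by simp
  have "(\<Sum>b\<in>UNIV. shm T i (inc b) \<cdot> shm T i (prj b)) = (\<Sum>b\<in>UNIV. shm T i (inc b \<cdot> prj b))"
    using mor obj by (intro sum.cong refl shm_cmp[where Y = "?Y _", symmetric])
  also have "\<dots> = shm T i (\<Sum>b\<in>UNIV. inc b \<cdot> prj b)"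
    using mor obj by (intro shm_sum[symmetric, where X = X and Y = X] cmp_mor[where Y = "?Y _"])
  finally have id: "(\<Sum>b\<in>UNIV. shm T i (inc b) \<cdot> shm T i (prj b)) = ident T (sh T i X)"
    using obj by (simp only: sum shm_ident)
  have orth': "shm T i (prj c) \<cdot> shm T i (inc b) = (if b = c then ident T (sh T i (?Y b)) else 0)" for b c
    using shm_cmp[OF obj(2)[of b] obj(1) obj(2)[of c] mor(1) mor(2), of i] obj(2)[of b]
    unfolding orth by (simp add: shm_ident split: if_splits)
  show ?thesis
    unfolding direct_sum_def Y ball_UNIV
    by (intro conjI allI exI[of _ "\<lambda>b. shm T i (inc b)"] exI[of _ "\<lambda>b. shm T i (prj b)"])
      (rule sh_obj obj finite shm_mor mor orth' id)+
qed

lemma indecomposable_sh: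
  assumes "indecomposable T X"
  shows "indecomposable T (sh T i X)"
  unfolding indecomposable_def
proof (intro conjI allI impI)
  have X: "X \<in> obj T" using assms by (simp add: indecomposable_def)
  then show "sh T i X \<in> obj T" by (rule sh_obj)
  show "\<not> zero_obj T (sh T i X)"
    using zero_obj_sh[of "sh T i X" "- i"] assms X by (auto simp: indecomposable_def)
  fix A B assume AB: "direct_sum2 T (sh T i X) A B"
  then have obj: "A \<in> obj T" "B \<in> obj T"
    unfolding direct_sum_def by (metis UNIV_I)+
  have "direct_sum2 T X (sh T (- i) A) (sh T (- i) B)"
    using direct_sum2_sh[OF AB, of "- i"] X by simp
  then show "zero_obj T A \<or> zero_obj T B"
    using assms zero_obj_sh[of "sh T (- i) A" i] zero_obj_sh[of "sh T (- i) B" i] obj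
    by (auto simp: indecomposable_def)
qed

lemma ind_objs_sh: "X \<in> ind_objs T G \<Longrightarrow> sh T 1 X \<in> ind_objs T G"
  unfolding ind_objs_def using add_closure_sh indecomposable_sh by blast

end

section \<open>The order on indecomposable objects and their shifts\<close>

locale linearly_generated = triangulated_category T
  for T :: "('k::field, 'o, 'm::ab_group_add) tcat" (structure) +
  fixes G :: 'o
  assumes linear_generator: "linear_generator T G"
begin

abbreviation le :: "'o \<Rightarrow> 'o \<Rightarrow> bool" where
  "le \<equiv> gen_le T"

text \<open>Objects some non-negative shift of which is an indecomposable object of \<open>\<langle>G\<rangle>\<^sub>1\<close>. The subcategory
  \<open>\<langle>G\<rangle>\<^sub>1\<close> is only required to be closed under \<open>[1]\<close>; the axioms of a linear generator are transported to
  negative shifts by shifting finitely many objects into \<open>\<langle>G\<rangle>\<^sub>1\<close> simultaneously.\<close>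

definition shifted_ind :: "'o \<Rightarrow> bool" where
  "shifted_ind X \<longleftrightarrow> X \<in> obj T \<and> (\<exists>k::nat. sh T (int k) X \<in> ind_objs T G)"

lemma ind_objs_obj: "X \<in> ind_objs T G \<Longrightarrow> X \<in> obj T"
  by (simp add: ind_objs_def indecomposable_def)

lemma shifted_ind_obj: "shifted_ind X \<Longrightarrow> X \<in> obj T"
  by (simp add: shifted_ind_def)

lemma ind_objs_sh_nat: "X \<in> ind_objs T G \<Longrightarrow> sh T (int k) X \<in> ind_objs T G"
proof (induction k)
  case (Suc k)
  then show ?case
    using ind_objs_sh[of "sh T (int k) X" G] sh_add[of X 1 "int k"] ind_objs_obj by simp
qed (simp add: sh_0 ind_objs_obj)

lemma shifted_ind_large:
  assumes "shifted_ind X"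
  obtains k where "\<And>j. k \<le> j \<Longrightarrow> sh T (int j) X \<in> ind_objs T G"
proof -
  obtain k where k: "sh T (int k) X \<in> ind_objs T G" and X: "X \<in> obj T"
    using assms by (auto simp: shifted_ind_def)
  have "sh T (int j) X \<in> ind_objs T G" if "k \<le> j" for j
    using ind_objs_sh_nat[OF k, of "j - k"] sh_add[OF X, of "int (j - k)" "int k"] that
    by (simp add: of_nat_diff)
  with that show thesis by blast
qed

lemma shifted_ind_common:
  assumes "shifted_ind X" "shifted_ind Y" "shifted_ind Z"
  obtains k :: nat where "sh T (int k) X \<in> ind_objs T G" "sh T (int k) Y \<in> ind_objs T G"
    "sh T (int k) Z \<in> ind_objs T G"
proof -
  obtain i j k where
    "\<And>l. i \<le> l \<Longrightarrow> sh T (int l) X \<in> ind_objs T G"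
    "\<And>l. j \<le> l \<Longrightarrow> sh T (int l) Y \<in> ind_objs T G"
    "\<And>l. k \<le> l \<Longrightarrow> sh T (int l) Z \<in> ind_objs T G"
    using assms shifted_ind_large by metis
  then show thesis
    using that[of "max i (max j k)"] by simp
qed

lemma shifted_ind_sh:
  assumes "shifted_ind X"
  shows "shifted_ind (sh T i X)"
proof -
  obtain k where k: "\<And>j. k \<le> j \<Longrightarrow> sh T (int j) X \<in> ind_objs T G"
    using shifted_ind_large[OF assms] by blast
  have X: "X \<in> obj T" by (rule shifted_ind_obj[OF assms])
  define l where "l = nat \<bar>int k - i\<bar>"
  define m where "m = nat (int l + i)"
  have "k \<le> m" "int m = int l + i"
    by (auto simp: l_def m_def)
  then have "sh T (int l) (sh T i X) \<in> ind_objs T G"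
    using k[of m] sh_add[OF X, of "int l" i] by simp
  then show ?thesis
    using X unfolding shifted_ind_def by (blast intro: sh_obj)
qed

lemma ind_objs_order:
  assumes "X \<in> ind_objs T G" "Y \<in> ind_objs T G"
  shows "(iso_class T X, iso_class T Y) \<in>
      {(iso_class T Q, iso_class T P) | Q P. Q \<in> ind_objs T G \<and> P \<in> ind_objs T G \<and> le Q P}
    \<longleftrightarrow> le X Y"
proof
  assume "(iso_class T X, iso_class T Y) \<in>
      {(iso_class T Q, iso_class T P) | Q P. Q \<in> ind_objs T G \<and> P \<in> ind_objs T G \<and> le Q P}"
  then obtain Q P where "iso_class T X = iso_class T Q" "iso_class T Y = iso_class T P" "le Q P"
    by blast
  then show "le X Y"
    using assms gen_le_iso iso_obj_sym by (auto simp: iso_class_eq_iff ind_objs_obj)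
qed (use assms in blast)

lemma ind_objs_linear_order:
  "linear_order_on (iso_class T ` ind_objs T G)
     {(iso_class T Q, iso_class T P) | Q P. Q \<in> ind_objs T G \<and> P \<in> ind_objs T G \<and> le Q P}"
  using linear_generator by (simp add: linear_generator_def)

lemma le_refl:
  assumes "shifted_ind X"
  shows "le X X"
proof -
  obtain k where k: "sh T (int k) X \<in> ind_objs T G"
    using assms by (auto simp: shifted_ind_def)
  have "le (sh T (int k) X) (sh T (int k) X)"
    using ind_objs_linear_order k unfolding ind_objs_order[OF k k, symmetric]
    by (meson image_eqI order_on_defs refl_onD)
  then show ?thesis
    using assms by (simp add: gen_le_sh shifted_ind_obj)
qed

lemma le_trans:
  assumes "le X Y" "le Y Z" "shifted_ind X" "shifted_ind Y" "shifted_ind Z"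
  shows "le X Z"
proof -
  obtain k where k: "sh T (int k) X \<in> ind_objs T G" "sh T (int k) Y \<in> ind_objs T G"
    "sh T (int k) Z \<in> ind_objs T G"
    using shifted_ind_common assms(3-5) by blast
  have "le (sh T (int k) X) (sh T (int k) Y)" "le (sh T (int k) Y) (sh T (int k) Z)"
    using assms by (simp_all add: gen_le_sh shifted_ind_obj)
  then have "le (sh T (int k) X) (sh T (int k) Z)"
    unfolding ind_objs_order[OF k(1,2), symmetric] ind_objs_order[OF k(2,3), symmetric]
      ind_objs_order[OF k(1,3), symmetric]
    using ind_objs_linear_order by (meson order_on_defs transD)
  then show ?thesis
    using assms by (simp add: gen_le_sh shifted_ind_obj)
qed

lemma iso_obj_unshift:
  assumes "X \<in> obj T" "Y \<in> obj T" "iso_obj T (sh T i X) (sh T i Y)"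
  shows "iso_obj T X Y"
  using iso_obj_sh[OF assms(3), of "- i"] assms(1,2) by simp

lemma le_antisym:
  assumes "le X Y" "le Y X" "shifted_ind X" "shifted_ind Y"
  shows "iso_obj T X Y"
proof -
  obtain k where k: "sh T (int k) X \<in> ind_objs T G" "sh T (int k) Y \<in> ind_objs T G"
    using shifted_ind_common assms(3,4) by blast
  have "le (sh T (int k) X) (sh T (int k) Y)" "le (sh T (int k) Y) (sh T (int k) X)"
    using assms by (simp_all add: gen_le_sh shifted_ind_obj)
  then have "iso_class T (sh T (int k) X) = iso_class T (sh T (int k) Y)"
    unfolding ind_objs_order[OF k(1,2), symmetric] ind_objs_order[OF k(2,1), symmetric]
    using ind_objs_linear_order by (meson order_on_defs antisymD)
  then show ?thesis
    using assms k by (auto simp: iso_class_eq_iff ind_objs_obj shifted_ind_obj intro: iso_obj_unshift)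
qed

lemma le_iso:
  assumes "iso_obj T X Y" "shifted_ind X" "shifted_ind Y"
  shows "le X Y" "le Y X"
  using gen_le_iso[OF le_refl[OF assms(2)] assms(1) iso_obj_refl]
    gen_le_iso[OF le_refl[OF assms(2)] iso_obj_refl assms(1)] assms(2) by (simp_all add: shifted_ind_obj)

lemma mor_zero_of_le:
  assumes "le X Y" "\<not> iso_obj T X Y" "shifted_ind X" "shifted_ind Y"
  shows "mor T X Y = {0}"
proof -
  obtain k where k: "sh T (int k) X \<in> ind_objs T G" "sh T (int k) Y \<in> ind_objs T G"
    using shifted_ind_common assms(3,4) by blast
  have "le (sh T (int k) X) (sh T (int k) Y)" "\<not> iso_obj T (sh T (int k) X) (sh T (int k) Y)"
    using assms by (auto simp: gen_le_sh shifted_ind_obj dest: iso_obj_unshift[rotated 2])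
  then have "mor T (sh T (int k) X) (sh T (int k) Y) = {0}"
    using k linear_generator by (simp add: linear_generator_def)
  then show ?thesis
    using mor_sh_zero[of "sh T (int k) X" "sh T (int k) Y" "- int k"] assms(3,4)
    by (simp add: shifted_ind_obj sh_obj)
qed

lemma le_sh1:
  assumes "shifted_ind X"
  shows "le X (sh T 1 X)"
proof -
  obtain k where k: "sh T (int k) X \<in> ind_objs T G" and X: "X \<in> obj T"
    using assms by (auto simp: shifted_ind_def)
  have "le (sh T (int k) X) (sh T 1 (sh T (int k) X))"
    using k linear_generator by (simp add: linear_generator_def)
  moreover have "sh T 1 (sh T (int k) X) = sh T (int k) (sh T 1 X)"
    using sh_add[OF X, of 1 "int k"] sh_add[OF X, of "int k" 1] by (simp add: add.commute)
  ultimately show ?thesis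
    using X by (simp add: gen_le_sh sh_obj)
qed

lemma le_sh_mono:
  assumes X: "shifted_ind X" and "i \<le> j"
  shows "le (sh T i X) (sh T j X)"
  using assms(2)
proof (induction j rule: int_ge_induct)
  case base
  then show ?case by (rule le_refl[OF shifted_ind_sh[OF X]])
next
  case (step j)
  have "le (sh T j X) (sh T (j + 1) X)"
    using le_sh1[OF shifted_ind_sh[OF X, of j]] sh_add[of X 1 j] shifted_ind_obj[OF X]
    by (simp add: add.commute)
  with step show ?case
    using le_trans shifted_ind_sh[OF X] by blast
qed

text \<open>
  Axiom (G4) says that along \<open>R \<le> Q \<le> P\<close> some composite \<open>P \<rightarrow> Q \<rightarrow> R\<close> is nonzero; since the morphism spaces
  are lines, all composites of nonzero morphisms are then nonzero.
\<close>

lemma cmp_nonzero: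
  assumes "le R Q" "le Q P" "shifted_ind R" "shifted_ind Q" "shifted_ind P"
    and h: "h \<in> mor T P Q" "h \<noteq> 0" and g: "g \<in> mor T Q R" "g \<noteq> 0"
  shows "g \<cdot> h \<noteq> 0"
proof
  assume zero: "g \<cdot> h = 0"
  obtain k where k: "sh T (int k) R \<in> ind_objs T G" "sh T (int k) Q \<in> ind_objs T G"
    "sh T (int k) P \<in> ind_objs T G"
    using shifted_ind_common assms(3-5) by blast
  let ?s = "sh T (int k)" and ?m = "shm T (int k)"
  have obj: "R \<in> obj T" "Q \<in> obj T" "P \<in> obj T" "?s R \<in> obj T" "?s Q \<in> obj T" "?s P \<in> obj T"
    using assms by (auto simp: shifted_ind_obj sh_obj)
  have le: "le (?s R) (?s Q)" "le (?s Q) (?s P)" "le R P"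
    using assms obj le_trans by (auto simp: gen_le_sh)
  have mor: "?m h \<in> mor T (?s P) (?s Q)" "?m g \<in> mor T (?s Q) (?s R)"
    using h g obj by (auto intro: shm_mor)
  obtain f where f: "f \<in> mor T P R" "f \<noteq> 0"
    using le(3) obj by (auto simp: gen_le_iff_one_dim one_dim_def)
  then have "?m f \<in> mor T (?s P) (?s R)" "?m f \<noteq> 0"
    using obj by (auto simp: shm_mor shm_eq_0_iff)
  then obtain h' g' where fac: "h' \<in> mor T (?s P) (?s Q)" "g' \<in> mor T (?s Q) (?s R)" "?m f = g' \<cdot> h'"
    using linear_generator k le unfolding linear_generator_def by blast
  obtain c where c: "h' = scl T c (?m h)"
    using one_dim_multiple[OF _ mor(1) _ fac(1)] le(2) obj h shm_eq_0_iff[OF obj(3,2) h(1)]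
    by (auto simp: gen_le_iff_one_dim)
  obtain d where d: "g' = scl T d (?m g)"
    using one_dim_multiple[OF _ mor(2) _ fac(2)] le(1) obj g shm_eq_0_iff[OF obj(2,1) g(1)]
    by (auto simp: gen_le_iff_one_dim)
  have "?m g \<cdot> ?m h = 0"
    using shm_cmp[OF obj(3,2,1) h(1) g(1), of "int k"] zero by simp
  then have "g' \<cdot> h' = 0"
    using c d mor obj fac cmp_scl_left[of "?s P" "?s Q" "?s R" h' "?m g" d]
      cmp_scl_right[of "?s P" "?s Q" "?s R" "?m h" "?m g" c] by simp
  with fac(3) \<open>?m f \<noteq> 0\<close> show False by simp
qed

lemma shifted_ind_summand:
  assumes "direct_sum T G S Y" "s \<in> S" "indecomposable T (Y s)"
  shows "shifted_ind (Y s)"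
proof -
  have "Y s \<in> obj T" using assms(3) by (simp add: indecomposable_def)
  moreover have "Y s \<in> ind_objs T G"
    using summand_in_add_closure[OF assms(1,2)] assms(3) by (simp add: ind_objs_def)
  ultimately show ?thesis
    unfolding shifted_ind_def using sh_0[of "Y s"] by (metis of_nat_0)
qed

end

section \<open>Graded morphism spaces between the summands\<close>

text \<open>Indecomposables listed in increasing order, alternately not isomorphic and isomorphic to
  their suspensions.\<close>

locale ordered_summands = linearly_generated T G
  for T :: "('k::field, 'o, 'm::ab_group_add) tcat" (structure) and G :: 'o +
  fixes N :: nat and P :: "nat \<Rightarrow> 'o"
  assumes N: "1 \<le> N"
    and P_ind: "a \<in> {1..N} \<Longrightarrow> shifted_ind (P a)"
    and P_even: "a \<in> {1..N} \<Longrightarrow> iso_obj T (P a) (sh T 1 (P a)) \<longleftrightarrow> even a"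
    and P_le: "a \<in> {1..N} \<Longrightarrow> b \<in> {1..N} \<Longrightarrow> a < b \<Longrightarrow> le (P a) (P b)"
begin

lemma P_obj: "a \<in> {1..N} \<Longrightarrow> P a \<in> obj T"
  using P_ind shifted_ind_obj by blast

lemma P_sh_obj: "a \<in> {1..N} \<Longrightarrow> sh T d (P a) \<in> obj T"
  using P_obj sh_obj by blast

lemma P_sh_ind: "a \<in> {1..N} \<Longrightarrow> shifted_ind (sh T d (P a))"
  using P_ind shifted_ind_sh by blast

lemma P_le_eq: "a \<in> {1..N} \<Longrightarrow> b \<in> {1..N} \<Longrightarrow> a \<le> b \<Longrightarrow> le (P a) (P b)"
  using P_le le_refl[OF P_ind] by (cases "a = b") auto

lemma P_even_sh:
  assumes "a \<in> {1..N}" "even a"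
  shows "iso_obj T (sh T d (P a)) (P a)"
proof -
  have step: "iso_obj T (sh T i (P a)) (sh T (i + 1) (P a))" for i
    using iso_obj_sh[of "P a" "sh T 1 (P a)" i] P_even[OF assms(1)] assms(2)
      sh_add[OF P_obj[OF assms(1)], of i 1] by simp
  show ?thesis
  proof (induction d rule: int_induct[where k = 0])
    case base
    then show ?case using assms(1) by (simp add: sh_0 P_obj iso_obj_refl)
  next
    case (step1 i)
    then show ?case using step[of i] iso_obj_sym iso_obj_trans by blast
  next
    case (step2 i)
    then show ?case using step[of "i - 1"] iso_obj_trans by simp
  qed
qed

text \<open>If \<open>d > 0\<close>, the shift is absorbed by a summand \<open>P c\<close> with \<open>c\<close> even and \<open>a \<le> c \<le> b\<close>.\<close>

lemma le_of_path_type: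
  assumes a: "a \<in> {1..N}" and b: "b \<in> {1..N}" and t: "path_type a b d"
  shows "le (sh T d (P a)) (P b)"
proof (cases "d \<le> 0")
  case True
  have "le (sh T d (P a)) (sh T 0 (P a))"
    by (rule le_sh_mono[OF P_ind[OF a] True])
  moreover have "le (P a) (P b)"
    using P_le_eq[OF a b] t by (simp add: path_type_def)
  ultimately show ?thesis
    using le_trans[of _ "P a"] P_ind P_sh_ind a b by (simp add: sh_0 P_obj)
next
  case False
  define c where "c = (if even a then a else a + 1)"
  have c: "c \<in> {1..N}" "a \<le> c" "c \<le> b" "even c"
    using t a b False by (auto simp: c_def path_type_def)
  have "le (sh T d (P a)) (sh T d (P c))"
    using P_le_eq[OF a c(1,2)] a c(1) by (simp add: gen_le_sh P_obj)
  moreover have "le (sh T d (P c)) (P c)"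
    using le_iso[OF P_even_sh[OF c(1,4)]] P_ind P_sh_ind c(1) by blast
  moreover have "le (P c) (P b)"
    using P_le_eq[OF c(1) b c(3)] .
  ultimately show ?thesis
    using le_trans P_ind P_sh_ind a b c(1) by meson
qed

lemma mor_zero_of_not_path_type:
  assumes a: "a \<in> {1..N}" and b: "b \<in> {1..N}" and t: "\<not> path_type a b d"
  shows "mor T (P b) (sh T d (P a)) = {0}"
proof (rule mor_zero_of_le)
  show "shifted_ind (P b)" "shifted_ind (sh T d (P a))"
    using a b P_ind P_sh_ind by auto
  show "le (P b) (sh T d (P a))"
  proof (cases "b < a")
    case True
    have "le (sh T (- d) (P b)) (P a)"
      using le_of_path_type[OF b a] True by (simp add: path_type_def)
    then show ?thesis
      using gen_le_sh[of "P a" "sh T (- d) (P b)" d] a b by (simp add: P_obj P_sh_obj)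
  next
    case False
    then show ?thesis
      using t le_sh_mono[OF P_ind[OF a], of 0 d] a by (auto simp: path_type_def sh_0 P_obj)
  qed
  show "\<not> iso_obj T (P b) (sh T d (P a))"
  proof
    assume iso: "iso_obj T (P b) (sh T d (P a))"
    show False
    proof (cases "b < a")
      case False
      then have ab: "a = b" "odd a" "d \<ge> 1"
        using t by (auto simp: path_type_def)
      have "le (sh T 1 (P a)) (sh T d (P a))"
        by (rule le_sh_mono[OF P_ind[OF a] ab(3)])
      moreover have "le (sh T d (P a)) (P a)"
        using le_iso(2)[OF iso] ab(1) a P_ind P_sh_ind by simp
      ultimately have "le (sh T 1 (P a)) (P a)"
        using le_trans P_ind P_sh_ind a by meson
      then have "iso_obj T (P a) (sh T 1 (P a))"
        using le_antisym[OF le_sh1] P_ind P_sh_ind a by blast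
      with P_even[OF a] ab(2) show False by simp
    next
      case True
      \<comment> \<open>The neighbour of \<open>b\<close> is squeezed between \<open>P b\<close> and \<open>P a\<close>, so it is isomorphic to \<open>P b\<close>
        up to shift, although only one of the two is invariant under the suspension.\<close>
      define c where "c = b + 1"
      have c: "c \<in> {1..N}" "c \<le> a" "b < c"
        using True a b by (auto simp: c_def)
      have "le (sh T d (P c)) (sh T d (P a))"
        using P_le_eq[OF c(1) a c(2)] a c(1) by (simp add: gen_le_sh P_obj)
      moreover have "le (sh T d (P a)) (P b)"
        using le_iso(2)[OF iso] a b P_ind P_sh_ind by blast
      ultimately have "le (sh T d (P c)) (P b)"
        using le_trans P_ind P_sh_ind a b c(1) by meson
      moreover have "le (sh T (- d) (P b)) (P c)"
        using le_of_path_type[OF b c(1)] c(3) by (simp add: path_type_def)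
      then have "le (P b) (sh T d (P c))"
        using gen_le_sh[of "P c" "sh T (- d) (P b)" d] b c(1) by (simp add: P_obj P_sh_obj)
      ultimately have bc: "iso_obj T (P b) (sh T d (P c))"
        using le_antisym P_ind P_sh_ind b c(1) by blast
      have cb: "iso_obj T (P c) (sh T (- d) (P b))"
        using iso_obj_sym[OF iso_obj_sh[OF bc, of "- d"]] c(1) by (simp add: P_obj)
      have sh1: "iso_obj T X (sh T 1 X)"
        if "iso_obj T X (sh T i Y)" "iso_obj T Y (sh T 1 Y)" for X Y i
      proof -
        have "Y \<in> obj T" using that(2) by (simp add: iso_obj_def)
        then have "iso_obj T (sh T i Y) (sh T 1 (sh T i Y))"
          using iso_obj_sh[OF that(2), of i] sh_add[of Y i 1] sh_add[of Y 1 i]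
          by (simp add: add.commute)
        then show ?thesis
          using that(1) iso_obj_sh[OF that(1), of 1] iso_obj_sym iso_obj_trans by blast
      qed
      have "iso_obj T (P b) (sh T 1 (P b)) \<longleftrightarrow> iso_obj T (P c) (sh T 1 (P c))"
        using sh1[OF bc] sh1[OF cb] by blast
      with P_even[OF b] P_even[OF c(1)] show False
        by (simp add: c_def)
    qed
  qed
qed

text \<open>\<open>ghom a b d\<close> is the part of degree \<open>d\<close> in row \<open>a\<close> and column \<open>b\<close> of the graded endomorphism algebra,
  viewed as an algebra of matrices.\<close>

definition ghom :: "nat \<Rightarrow> nat \<Rightarrow> int \<Rightarrow> 'm set" where
  "ghom a b d = mor T (P b) (sh T d (P a))"

text \<open>The product of the graded endomorphism algebra on homogeneous elements; \<open>e\<close> is the degree of the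
  right factor \<open>v\<close>.\<close>

definition gprod :: "int \<Rightarrow> 'm \<Rightarrow> 'm \<Rightarrow> 'm" where
  "gprod e u v = shm T e u \<cdot> v"

lemma shm_hom:
  assumes "a \<in> {1..N}" "b \<in> {1..N}" "u \<in> ghom a b d"
  shows "shm T e u \<in> mor T (sh T e (P b)) (sh T (d + e) (P a))"
  using shm_mor[of "P b" "sh T d (P a)" u e] sh_add[of "P a" e d] assms
  by (simp add: ghom_def P_obj P_sh_obj add.commute)

lemma gprod_hom:
  assumes "a \<in> {1..N}" "b \<in> {1..N}" "c \<in> {1..N}" "u \<in> ghom a b d" "v \<in> ghom b c e"
  shows "gprod e u v \<in> ghom a c (d + e)"
  using cmp_mor[of "P c" "sh T e (P b)" "sh T (d + e) (P a)" v "shm T e u"] shm_hom[of a b u d e] assms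
  by (simp add: gprod_def ghom_def P_obj P_sh_obj)

lemma gprod_assoc:
  assumes "a \<in> {1..N}" "b \<in> {1..N}" "c \<in> {1..N}" "c' \<in> {1..N}"
    and u: "u \<in> ghom a b d" and v: "v \<in> ghom b c e" and w: "w \<in> ghom c c' f"
  shows "gprod f (gprod e u v) w = gprod (e + f) u (gprod f v w)"
proof -
  have "shm T f (shm T e u \<cdot> v) = shm T f (shm T e u) \<cdot> shm T f v"
    using shm_cmp[of "P c" "sh T e (P b)" "sh T (d + e) (P a)" v "shm T e u" f]
      shm_hom[OF _ _ u, of e] v assms(1-4) by (simp add: ghom_def P_obj P_sh_obj)
  also have "shm T f (shm T e u) = shm T (e + f) u"
    using shm_comp[of "P b" "sh T d (P a)" u f e] u assms(1-4)
    by (simp add: ghom_def P_obj P_sh_obj add.commute)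
  finally show ?thesis
    using cmp_assoc[of "P c'" "sh T f (P c)" "sh T (e + f) (P b)" "sh T (d + (e + f)) (P a)"
        w "shm T f v" "shm T (e + f) u"] shm_hom[OF _ _ u, of "e + f"] shm_hom[OF _ _ v, of f] w assms(1-4)
    by (simp add: gprod_def ghom_def P_obj P_sh_obj)
qed

lemma ident_hom: "a \<in> {1..N} \<Longrightarrow> ident T (P a) \<in> ghom a a 0"
  by (simp add: ghom_def P_obj sh_0 ident_mor)

lemma gprod_ident:
  assumes "a \<in> {1..N}" "b \<in> {1..N}" "u \<in> ghom a b d"
  shows "gprod d (ident T (P a)) u = u" "gprod 0 u (ident T (P b)) = u"
  using assms cmp_ident_left[of "P b" "sh T d (P a)" u] cmp_ident_right[of "P b" "sh T d (P a)" u]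
    shm_0[of "P b" "sh T d (P a)" u]
  by (simp_all add: gprod_def shm_ident P_obj P_sh_obj ghom_def)

lemma hom_one_dim:
  assumes "a \<in> {1..N}" "b \<in> {1..N}" "path_type a b d"
  shows "one_dim (P b) (sh T d (P a))"
  using le_of_path_type[OF assms] assms by (simp add: gen_le_iff_one_dim P_obj P_sh_obj)

lemma ident_P_nonzero: "a \<in> {1..N} \<Longrightarrow> ident T (P a) \<noteq> 0"
  using hom_one_dim[of a a 0] gprod_ident(1)[of a a _ 0] cmp_zero_left[of "P a" "P a" "P a"]
  by (auto simp: one_dim_def gprod_def path_type_def ghom_def sh_0 P_obj shm_zero)

lemma gprod_nonzero:
  assumes "a \<in> {1..N}" "b \<in> {1..N}" "c \<in> {1..N}" "u \<in> ghom a b d" "v \<in> ghom b c e" "u \<noteq> 0" "v \<noteq> 0"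
  shows "gprod e u v \<noteq> 0"
proof -
  have "path_type a b d" "path_type b c e"
    using mor_zero_of_not_path_type assms unfolding ghom_def by blast+
  then have "le (sh T (d + e) (P a)) (sh T e (P b))" "le (sh T e (P b)) (P c)"
    using le_of_path_type assms gen_le_sh[of "P b" "sh T d (P a)" e] sh_add[of "P a" e d]
    by (simp_all add: P_obj P_sh_obj add.commute)
  moreover have "shm T e u \<noteq> 0"
    using assms shm_eq_0_iff[of "P b" "sh T d (P a)" u e] by (simp add: ghom_def P_obj P_sh_obj)
  ultimately show ?thesis
    using cmp_nonzero[of "sh T (d + e) (P a)" "sh T e (P b)" "P c" v "shm T e u"] assms
      shm_hom[of a b u d e] by (simp add: gprod_def ghom_def P_ind P_sh_ind)
qed

lemma gprod_zero:
  assumes "a \<in> {1..N}" "b \<in> {1..N}" "c \<in> {1..N}" "u \<in> ghom a b d"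
  shows "gprod e u 0 = 0"
  using cmp_zero_right[of "P c" "sh T e (P b)" "sh T (d + e) (P a)" "shm T e u"] assms shm_hom[of a b u d e]
  by (simp add: gprod_def P_obj P_sh_obj)

lemma gprod_cancel:
  assumes "a \<in> {1..N}" "b \<in> {1..N}" "c \<in> {1..N}" "u \<in> ghom a b d" "u \<noteq> 0"
    and "v \<in> ghom b c e" "w \<in> ghom b c e" "gprod e u v = gprod e u w"
  shows "v = w"
proof -
  have "v - w \<in> ghom b c e"
    using assms by (auto simp: ghom_def P_obj P_sh_obj intro: mor_diff)
  moreover have "gprod e u (v - w) + gprod e u w = gprod e u v"
    using cmp_add_right[of "P c" "sh T e (P b)" "sh T (d + e) (P a)" "v - w" w "shm T e u"]
      assms shm_hom[of a b u d e] calculation by (simp add: gprod_def P_obj P_sh_obj ghom_def)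
  ultimately show ?thesis
    using gprod_nonzero[of a b c u d "v - w" e] assms by auto
qed

lemma gprod_solve:
  assumes "a \<in> {1..N}" "b \<in> {1..N}" "c \<in> {1..N}" "u \<in> ghom a b d" "u \<noteq> 0"
    and "path_type b c e" "w \<in> ghom a c (d + e)"
  shows "\<exists>v\<in>ghom b c e. gprod e u v = w"
proof -
  obtain v where v: "v \<in> ghom b c e" "v \<noteq> 0"
    using hom_one_dim[OF assms(2,3,6)] by (auto simp: one_dim_def ghom_def)
  have ab: "path_type a b d"
    using mor_zero_of_not_path_type assms unfolding ghom_def by blast
  obtain k where "w = scl T k (gprod e u v)"
    using one_dim_multiple[OF hom_one_dim[OF assms(1,3) path_type_comp[OF ab assms(6)]], of "gprod e u v" w]
      gprod_hom[OF assms(1-4) v(1)] gprod_nonzero[OF assms(1-4) v(1) assms(5) v(2)] assms(7)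
    by (auto simp: ghom_def)
  also have "\<dots> = gprod e u (scl T k v)"
    using cmp_scl_right[of "P c" "sh T e (P b)" "sh T (d + e) (P a)" v "shm T e u" k]
      shm_hom[of a b u d e] assms v(1) by (simp add: gprod_def ghom_def P_obj P_sh_obj)
  finally show ?thesis
    using v(1) mor_scl[of "P c" "sh T e (P b)" v k] assms(2,3) by (auto simp: ghom_def P_obj P_sh_obj)
qed

end

section \<open>A multiplicative basis\<close>

context ordered_summands
begin

text \<open>The normalisation propagates from the first summand. The vectors \<open>F b d : P b \<rightarrow> P 1[d]\<close> are
  determined by powers of \<open>\<alpha> : P 1 \<rightarrow> P 1[-1]\<close> and the chosen \<open>\<delta> b : P b \<rightarrow> P 1\<close>, and \<open>E a b d\<close> is the
  solution of \<open>F a 0 \<cdot> E a b d = F b d\<close>. Multiplicativity is checked after multiplication with \<open>F a 0\<close>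
  and a power of \<open>\<alpha>\<close> on the left, which can be cancelled.\<close>

theorem ex_multiplicative_basis:
  "\<exists>E. (\<forall>a\<in>{1..N}. \<forall>b\<in>{1..N}. \<forall>d. path_type a b d \<longrightarrow> E a b d \<in> ghom a b d \<and> E a b d \<noteq> 0) \<and>
       (\<forall>a\<in>{1..N}. E a a 0 = ident T (P a)) \<and>
       (\<forall>a\<in>{1..N}. \<forall>b\<in>{1..N}. \<forall>c\<in>{1..N}. \<forall>d e. path_type a b d \<longrightarrow> path_type b c e \<longrightarrow>
          gprod e (E a b d) (E b c e) = E a c (d + e))"
proof -
  have one: "1 \<in> {1..N}" using N by simp
  have ex: "\<exists>x\<in>ghom 1 b d. x \<noteq> 0" if "b \<in> {1..N}" "path_type 1 b d" for b d
    using hom_one_dim[OF one that] by (auto simp: one_dim_def ghom_def)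
  have "path_type 1 1 (- 1)" by (simp add: path_type_def)
  then obtain \<alpha> where \<alpha>: "\<alpha> \<in> ghom 1 1 (- 1)" "\<alpha> \<noteq> 0"
    using ex[OF one] by blast
  define A where "A = rec_nat (ident T (P 1)) (\<lambda>k. gprod (- int k) \<alpha>)"
  have A_0: "A 0 = ident T (P 1)" and A_Suc: "A (Suc k) = gprod (- int k) \<alpha> (A k)" for k
    by (simp_all add: A_def)
  have A: "A k \<in> ghom 1 1 (- int k) \<and> A k \<noteq> 0" for k
  proof (induction k)
    case 0
    then show ?case using ident_hom[OF one] ident_P_nonzero[OF one] by (simp add: A_0)
  next
    case (Suc k)
    then show ?case
      using gprod_hom[OF one one one \<alpha>(1), of "A k" "- int k"]
        gprod_nonzero[OF one one one \<alpha>(1) _ \<alpha>(2), of "A k" "- int k"] by (simp add: A_Suc)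
  qed
  have Ah: "A k \<in> ghom 1 1 (- int k)" and An: "A k \<noteq> 0" for k
    using A by blast+
  have A_add: "gprod (- int k) (A j) (A k) = A (j + k)" for j k
  proof (induction j)
    case 0
    then show ?case using gprod_ident(1)[OF one one] A by (simp add: A_0)
  next
    case (Suc j)
    then show ?case
      using gprod_assoc[OF one one one one \<alpha>(1), of "A j" "- int j" "A k" "- int k"] A
      by (simp add: A_Suc algebra_simps)
  qed
  define \<delta> where "\<delta> b = (if b = 1 then ident T (P 1) else SOME x. x \<in> ghom 1 b 0 \<and> x \<noteq> 0)" for b
  have \<delta>: "\<delta> b \<in> ghom 1 b 0" "\<delta> b \<noteq> 0" if b: "b \<in> {1..N}" for b
  proof -
    have "\<exists>x. x \<in> ghom 1 b 0 \<and> x \<noteq> 0"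
      using ex[OF b, of 0] b by (auto simp: path_type_def)
    from someI_ex[OF this] show "\<delta> b \<in> ghom 1 b 0" "\<delta> b \<noteq> 0"
      using ident_hom[OF one] ident_P_nonzero[OF one] by (auto simp: \<delta>_def)
  qed
  \<comment> \<open>\<open>F b d\<close> stands for \<open>\<alpha>\<^sup>-\<^sup>d \<delta> b\<close>, also for positive \<open>d\<close>, where \<open>\<alpha>\<close> is not invertible.\<close>
  define F where "F b d = (SOME x. x \<in> ghom 1 b d \<and>
      gprod d (A (nat d)) x = gprod 0 (A (nat (- d))) (\<delta> b))" for b d
  have F: "F b d \<in> ghom 1 b d" "gprod d (A (nat d)) (F b d) = gprod 0 (A (nat (- d))) (\<delta> b)"
    if b: "b \<in> {1..N}" and t: "path_type 1 b d" for b d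
  proof -
    have "- int (nat (- d)) + 0 = - int (nat d) + d" by simp
    then have "gprod 0 (A (nat (- d))) (\<delta> b) \<in> ghom 1 b (- int (nat d) + d)"
      using gprod_hom[OF one one b Ah \<delta>(1)[OF b]] by metis
    then have "\<exists>x. x \<in> ghom 1 b d \<and> gprod d (A (nat d)) x = gprod 0 (A (nat (- d))) (\<delta> b)"
      using gprod_solve[OF one one b Ah An t] by blast
    from someI_ex[OF this]
    show "F b d \<in> ghom 1 b d" "gprod d (A (nat d)) (F b d) = gprod 0 (A (nat (- d))) (\<delta> b)"
      by (simp_all add: F_def)
  qed
  have F_A: "gprod d (A j) (F b d) = gprod 0 (A k) (\<delta> b)"
    if b: "b \<in> {1..N}" and t: "path_type 1 b d" and jk: "int j - int k = d" for b d j k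
  proof -
    \<comment> \<open>Both \<open>j\<close> and \<open>k\<close> exceed the minimal exponents \<open>nat d\<close> and \<open>nat (- d)\<close> by the same \<open>m\<close>.\<close>
    define m where "m = j - nat d"
    have m: "j = m + nat d" "k = m + nat (- d)"
      using jk by (auto simp: m_def)
    have "gprod d (A j) (F b d) = gprod (- int (nat d) + d) (A m) (gprod d (A (nat d)) (F b d))"
      using gprod_assoc[OF one one one b Ah Ah F(1)[OF b t]] by (simp add: m(1) A_add del: int_nat_eq)
    also have "\<dots> = gprod (- int (nat (- d)) + 0) (A m) (gprod 0 (A (nat (- d))) (\<delta> b))"
      using F(2)[OF b t] by simp
    also have "\<dots> = gprod 0 (A k) (\<delta> b)"
      using gprod_assoc[OF one one one b Ah[of m] Ah[of "nat (- d)"] \<delta>(1)[OF b]]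
      by (simp add: m(2) A_add del: int_nat_eq)
    finally show ?thesis .
  qed
  have F_shift: "gprod d (A k) (F b d) = F b (d - int k)"
    if b: "b \<in> {1..N}" and t: "path_type 1 b d" for b d k
  proof -
    let ?j = "nat (d - int k)"
    have t': "path_type 1 b (d - int k)"
      using t b by (auto simp: path_type_def)
    have "gprod (d - int k) (A ?j) (gprod d (A k) (F b d)) = gprod d (A (?j + k)) (F b d)"
      using gprod_assoc[OF one one one b Ah[of ?j] Ah[of k] F(1)[OF b t]]
      by (simp add: A_add del: int_nat_eq)
    also have "\<dots> = gprod 0 (A (nat (- (d - int k)))) (\<delta> b)"
      by (rule F_A[OF b t]) simp
    also have "\<dots> = gprod (d - int k) (A ?j) (F b (d - int k))"
      using F(2)[OF b t'] by simp
    finally show ?thesis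
      using gprod_hom[OF one one b Ah[of k] F(1)[OF b t]]
      by (intro gprod_cancel[OF one one b Ah[of ?j] An _ F(1)[OF b t']]) simp_all
  qed
  have F_nonzero: "F b d \<noteq> 0" if b: "b \<in> {1..N}" and t: "path_type 1 b d" for b d
    using F(2)[OF b t] gprod_nonzero[OF one one b Ah \<delta>(1)[OF b] An \<delta>(2)[OF b]]
      gprod_zero[OF one one b Ah] by metis
  have F_0: "F b 0 = \<delta> b" if b: "b \<in> {1..N}" for b
    using F[OF b, of 0] gprod_ident(1)[OF one b] \<delta>[OF b] b by (simp add: A_0 path_type_def)
  define E where "E a b d = (SOME x. x \<in> ghom a b d \<and> gprod d (F a 0) x = F b d)" for a b d
  have type_1: "path_type 1 b d" if "a \<in> {1..N}" "path_type a b d" for a b d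
    using that by (cases "a = 1") (auto simp: path_type_def)
  have E: "E a b d \<in> ghom a b d" "gprod d (F a 0) (E a b d) = F b d"
    if a: "a \<in> {1..N}" and b: "b \<in> {1..N}" and t: "path_type a b d" for a b d
  proof -
    have "\<exists>x. x \<in> ghom a b d \<and> gprod d (F a 0) x = F b d"
      using gprod_solve[OF one a b _ _ t, of "F a 0" 0 "F b d"] F(1)[OF b type_1[OF a t]] \<delta>[OF a]
      by (auto simp: F_0[OF a])
    from someI_ex[OF this] show "E a b d \<in> ghom a b d" "gprod d (F a 0) (E a b d) = F b d"
      by (simp_all add: E_def)
  qed
  have "E a b d \<noteq> 0" if a: "a \<in> {1..N}" and b: "b \<in> {1..N}" and t: "path_type a b d" for a b d
    using E(2)[OF a b t] F_nonzero[OF b type_1[OF a t]] gprod_zero[OF one a b] \<delta>[OF a]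
    by (auto simp: F_0[OF a])
  moreover have "E a a 0 = ident T (P a)" if a: "a \<in> {1..N}" for a
  proof -
    have "path_type a a 0" by (simp add: path_type_def)
    with E[OF a a this] show ?thesis
      using gprod_cancel[OF one a a _ _ _ ident_hom[OF a], of "F a 0" 0 "E a a 0"]
        gprod_ident(2)[OF one a] \<delta>[OF a] by (simp add: F_0[OF a])
  qed
  moreover have "gprod e (E a b d) (E b c e) = E a c (d + e)"
    if a: "a \<in> {1..N}" and b: "b \<in> {1..N}" and c: "c \<in> {1..N}"
      and t: "path_type a b d" and t': "path_type b c e" for a b c d e
  proof -
    have t2: "path_type a c (d + e)" by (rule path_type_comp[OF t t'])
    have b1: "path_type 1 b d" and c1: "path_type 1 c e" and c2: "path_type 1 c (d + e)"
      using type_1 a b t t' t2 by blast+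
    let ?j = "nat d" and ?k = "nat (- d)"
    have Eh: "E a b d \<in> ghom a b d" "E b c e \<in> ghom b c e" "E a c (d + e) \<in> ghom a c (d + e)"
      using E(1) a b c t t' t2 by blast+
    have Fh: "F a 0 \<in> ghom 1 a 0" "F a 0 \<noteq> 0" "F b d \<in> ghom 1 b d" "F c (d + e) \<in> ghom 1 c (d + e)"
      "F b 0 \<in> ghom 1 b 0"
      using F(1) \<delta> a b c b1 c2 by (auto simp: F_0)
    have "gprod (d + e) (A ?j) (gprod e (F b d) (E b c e)) = gprod e (gprod d (A ?j) (F b d)) (E b c e)"
      using gprod_assoc[OF one one b c Ah[of ?j] Fh(3) Eh(2)] by simp
    also have "gprod d (A ?j) (F b d) = gprod 0 (A ?k) (F b 0)"
      using F(2)[OF b b1] by (simp add: F_0[OF b])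
    also have "gprod e (gprod 0 (A ?k) (F b 0)) (E b c e) = gprod e (A ?k) (F c e)"
      using gprod_assoc[OF one one b c Ah[of ?k] Fh(5) Eh(2)] E(2)[OF b c t'] by simp
    also have "\<dots> = gprod (d + e) (A ?j) (F c (d + e))"
      by (cases "d \<ge> 0") (simp_all add: F_shift[OF c c1] F_shift[OF c c2] add.commute)
    finally have "gprod e (F b d) (E b c e) = F c (d + e)"
      using gprod_cancel[OF one one c, of "A ?j" "- int ?j" "gprod e (F b d) (E b c e)" "d + e"]
        Ah An Fh Eh gprod_hom[OF one b c Fh(3) Eh(2)] by blast
    then have "gprod (d + e) (F a 0) (gprod e (E a b d) (E b c e)) = gprod (d + e) (F a 0) (E a c (d + e))"
      using gprod_assoc[OF one a b c Fh(1) Eh(1,2)] E(2)[OF a b t] E(2)[OF a c t2] by simp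
    then show ?thesis
      using gprod_cancel[OF one a c Fh(1,2)] gprod_hom[OF a b c Eh(1,2)] Eh(3) by blast
  qed
  ultimately show ?thesis
    using E(1) by (intro exI[of _ E]) blast
qed

end

section \<open>Matrix entries of graded endomorphisms\<close>

text \<open>The summands together with a decomposition of \<open>G\<close> and a multiplicative basis.\<close>

locale basis_of_summands = ordered_summands T G N P
  for T :: "('k::field, 'o, 'm::ab_group_add) tcat" (structure) and G :: 'o
    and N :: nat and P :: "nat \<Rightarrow> 'o" +
  fixes n :: nat and inc prj :: "nat \<Rightarrow> 'm" and E :: "nat \<Rightarrow> nat \<Rightarrow> int \<Rightarrow> 'm"
  assumes N_eq: "N = 2 * n - 1"
    and G_obj: "G \<in> obj T"
    and inc: "a \<in> {1..N} \<Longrightarrow> inc a \<in> mor T (P a) G"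
    and prj: "a \<in> {1..N} \<Longrightarrow> prj a \<in> mor T G (P a)"
    and prj_inc: "a \<in> {1..N} \<Longrightarrow> b \<in> {1..N} \<Longrightarrow>
      prj b \<cdot> inc a = (if a = b then ident T (P a) else 0)"
    and sum_inc_prj: "(\<Sum>a\<in>{1..N}. inc a \<cdot> prj a) = ident T G"
    and E_hom: "a \<in> {1..N} \<Longrightarrow> b \<in> {1..N} \<Longrightarrow> path_type a b d \<Longrightarrow> E a b d \<in> ghom a b d"
    and E_nonzero: "a \<in> {1..N} \<Longrightarrow> b \<in> {1..N} \<Longrightarrow> path_type a b d \<Longrightarrow> E a b d \<noteq> 0"
    and E_ident: "a \<in> {1..N} \<Longrightarrow> E a a 0 = ident T (P a)"
    and E_mult: "a \<in> {1..N} \<Longrightarrow> b \<in> {1..N} \<Longrightarrow> c \<in> {1..N} \<Longrightarrow> path_type a b d \<Longrightarrow>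
      path_type b c e \<Longrightarrow> gprod e (E a b d) (E b c e) = E a c (d + e)"
begin

abbreviation V :: "int \<Rightarrow> 'm set" where
  "V d \<equiv> mor T G (sh T d G)"

text \<open>The endomorphism \<open>G \<rightarrow> P b \<rightarrow> P a[d] \<rightarrow> G[d]\<close> with the single matrix entry \<open>u\<close>, in row \<open>a\<close>
  and column \<open>b\<close>.\<close>

definition embed :: "nat \<Rightarrow> nat \<Rightarrow> int \<Rightarrow> 'm \<Rightarrow> 'm" where
  "embed a b d u = shm T d (inc a) \<cdot> (u \<cdot> prj b)"

text \<open>The matrix entry of \<open>f : G \<rightarrow> G[d]\<close> in row \<open>a\<close> and column \<open>b\<close>.\<close>

definition entry :: "nat \<Rightarrow> nat \<Rightarrow> int \<Rightarrow> 'm \<Rightarrow> 'm" where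
  "entry a b d f = shm T d (prj a) \<cdot> (f \<cdot> inc b)"

lemma G_sh_obj: "sh T d G \<in> obj T"
  using G_obj sh_obj by blast

lemma shm_inc: "a \<in> {1..N} \<Longrightarrow> shm T d (inc a) \<in> mor T (sh T d (P a)) (sh T d G)"
  using inc shm_mor P_obj G_obj by blast

lemma shm_prj: "a \<in> {1..N} \<Longrightarrow> shm T d (prj a) \<in> mor T (sh T d G) (sh T d (P a))"
  using prj shm_mor P_obj G_obj by blast

lemma shm_prj_inc:
  assumes "a \<in> {1..N}" "b \<in> {1..N}"
  shows "shm T d (prj b) \<cdot> shm T d (inc a) = (if a = b then ident T (sh T d (P a)) else 0)"
  using shm_cmp[of "P a" G "P b" "inc a" "prj b" d] prj_inc[OF assms] assms
  by (auto simp: P_obj G_obj inc prj shm_ident)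

lemma embed_V:
  assumes "a \<in> {1..N}" "b \<in> {1..N}" "u \<in> ghom a b d"
  shows "embed a b d u \<in> V d"
  unfolding embed_def
  using assms cmp_mor[of G "P b" "sh T d (P a)" "prj b" u] shm_inc[of a d]
  by (auto simp: ghom_def P_obj P_sh_obj G_obj G_sh_obj prj
      intro: cmp_mor[where Y = "sh T d (P a)"])

lemma entry_hom:
  assumes "a \<in> {1..N}" "b \<in> {1..N}" "f \<in> V d"
  shows "entry a b d f \<in> ghom a b d"
  unfolding entry_def ghom_def
  using assms cmp_mor[of "P b" G "sh T d G" "inc b" f] shm_prj[of a d]
  by (auto simp: P_obj P_sh_obj G_obj G_sh_obj inc
      intro: cmp_mor[where Y = "sh T d G"])

lemma embed_scl:
  assumes "a \<in> {1..N}" "b \<in> {1..N}" "u \<in> ghom a b d"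
  shows "embed a b d (scl T c u) = scl T c (embed a b d u)"
  using assms cmp_scl_left[of G "P b" "sh T d (P a)" "prj b" u c]
    cmp_scl_right[of G "sh T d (P a)" "sh T d G" "u \<cdot> prj b" "shm T d (inc a)" c]
    cmp_mor[of G "P b" "sh T d (P a)" "prj b" u] shm_inc[of a d]
  by (simp add: embed_def ghom_def P_obj P_sh_obj G_obj G_sh_obj prj)

lemma embed_zero:
  assumes "a \<in> {1..N}" "b \<in> {1..N}"
  shows "embed a b d 0 = 0"
  using assms cmp_zero_left[of G "P b" "sh T d (P a)" "prj b"]
    cmp_zero_right[of G "sh T d (P a)" "sh T d G" "shm T d (inc a)"] shm_inc[of a d]
  by (simp add: embed_def P_obj P_sh_obj G_obj G_sh_obj prj)

lemma entry_scl:
  assumes "a \<in> {1..N}" "b \<in> {1..N}" "f \<in> V d"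
  shows "entry a b d (scl T c f) = scl T c (entry a b d f)"
  using assms cmp_scl_left[of "P b" G "sh T d G" "inc b" f c]
    cmp_scl_right[of "P b" "sh T d G" "sh T d (P a)" "f \<cdot> inc b" "shm T d (prj a)" c]
    cmp_mor[of "P b" G "sh T d G" "inc b" f] shm_prj[of a d]
  by (simp add: entry_def P_obj P_sh_obj G_obj G_sh_obj inc)

lemma entry_sum:
  assumes "a \<in> {1..N}" "b \<in> {1..N}" "\<And>i. i \<in> S \<Longrightarrow> f i \<in> V d"
  shows "entry a b d (\<Sum>i\<in>S. f i) = (\<Sum>i\<in>S. entry a b d (f i))"
  using assms cmp_sum_left[of "P b" G "sh T d G" "inc b" S f]
    cmp_sum_right[of "P b" "sh T d G" "sh T d (P a)" "shm T d (prj a)" S "\<lambda>i. f i \<cdot> inc b"]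
    cmp_mor[of "P b" G "sh T d G" "inc b"] shm_prj[of a d]
  by (simp add: entry_def P_obj P_sh_obj G_obj G_sh_obj inc)

lemma embed_mult:
  assumes a: "a \<in> {1..N}" "b \<in> {1..N}" "b' \<in> {1..N}" "c \<in> {1..N}"
    and u: "u \<in> ghom a b d" and v: "v \<in> ghom b' c e"
  shows "shm T e (embed a b d u) \<cdot> embed b' c e v =
    (if b = b' then embed a c (d + e) (gprod e u v) else 0)"
proof -
  note obj = P_obj[OF a(1)] P_obj[OF a(2)] P_obj[OF a(3)] P_obj[OF a(4)]
    P_sh_obj[OF a(1), of d] P_sh_obj[OF a(1), of "d + e"] P_sh_obj[OF a(2), of e] P_sh_obj[OF a(3), of e]
    G_obj G_sh_obj[of d] G_sh_obj[of e] G_sh_obj[of "d + e"]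
  have up: "u \<cdot> prj b \<in> mor T G (sh T d (P a))"
    using cmp_mor[of G "P b" "sh T d (P a)" "prj b" u] u a obj prj by (simp add: ghom_def)
  have vp: "v \<cdot> prj c \<in> mor T G (sh T e (P b'))"
    using cmp_mor[of G "P c" "sh T e (P b')" "prj c" v] v a obj prj by (simp add: ghom_def)
  have sh_eq: "sh T e (sh T d (P a)) = sh T (d + e) (P a)" "sh T e (sh T d G) = sh T (d + e) G"
    using sh_add[of "P a" e d] sh_add[of G e d] obj by (simp_all add: add.commute)
  have su: "shm T e u \<in> mor T (sh T e (P b)) (sh T (d + e) (P a))"
    by (rule shm_hom[OF a(1,2) u])
  have "shm T e (embed a b d u) = shm T e (shm T d (inc a)) \<cdot> shm T e (u \<cdot> prj b)"
    unfolding embed_def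
    using shm_cmp[of G "sh T d (P a)" "sh T d G" "u \<cdot> prj b" "shm T d (inc a)" e] obj up shm_inc[OF a(1)]
    by simp
  also have "shm T e (shm T d (inc a)) = shm T (d + e) (inc a)"
    using shm_comp[of "P a" G "inc a" e d] inc[OF a(1)] obj by (simp add: add.commute)
  also have "shm T e (u \<cdot> prj b) = shm T e u \<cdot> shm T e (prj b)"
    using shm_cmp[of G "P b" "sh T d (P a)" "prj b" u e] u obj prj[OF a(2)] by (simp add: ghom_def)
  finally have eq: "shm T e (embed a b d u) = shm T (d + e) (inc a) \<cdot> (shm T e u \<cdot> shm T e (prj b))" .
  have sup: "shm T e u \<cdot> shm T e (prj b) \<in> mor T (sh T e G) (sh T (d + e) (P a))"
    using cmp_mor[of "sh T e G" "sh T e (P b)" "sh T (d + e) (P a)"] su shm_prj[OF a(2)] obj by blast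
  have ev: "embed b' c e v \<in> V e"
    by (rule embed_V[OF a(3,4) v])
  have "shm T e (embed a b d u) \<cdot> embed b' c e v =
      shm T (d + e) (inc a) \<cdot> ((shm T e u \<cdot> shm T e (prj b)) \<cdot> embed b' c e v)"
    unfolding eq using cmp_assoc[of G "sh T e G" "sh T (d + e) (P a)" "sh T (d + e) G"] obj ev sup shm_inc[OF a(1)]
    by blast
  also have "(shm T e u \<cdot> shm T e (prj b)) \<cdot> embed b' c e v =
      shm T e u \<cdot> (shm T e (prj b) \<cdot> embed b' c e v)"
    using cmp_assoc[of G "sh T e G" "sh T e (P b)" "sh T (d + e) (P a)"] obj ev su shm_prj[OF a(2)] by blast
  also have "shm T e (prj b) \<cdot> embed b' c e v = (shm T e (prj b) \<cdot> shm T e (inc b')) \<cdot> (v \<cdot> prj c)"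
    unfolding embed_def
    using cmp_assoc[of G "sh T e (P b')" "sh T e G" "sh T e (P b)" "v \<cdot> prj c" "shm T e (inc b')" "shm T e (prj b)"]
      obj vp shm_inc[OF a(3)] shm_prj[OF a(2)] by simp
  also have "\<dots> = (if b = b' then v \<cdot> prj c else 0)"
    using shm_prj_inc[OF a(3,2), of e] cmp_ident_left[of G "sh T e (P b')" "v \<cdot> prj c"]
      cmp_zero_left[of G "sh T e (P b')" "sh T e (P b)" "v \<cdot> prj c"] obj vp by auto
  finally have main: "shm T e (embed a b d u) \<cdot> embed b' c e v =
      shm T (d + e) (inc a) \<cdot> (shm T e u \<cdot> (if b = b' then v \<cdot> prj c else 0))" .
  show ?thesis
  proof (cases "b = b'")
    case True
    then have "shm T e u \<cdot> (v \<cdot> prj c) = gprod e u v \<cdot> prj c"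
      using cmp_assoc[of G "P c" "sh T e (P b)" "sh T (d + e) (P a)" "prj c" v "shm T e u"] obj v su prj[OF a(4)]
      by (simp add: gprod_def ghom_def)
    with True main show ?thesis by (simp add: embed_def)
  next
    case False
    then show ?thesis
      using main cmp_zero_right[of G "sh T e (P b)" "sh T (d + e) (P a)" "shm T e u"]
        cmp_zero_right[of G "sh T (d + e) (P a)" "sh T (d + e) G" "shm T (d + e) (inc a)"]
        obj su shm_inc[OF a(1), of "d + e"] by simp
  qed
qed

lemma entry_embed:
  assumes a: "a \<in> {1..N}" "b \<in> {1..N}" "a' \<in> {1..N}" "b' \<in> {1..N}" and u: "u \<in> ghom a b d"
  shows "entry a' b' d (embed a b d u) = (if a = a' \<and> b = b' then u else 0)"
proof -
  note obj = P_obj[OF a(1)] P_obj[OF a(2)] P_obj[OF a(3)] P_obj[OF a(4)]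
    P_sh_obj[OF a(1), of d] P_sh_obj[OF a(3), of d] G_obj G_sh_obj[of d]
  have u': "u \<in> mor T (P b) (sh T d (P a))" using u by (simp add: ghom_def)
  have up: "u \<cdot> prj b \<in> mor T G (sh T d (P a))"
    using cmp_mor[of G "P b" "sh T d (P a)" "prj b" u] u' a obj prj by simp
  define w where "w = (if b = b' then u else 0)"
  have w: "w \<in> mor T (P b') (sh T d (P a))"
    using u' obj by (auto simp: w_def)
  have "embed a b d u \<cdot> inc b' = shm T d (inc a) \<cdot> ((u \<cdot> prj b) \<cdot> inc b')"
    unfolding embed_def using cmp_assoc[of "P b'" G "sh T d (P a)" "sh T d G"] obj up shm_inc[OF a(1)] inc[OF a(4)]
    by blast
  also have "(u \<cdot> prj b) \<cdot> inc b' = u \<cdot> (prj b \<cdot> inc b')"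
    using cmp_assoc[of "P b'" G "P b" "sh T d (P a)"] obj u' prj[OF a(2)] inc[OF a(4)] by blast
  also have "\<dots> = w"
    using prj_inc[OF a(4,2)] cmp_ident_right[of "P b" "sh T d (P a)" u]
      cmp_zero_right[of "P b'" "P b" "sh T d (P a)" u] obj u' by (auto simp: w_def)
  finally have "entry a' b' d (embed a b d u) = shm T d (prj a') \<cdot> (shm T d (inc a) \<cdot> w)"
    by (simp add: entry_def)
  also have "\<dots> = (shm T d (prj a') \<cdot> shm T d (inc a)) \<cdot> w"
    using cmp_assoc[of "P b'" "sh T d (P a)" "sh T d G" "sh T d (P a')"] obj w shm_inc[OF a(1)] shm_prj[OF a(3)]
    by metis
  also have "\<dots> = (if a = a' then w else 0)"
    using shm_prj_inc[OF a(1,3), of d] cmp_ident_left[of "P b'" "sh T d (P a)" w]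
      cmp_zero_left[of "P b'" "sh T d (P a)" "sh T d (P a')" w] obj w by auto
  finally show ?thesis by (simp add: w_def)
qed

lemma sum_embed_comp:
  assumes f: "f \<in> V d"
  shows "(\<Sum>a\<in>{1..N}. \<Sum>b\<in>{1..N}. embed a b d (entry a b d f)) = f"
proof -
  note obj = G_obj G_sh_obj[of d]
  have ip: "inc b \<cdot> prj b \<in> mor T G G" if "b \<in> {1..N}" for b
    using cmp_mor[of G "P b" G "prj b" "inc b"] that by (simp add: P_obj G_obj inc prj)
  have sip: "shm T d (inc a \<cdot> prj a) \<in> mor T (sh T d G) (sh T d G)" if "a \<in> {1..N}" for a
    using ip[OF that] obj by (intro shm_mor)
  have fip: "f \<cdot> (inc b \<cdot> prj b) \<in> V d" if "b \<in> {1..N}" for b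
    using cmp_mor[of G G "sh T d G"] ip[OF that] f obj by blast
  have eq: "embed a b d (entry a b d f) = shm T d (inc a \<cdot> prj a) \<cdot> (f \<cdot> (inc b \<cdot> prj b))"
    if a: "a \<in> {1..N}" and b: "b \<in> {1..N}" for a b
  proof -
    note obj = obj P_obj[OF a] P_obj[OF b] P_sh_obj[OF a, of d]
    have fi: "f \<cdot> inc b \<in> mor T (P b) (sh T d G)"
      using cmp_mor[of "P b" G "sh T d G" "inc b" f] f obj inc[OF b] by blast
    have fip': "(f \<cdot> inc b) \<cdot> prj b \<in> V d"
      using cmp_mor[of G "P b" "sh T d G" "prj b" "f \<cdot> inc b"] fi obj prj[OF b] by blast
    have "embed a b d (entry a b d f) = shm T d (inc a) \<cdot> (shm T d (prj a) \<cdot> ((f \<cdot> inc b) \<cdot> prj b))"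
      unfolding embed_def entry_def
      using cmp_assoc[of G "P b" "sh T d G" "sh T d (P a)" "prj b" "f \<cdot> inc b" "shm T d (prj a)"]
        fi obj prj[OF b] shm_prj[OF a] by simp
    also have "\<dots> = (shm T d (inc a) \<cdot> shm T d (prj a)) \<cdot> ((f \<cdot> inc b) \<cdot> prj b)"
      using cmp_assoc[of G "sh T d G" "sh T d (P a)" "sh T d G"] fip' obj shm_inc[OF a] shm_prj[OF a] by metis
    also have "shm T d (inc a) \<cdot> shm T d (prj a) = shm T d (inc a \<cdot> prj a)"
      using shm_cmp[of G "P a" G "prj a" "inc a" d] obj inc[OF a] prj[OF a] by simp
    also have "(f \<cdot> inc b) \<cdot> prj b = f \<cdot> (inc b \<cdot> prj b)"
      using cmp_assoc[of G "P b" G "sh T d G" "prj b" "inc b" f] obj inc[OF b] prj[OF b] f by simp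
    finally show ?thesis .
  qed
  have "(\<Sum>a\<in>{1..N}. \<Sum>b\<in>{1..N}. embed a b d (entry a b d f)) =
      (\<Sum>a\<in>{1..N}. \<Sum>b\<in>{1..N}. shm T d (inc a \<cdot> prj a) \<cdot> (f \<cdot> (inc b \<cdot> prj b)))"
    by (intro sum.cong refl eq)
  also have "\<dots> = (\<Sum>a\<in>{1..N}. shm T d (inc a \<cdot> prj a) \<cdot> (\<Sum>b\<in>{1..N}. f \<cdot> (inc b \<cdot> prj b)))"
    using sip fip obj
    by (intro sum.cong refl cmp_sum_right[symmetric, where X = G and Y = "sh T d G" and Z = "sh T d G"])
  also have "(\<Sum>b\<in>{1..N}. f \<cdot> (inc b \<cdot> prj b)) = f"
    using cmp_sum_right[of G G "sh T d G" f "{1..N}" "\<lambda>b. inc b \<cdot> prj b"] ip f obj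
    by (simp add: sum_inc_prj cmp_ident_right del: One_nat_def)
  also have "(\<Sum>a\<in>{1..N}. shm T d (inc a \<cdot> prj a) \<cdot> f) = (\<Sum>a\<in>{1..N}. shm T d (inc a \<cdot> prj a)) \<cdot> f"
    using cmp_sum_left[of G "sh T d G" "sh T d G" f "{1..N}" "\<lambda>a. shm T d (inc a \<cdot> prj a)"] sip f obj by simp
  also have "(\<Sum>a\<in>{1..N}. shm T d (inc a \<cdot> prj a)) = ident T (sh T d G)"
    using shm_sum[of G G "{1..N}" "\<lambda>a. inc a \<cdot> prj a" d] ip obj
    by (simp add: sum_inc_prj shm_ident del: One_nat_def)
  also have "ident T (sh T d G) \<cdot> f = f"
    using cmp_ident_left[of G "sh T d G" f] f obj by blast
  finally show ?thesis .
qed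

text \<open>The basis vectors of the graded endomorphism algebra of \<open>G\<close>. Products of matching vectors are
  again basis vectors.\<close>

definition M :: "nat \<Rightarrow> nat \<Rightarrow> int \<Rightarrow> 'm" where
  "M a b d = embed a b d (E a b d)"

lemma M_V: "a \<in> {1..N} \<Longrightarrow> b \<in> {1..N} \<Longrightarrow> path_type a b d \<Longrightarrow> M a b d \<in> V d"
  unfolding M_def by (intro embed_V E_hom)

lemma M_mult:
  assumes "a \<in> {1..N}" "b \<in> {1..N}" "b' \<in> {1..N}" "c \<in> {1..N}" "path_type a b d" "path_type b' c e"
  shows "shm T e (M a b d) \<cdot> M b' c e = (if b = b' then M a c (d + e) else 0)"
  using embed_mult[OF assms(1-4) E_hom[OF assms(1,2,5)] E_hom[OF assms(3,4,6)]] E_mult[OF assms(1,2,4,5)] assms(6)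
  by (auto simp: M_def)

lemma M_ident: "a \<in> {1..N} \<Longrightarrow> M a a 0 = inc a \<cdot> prj a"
  using shm_0[of "P a" G "inc a"] cmp_ident_left[of G "P a" "prj a"]
  by (simp add: M_def embed_def E_ident P_obj G_obj inc prj)

lemma V_expand:
  assumes f: "f \<in> V d"
  obtains c where "f = (\<Sum>a\<in>{1..N}. \<Sum>b\<in>{1..N}. if path_type a b d then scl T (c a b) (M a b d) else 0)"
proof -
  have "\<exists>c. embed a b d (entry a b d f) = (if path_type a b d then scl T c (M a b d) else 0)"
    if a: "a \<in> {1..N}" and b: "b \<in> {1..N}" for a b
  proof (cases "path_type a b d")
    case True
    obtain c where "entry a b d f = scl T c (E a b d)"
      using one_dim_multiple[OF hom_one_dim[OF a b True]] entry_hom[OF a b f] E_hom[OF a b True] E_nonzero[OF a b True]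
      unfolding ghom_def by blast
    then show ?thesis
      using True embed_scl[OF a b E_hom[OF a b True]] by (auto simp: M_def)
  next
    case False
    then have "entry a b d f = 0"
      using mor_zero_of_not_path_type[OF a b False] entry_hom[OF a b f] by (auto simp: ghom_def)
    with False show ?thesis
      by (simp add: embed_zero[OF a b])
  qed
  then obtain c where c: "\<And>a b. a \<in> {1..N} \<Longrightarrow> b \<in> {1..N} \<Longrightarrow>
      embed a b d (entry a b d f) = (if path_type a b d then scl T (c a b) (M a b d) else 0)"
    by metis
  have "f = (\<Sum>a\<in>{1..N}. \<Sum>b\<in>{1..N}. embed a b d (entry a b d f))"
    using sum_embed_comp[OF f] by simp
  also have "\<dots> = (\<Sum>a\<in>{1..N}. \<Sum>b\<in>{1..N}. if path_type a b d then scl T (c a b) (M a b d) else 0)"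
    by (intro sum.cong refl c)
  finally have "f = (\<Sum>a\<in>{1..N}. \<Sum>b\<in>{1..N}. if path_type a b d then scl T (c a b) (M a b d) else 0)" .
  with that show thesis .
qed

end

section \<open>The graded endomorphism algebra as a quotient of the path algebra\<close>

lemma graded_end_algebra_sel:
  "carrier (graded_end_algebra T Y) = {u. \<forall>i. Poly_Mapping.lookup u i \<in> mor T Y (sh T i Y)}"
  "zero (graded_end_algebra T Y) = 0"
  "add (graded_end_algebra T Y) = (+)"
  "one (graded_end_algebra T Y) = Poly_Mapping.single 0 (ident T Y)"
  "smult (graded_end_algebra T Y) = (\<lambda>c. Poly_Mapping.map (scl T c))"
  "hpart (graded_end_algebra T Y) d = {Poly_Mapping.single d f | f. f \<in> mor T Y (sh T d Y)}"
  by (simp_all add: graded_end_algebra_def)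

context triangulated_category
begin

lemma graded_end_algebra_mult:
  assumes Y: "Y \<in> obj T"
    and u: "u \<in> carrier (graded_end_algebra T Y)" "finite S" "Poly_Mapping.keys u \<subseteq> S"
    and v: "v \<in> carrier (graded_end_algebra T Y)" "finite S'" "Poly_Mapping.keys v \<subseteq> S'"
  shows "u \<otimes>\<^bsub>graded_end_algebra T Y\<^esub> v = (\<Sum>j\<in>S. \<Sum>i\<in>S'.
    Poly_Mapping.single (j + i) (shm T i (Poly_Mapping.lookup u j) \<cdot> Poly_Mapping.lookup v i))"
proof -
  have zero_l: "0 \<cdot> Poly_Mapping.lookup v i = 0" for i
    using v(1) cmp_zero_left[of Y "sh T i Y" "sh T i Y"] Y sh_obj by (auto simp: graded_end_algebra_sel)
  have zero_r: "shm T i (Poly_Mapping.lookup u j) \<cdot> 0 = 0" for i j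
    using u(1) cmp_zero_right[of Y "sh T i Y" "sh T i (sh T j Y)" "shm T i (Poly_Mapping.lookup u j)"]
      shm_mor[of Y "sh T j Y" "Poly_Mapping.lookup u j" i] Y sh_obj by (auto simp: graded_end_algebra_sel)
  have "u \<otimes>\<^bsub>graded_end_algebra T Y\<^esub> v = (\<Sum>j\<in>Poly_Mapping.keys u. \<Sum>i\<in>Poly_Mapping.keys v.
      Poly_Mapping.single (j + i) (shm T i (Poly_Mapping.lookup u j) \<cdot> Poly_Mapping.lookup v i))"
    by (simp add: graded_end_algebra_def)
  also have "\<dots> = (\<Sum>j\<in>Poly_Mapping.keys u. \<Sum>i\<in>S'.
      Poly_Mapping.single (j + i) (shm T i (Poly_Mapping.lookup u j) \<cdot> Poly_Mapping.lookup v i))"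
    using v(2,3) by (intro sum.cong refl sum.mono_neutral_left) (auto simp: in_keys_iff zero_r)
  also have "\<dots> = (\<Sum>j\<in>S. \<Sum>i\<in>S'.
      Poly_Mapping.single (j + i) (shm T i (Poly_Mapping.lookup u j) \<cdot> Poly_Mapping.lookup v i))"
    using u(2,3) by (intro sum.mono_neutral_left) (auto simp: in_keys_iff zero_l)
  finally show ?thesis .
qed

lemma graded_end_algebra_mult_add_left:
  assumes Y: "Y \<in> obj T"
    and uv: "u \<in> carrier (graded_end_algebra T Y)" "u' \<in> carrier (graded_end_algebra T Y)"
      "v \<in> carrier (graded_end_algebra T Y)"
  shows "(u + u') \<otimes>\<^bsub>graded_end_algebra T Y\<^esub> v =
    u \<otimes>\<^bsub>graded_end_algebra T Y\<^esub> v + u' \<otimes>\<^bsub>graded_end_algebra T Y\<^esub> v"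
proof -
  let ?S = "Poly_Mapping.keys u \<union> Poly_Mapping.keys u'"
  have c: "u + u' \<in> carrier (graded_end_algebra T Y)"
    using uv Y by (simp add: graded_end_algebra_sel lookup_add mor_add sh_obj)
  have mult: "w \<otimes>\<^bsub>graded_end_algebra T Y\<^esub> v = (\<Sum>j\<in>?S. \<Sum>i\<in>Poly_Mapping.keys v.
    Poly_Mapping.single (j + i) (shm T i (Poly_Mapping.lookup w j) \<cdot> Poly_Mapping.lookup v i))"
    if "w \<in> {u, u', u + u'}" for w
    using that uv c keys_add[of u u'] by (intro graded_end_algebra_mult[OF Y]) auto
  have "shm T i (Poly_Mapping.lookup (u + u') j) \<cdot> Poly_Mapping.lookup v i =
     shm T i (Poly_Mapping.lookup u j) \<cdot> Poly_Mapping.lookup v i +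
     shm T i (Poly_Mapping.lookup u' j) \<cdot> Poly_Mapping.lookup v i" for i j
    using uv Y shm_add[of Y "sh T j Y" "Poly_Mapping.lookup u j" "Poly_Mapping.lookup u' j" i]
      cmp_add_left[of Y "sh T i Y" "sh T i (sh T j Y)" "Poly_Mapping.lookup v i"
        "shm T i (Poly_Mapping.lookup u j)" "shm T i (Poly_Mapping.lookup u' j)"]
    by (simp add: graded_end_algebra_sel lookup_add sh_obj shm_mor)
  then show ?thesis
    by (simp add: mult single_add sum.distrib)
qed

lemma graded_end_algebra_mult_add_right:
  assumes Y: "Y \<in> obj T"
    and uv: "u \<in> carrier (graded_end_algebra T Y)" "v \<in> carrier (graded_end_algebra T Y)"
      "v' \<in> carrier (graded_end_algebra T Y)"
  shows "u \<otimes>\<^bsub>graded_end_algebra T Y\<^esub> (v + v') =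
    u \<otimes>\<^bsub>graded_end_algebra T Y\<^esub> v + u \<otimes>\<^bsub>graded_end_algebra T Y\<^esub> v'"
proof -
  let ?S = "Poly_Mapping.keys v \<union> Poly_Mapping.keys v'"
  have c: "v + v' \<in> carrier (graded_end_algebra T Y)"
    using uv Y by (simp add: graded_end_algebra_sel lookup_add mor_add sh_obj)
  have mult: "u \<otimes>\<^bsub>graded_end_algebra T Y\<^esub> w = (\<Sum>j\<in>Poly_Mapping.keys u. \<Sum>i\<in>?S.
    Poly_Mapping.single (j + i) (shm T i (Poly_Mapping.lookup u j) \<cdot> Poly_Mapping.lookup w i))"
    if "w \<in> {v, v', v + v'}" for w
    using that uv c keys_add[of v v'] by (intro graded_end_algebra_mult[OF Y]) auto
  have "shm T i (Poly_Mapping.lookup u j) \<cdot> Poly_Mapping.lookup (v + v') i =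
     shm T i (Poly_Mapping.lookup u j) \<cdot> Poly_Mapping.lookup v i +
     shm T i (Poly_Mapping.lookup u j) \<cdot> Poly_Mapping.lookup v' i" for i j
    using uv Y cmp_add_right[of Y "sh T i Y" "sh T i (sh T j Y)" "Poly_Mapping.lookup v i"
        "Poly_Mapping.lookup v' i" "shm T i (Poly_Mapping.lookup u j)"]
    by (simp add: graded_end_algebra_sel lookup_add sh_obj shm_mor)
  then show ?thesis
    by (simp add: mult single_add sum.distrib)
qed

lemma graded_end_algebra_single:
  "Y \<in> obj T \<Longrightarrow> f \<in> mor T Y (sh T d Y) \<Longrightarrow>
    Poly_Mapping.single d f \<in> carrier (graded_end_algebra T Y)"
  by (auto simp: graded_end_algebra_sel lookup_single when_def sh_obj)

lemma graded_end_algebra_mult_single: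
  assumes "Y \<in> obj T" "f \<in> mor T Y (sh T d Y)" "g \<in> mor T Y (sh T e Y)"
  shows "Poly_Mapping.single d f \<otimes>\<^bsub>graded_end_algebra T Y\<^esub> Poly_Mapping.single e g =
    Poly_Mapping.single (d + e) (shm T e f \<cdot> g)"
  using graded_end_algebra_mult[OF assms(1) graded_end_algebra_single[OF assms(1,2)] _ _
      graded_end_algebra_single[OF assms(1,3)], of "{d}" "{e}"] by simp

end

lemma map_zero: "f 0 = 0 \<Longrightarrow> Poly_Mapping.map f 0 = 0"
  by (rule poly_mapping_eqI) (simp add: lookup_map_zero)

lemma smult_add:
  "Poly_Mapping.map ((*) c) (x + y) = Poly_Mapping.map ((*) c) x + Poly_Mapping.map ((*) c) (y :: _ \<Rightarrow>\<^sub>0 'k::comm_ring_1)"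
  by (rule poly_mapping_eqI) (simp add: lookup_add distrib_left lookup_map_zero)

context basis_of_summands
begin

text \<open>The image of \<open>c s\<close>, for a path \<open>s\<close> and a scalar \<open>c\<close>: a path from \<open>a\<close> to \<open>b\<close> of degree \<open>d\<close> is sent to
  the basis vector \<open>M a b d\<close> in degree \<open>d\<close>.\<close>

definition path_image :: "(nat, arrow) qpath \<Rightarrow> 'k \<Rightarrow> int \<Rightarrow>\<^sub>0 'm" where
  "path_image s c = Poly_Mapping.single (path_degree arrow_degree s)
     (scl T c (M (fst s) (snd (snd s)) (path_degree arrow_degree s)))"

text \<open>The linear extension of \<open>path_image\<close> to the path algebra.\<close>

definition \<Theta> :: "((nat, arrow) qpath \<Rightarrow>\<^sub>0 'k) \<Rightarrow> (int \<Rightarrow>\<^sub>0 'm)" where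
  "\<Theta> x = (\<Sum>s\<in>Poly_Mapping.keys x. path_image s (Poly_Mapping.lookup x s))"

abbreviation A where "A \<equiv> kQ n :: ('k, (nat, arrow) qpath \<Rightarrow>\<^sub>0 'k) graded_algebra"
abbreviation \<Lambda> where "\<Lambda> \<equiv> graded_end_algebra T G"

lemma path_image_0 [simp]: "path_image s 0 = 0"
  by (simp add: path_image_def)

lemma path_image_add: "path_image s (c + d) = path_image s c + path_image s d"
  by (simp add: path_image_def scl_add_left single_add)

lemma \<Theta>_superset:
  "finite S \<Longrightarrow> Poly_Mapping.keys x \<subseteq> S \<Longrightarrow> \<Theta> x = (\<Sum>s\<in>S. path_image s (Poly_Mapping.lookup x s))"
  unfolding \<Theta>_def by (intro sum.mono_neutral_left) (auto simp: in_keys_iff)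

lemma \<Theta>_add: "\<Theta> (x + y) = \<Theta> x + \<Theta> y"
proof -
  have "\<Theta> z = (\<Sum>s\<in>Poly_Mapping.keys x \<union> Poly_Mapping.keys y. path_image s (Poly_Mapping.lookup z s))"
    if "z \<in> {x, y, x + y}" for z
    using that keys_add[of x y] by (intro \<Theta>_superset) auto
  then show ?thesis
    by (simp add: lookup_add path_image_add sum.distrib)
qed

lemma \<Theta>_zero [simp]: "\<Theta> 0 = 0"
  by (simp add: \<Theta>_def)

lemma \<Theta>_single: "\<Theta> (Poly_Mapping.single s c) = path_image s c"
  using \<Theta>_superset[of "{s}" "Poly_Mapping.single s c"] by simp

lemma \<Theta>_diff: "\<Theta> (x - y) = \<Theta> x - \<Theta> y"
  using \<Theta>_add[of "x - y" y] by simp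

lemma \<Theta>_sum: "\<Theta> (\<Sum>i\<in>S. x i) = (\<Sum>i\<in>S. \<Theta> (x i))"
  by (induction S rule: infinite_finite_induct) (simp_all add: \<Theta>_add)

lemma qpath_type:
  assumes "s \<in> qpaths (quiverQ n)"
  shows "fst s \<in> {1..N}" "snd (snd s) \<in> {1..N}"
    "path_type (fst s) (snd (snd s)) (path_degree arrow_degree s)"
  using assms path_type_awalk[of n "fst s" "fst (snd s)" "snd (snd s)"]
    quiverQ.awalk_hd_in_verts[of n "fst s" "fst (snd s)" "snd (snd s)"]
    quiverQ.awalk_last_in_verts[of n "fst s" "fst (snd s)" "snd (snd s)"]
  by (auto simp: qpaths_def path_degree_def N_eq)

lemma M_scl_V: "a \<in> {1..N} \<Longrightarrow> b \<in> {1..N} \<Longrightarrow> path_type a b d \<Longrightarrow> scl T c (M a b d) \<in> V d"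
  using M_V mor_scl G_obj G_sh_obj by blast

lemma path_image_closed: "s \<in> qpaths (quiverQ n) \<Longrightarrow> path_image s c \<in> carrier \<Lambda>"
  unfolding path_image_def by (intro graded_end_algebra_single G_obj M_scl_V qpath_type)

lemma \<Lambda>_add_closed: "u \<in> carrier \<Lambda> \<Longrightarrow> v \<in> carrier \<Lambda> \<Longrightarrow> u + v \<in> carrier \<Lambda>"
  by (simp add: graded_end_algebra_sel lookup_add mor_add G_obj G_sh_obj)

lemma \<Theta>_closed:
  assumes "x \<in> carrier A"
  shows "\<Theta> x \<in> carrier \<Lambda>"
proof -
  have "Poly_Mapping.keys x \<subseteq> qpaths (quiverQ n)"
    using assms by (simp add: path_algebra_sel)
  then show ?thesis
  proof (induction x rule: poly_mapping_single_induct)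
    case zero
    then show ?case by (simp add: graded_end_algebra_sel G_obj G_sh_obj)
  qed (simp_all add: \<Theta>_add \<Theta>_single path_image_closed \<Lambda>_add_closed)
qed

lemma path_image_mult:
  assumes s: "s \<in> qpaths (quiverQ n)" and t: "t \<in> qpaths (quiverQ n)"
  shows "path_image s c \<otimes>\<^bsub>\<Lambda>\<^esub> path_image t c' = \<Theta> (path_prod s t (c * c'))"
proof -
  note s = qpath_type[OF s] and t = qpath_type[OF t]
  let ?d = "path_degree arrow_degree s" and ?e = "path_degree arrow_degree t"
  let ?f = "M (fst s) (snd (snd s)) ?d" and ?g = "M (fst t) (snd (snd t)) ?e"
  have "shm T ?e (scl T c ?f) \<cdot> scl T c' ?g = scl T (c * c') (shm T ?e ?f \<cdot> ?g)"
  proof -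
    have f: "?f \<in> V ?d" and g: "?g \<in> V ?e"
      using M_V s t by auto
    have sf: "shm T ?e ?f \<in> mor T (sh T ?e G) (sh T ?e (sh T ?d G))"
      using shm_mor[OF G_obj G_sh_obj f] .
    show ?thesis
      using shm_scl[OF G_obj G_sh_obj f, of ?e c] sf g G_obj G_sh_obj sh_obj
        cmp_scl_left[of G "sh T ?e G" "sh T ?e (sh T ?d G)" "scl T c' ?g" "shm T ?e ?f" c]
        cmp_scl_right[of G "sh T ?e G" "sh T ?e (sh T ?d G)" ?g "shm T ?e ?f" c']
      by (simp add: mor_scl scl_scl)
  qed
  also have "shm T ?e ?f \<cdot> ?g =
      (if snd (snd s) = fst t then M (fst s) (snd (snd t)) (?d + ?e) else 0)"
    by (rule M_mult[OF s(1,2) t(1,2) s(3) t(3)])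
  finally have "path_image s c \<otimes>\<^bsub>\<Lambda>\<^esub> path_image t c' = Poly_Mapping.single (?d + ?e)
     (if snd (snd s) = fst t then scl T (c * c') (M (fst s) (snd (snd t)) (?d + ?e)) else 0)"
    using graded_end_algebra_mult_single[OF G_obj M_scl_V[OF s] M_scl_V[OF t], of c c']
    by (simp add: path_image_def split: if_splits)
  then show ?thesis
    by (simp add: path_prod_def \<Theta>_single path_image_def path_degree_def split: prod.splits)
qed

lemma \<Theta>_mult:
  assumes "x \<in> carrier A" "y \<in> carrier A"
  shows "\<Theta> (x \<otimes>\<^bsub>A\<^esub> y) = \<Theta> x \<otimes>\<^bsub>\<Lambda>\<^esub> \<Theta> y"
proof -
  have zero: "0 \<otimes>\<^bsub>\<Lambda>\<^esub> u = 0" "u \<otimes>\<^bsub>\<Lambda>\<^esub> 0 = 0" for u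
    by (simp_all add: graded_end_algebra_def)
  have x: "Poly_Mapping.keys x \<subseteq> qpaths (quiverQ n)" and y: "Poly_Mapping.keys y \<subseteq> qpaths (quiverQ n)"
    using assms by (simp_all add: path_algebra_sel)
  have closed: "\<Theta> z \<in> carrier \<Lambda>" if "Poly_Mapping.keys z \<subseteq> qpaths (quiverQ n)" for z
    using that by (intro \<Theta>_closed) (simp add: path_algebra_sel)
  from x show ?thesis
  proof (induction x rule: poly_mapping_single_induct)
    case (single s c)
    from y show ?case
    proof (induction y rule: poly_mapping_single_induct)
      case (single t c')
      then show ?case
        using \<open>s \<in> qpaths (quiverQ n)\<close>
        by (simp add: path_algebra_mult_single \<Theta>_single path_image_mult)
    next
      case (add y y')
      have "\<Theta> (Poly_Mapping.single s c) \<in> carrier \<Lambda>"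
        using \<open>s \<in> qpaths (quiverQ n)\<close> by (simp add: \<Theta>_single path_image_closed)
      then show ?case
        using add closed[of y] closed[of y']
        by (simp add: path_algebra_mult_add_right \<Theta>_add graded_end_algebra_mult_add_right[OF G_obj])
    qed (simp add: zero)
  next
    case (add x x')
    then show ?case
      using closed[of x] closed[of x'] closed[OF y]
      by (simp add: path_algebra_mult_add_left \<Theta>_add graded_end_algebra_mult_add_left[OF G_obj])
  qed (simp add: zero)
qed

lemma single_sum: "Poly_Mapping.single d (\<Sum>i\<in>S. f i) = (\<Sum>i\<in>S. Poly_Mapping.single d (f i))"
  by (induction S rule: infinite_finite_induct) (simp_all add: single_add)

lemma \<Theta>_one: "\<Theta> \<one>\<^bsub>A\<^esub> = \<one>\<^bsub>\<Lambda>\<^esub>"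
proof -
  have "\<Theta> \<one>\<^bsub>A\<^esub> = (\<Sum>v\<in>{1..N}. Poly_Mapping.single 0 (inc v \<cdot> prj v))"
    by (simp add: path_algebra_sel \<Theta>_sum \<Theta>_single path_image_def path_degree_def M_ident N_eq
        del: One_nat_def)
  then show ?thesis
    by (simp only: single_sum[symmetric] sum_inc_prj graded_end_algebra_sel)
qed

lemma \<Theta>_ring_hom: "\<Theta> \<in> ring_hom A \<Lambda>"
  by (intro ring_hom_memI)
    (simp_all add: \<Theta>_closed \<Theta>_mult \<Theta>_one path_algebra_sel(3) graded_end_algebra_sel(3) \<Theta>_add)

lemma \<Theta>_smult: "\<Theta> (Poly_Mapping.map ((*) c) x) = Poly_Mapping.map (scl T c) (\<Theta> x)"
proof (induction x rule: poly_mapping_single_induct[OF subset_UNIV])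
  case (2 s c')
  then show ?case
    by (simp add: \<Theta>_single path_image_def scl_scl)
next
  case (3 x y)
  have "Poly_Mapping.map (scl T c) (u + v) = Poly_Mapping.map (scl T c) u + Poly_Mapping.map (scl T c) v"
    for u v :: "int \<Rightarrow>\<^sub>0 'm"
    by (rule poly_mapping_eqI) (simp add: lookup_add scl_add_right lookup_map_zero)
  with 3 show ?case by (simp add: smult_add \<Theta>_add)
qed (simp add: map_zero)

text \<open>The normal form \<open>normal_path a b d\<close> together with its end points.\<close>

definition normal_qpath :: "nat \<Rightarrow> nat \<Rightarrow> int \<Rightarrow> (nat, arrow) qpath" where
  "normal_qpath a b d = (a, normal_path a b d, b)"

lemma normal_qpath:
  assumes "a \<in> {1..N}" "b \<in> {1..N}" "path_type a b d"
  shows "normal_qpath a b d \<in> qpaths (quiverQ n)" "path_degree arrow_degree (normal_qpath a b d) = d"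
  using assms awalk_normal_path[of a b n d]
  by (simp_all add: normal_qpath_def qpaths_def path_degree_def degree_normal_path N_eq)

lemma \<Theta>_homogeneous_surj:
  assumes "f \<in> V d"
  shows "\<exists>x\<in>hpart A d. \<Theta> x = Poly_Mapping.single d f"
proof -
  obtain c where c: "f = (\<Sum>a\<in>{1..N}. \<Sum>b\<in>{1..N}. if path_type a b d then scl T (c a b) (M a b d) else 0)"
    using V_expand[OF assms] by blast
  define x where "x = (\<Sum>a\<in>{1..N}. \<Sum>b\<in>{1..N}.
      if path_type a b d then Poly_Mapping.single (normal_qpath a b d) (c a b) else 0)"
  have im: "\<Theta> (if path_type a b d then Poly_Mapping.single (normal_qpath a b d) (c a b) else 0) =
     Poly_Mapping.single d (if path_type a b d then scl T (c a b) (M a b d) else 0)"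
    if "a \<in> {1..N}" "b \<in> {1..N}" for a b
    using normal_qpath(2)[OF that] by (simp add: \<Theta>_single path_image_def normal_qpath_def)
  have "\<Theta> x = (\<Sum>a\<in>{1..N}. \<Sum>b\<in>{1..N}.
     Poly_Mapping.single d (if path_type a b d then scl T (c a b) (M a b d) else 0))"
    unfolding x_def \<Theta>_sum by (intro sum.cong refl im)
  also have "\<dots> = Poly_Mapping.single d f"
    unfolding c single_sum ..
  finally have "\<Theta> x = Poly_Mapping.single d f" .
  moreover have "Poly_Mapping.keys x \<subseteq> {p \<in> qpaths (quiverQ n). path_degree arrow_degree p = d}"
    unfolding x_def
    by (intro order_trans[OF keys_sum] UN_least) (simp add: normal_qpath split: if_splits)
  ultimately show ?thesis
    by (auto simp: path_algebra_sel)
qed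

lemma hpart_carrier: "hpart A d \<subseteq> carrier A"
  by (auto simp: path_algebra_sel)

lemma \<Theta>_hpart: "\<Theta> ` hpart A d = hpart \<Lambda> d"
proof
  show "\<Theta> ` hpart A d \<subseteq> hpart \<Lambda> d"
  proof safe
    fix x assume x: "x \<in> hpart A d"
    then have keys: "s \<in> qpaths (quiverQ n) \<and> path_degree arrow_degree s = d" if "s \<in> Poly_Mapping.keys x" for s
      using that by (auto simp: path_algebra_sel)
    have "\<Theta> x = Poly_Mapping.single d (\<Sum>s\<in>Poly_Mapping.keys x.
        scl T (Poly_Mapping.lookup x s) (M (fst s) (snd (snd s)) d))"
      unfolding \<Theta>_def single_sum using keys by (intro sum.cong refl) (auto simp: path_image_def)
    moreover have "(\<Sum>s\<in>Poly_Mapping.keys x.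
        scl T (Poly_Mapping.lookup x s) (M (fst s) (snd (snd s)) d)) \<in> V d"
      using keys qpath_type by (intro mor_sum G_obj G_sh_obj M_scl_V) metis+
    ultimately show "\<Theta> x \<in> hpart \<Lambda> d"
      by (auto simp: graded_end_algebra_sel)
  qed
  show "hpart \<Lambda> d \<subseteq> \<Theta> ` hpart A d"
  proof
    fix u assume "u \<in> hpart \<Lambda> d"
    then obtain f where f: "u = Poly_Mapping.single d f" "f \<in> V d"
      by (auto simp: graded_end_algebra_sel)
    then show "u \<in> \<Theta> ` hpart A d"
      using \<Theta>_homogeneous_surj[OF f(2)] by (metis imageI)
  qed
qed

lemma \<Theta>_surj: "\<Theta> ` carrier A = carrier \<Lambda>"
proof
  show "\<Theta> ` carrier A \<subseteq> carrier \<Lambda>"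
    using \<Theta>_closed by blast
  show "carrier \<Lambda> \<subseteq> \<Theta> ` carrier A"
  proof
    fix u assume u: "u \<in> carrier \<Lambda>"
    have "\<exists>x\<in>carrier A. \<Theta> x = Poly_Mapping.single d (Poly_Mapping.lookup u d)" for d
      using \<Theta>_homogeneous_surj[of "Poly_Mapping.lookup u d" d] u hpart_carrier
      by (auto simp: graded_end_algebra_sel)
    then obtain x where x: "\<And>d. x d \<in> carrier A"
      "\<And>d. \<Theta> (x d) = Poly_Mapping.single d (Poly_Mapping.lookup u d)"
      by metis
    have "\<Theta> (\<Sum>d\<in>Poly_Mapping.keys u. x d) = u"
      by (rule poly_mapping_eqI)
        (auto simp: \<Theta>_sum x(2) lookup_sum lookup_single when_def in_keys_iff)
    moreover have "(\<Sum>d\<in>Poly_Mapping.keys u. x d) \<in> carrier A"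
      using x(1) keys_sum[of x "Poly_Mapping.keys u"] by (fastforce simp: path_algebra_sel)
    ultimately show "u \<in> \<Theta> ` carrier A" by (metis imageI)
  qed
qed

text \<open>The ring axioms of the graded endomorphism algebra are inherited along the surjection \<open>\<Theta>\<close>.\<close>

lemma ring_\<Lambda>: "ring \<Lambda>"
proof -
  interpret ring A by (rule ring_kQ)
  have "\<Lambda>\<lparr>carrier := \<Theta> ` carrier A, zero := \<Theta> \<zero>\<^bsub>A\<^esub>\<rparr> = \<Lambda>"
    unfolding \<Theta>_surj by (simp add: path_algebra_sel graded_end_algebra_def)
  then show ?thesis
    using ring_hom_imp_img_ring[OF \<Theta>_ring_hom] by simp
qed

sublocale \<Theta>: ring_hom_ring A \<Lambda> \<Theta>
  using ring_kQ ring_\<Lambda> \<Theta>_ring_hom by (intro ring_hom_ringI2)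

lemma kernel_eq: "a_kernel A \<Lambda> \<Theta> = {x \<in> carrier A. \<Theta> x = 0}"
  unfolding a_kernel_def' graded_end_algebra_sel(2) ..

lemma kernel_of_same_degree:
  assumes "quiverQ.awalk n u p v" "quiverQ.awalk n u q v"
    and "sum_list (map arrow_degree p) = sum_list (map arrow_degree q)"
  shows "pth u p v - pth u q v \<in> a_kernel A \<Lambda> \<Theta>"
proof -
  have "pth u p v - pth u q v \<in> carrier A"
    using assms keys_diff[of "pth u p v :: _ \<Rightarrow>\<^sub>0 'k" "pth u q v"]
    by (auto simp: path_algebra_sel qpaths_def)
  then show ?thesis
    using assms by (simp add: kernel_eq \<Theta>_diff \<Theta>_single path_image_def path_degree_def)
qed

lemma relations_kernel: "(relations n :: (_ \<Rightarrow>\<^sub>0 'k) set) \<subseteq> a_kernel A \<Lambda> \<Theta>"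
  unfolding relations_def
  by (intro Un_least; clarify; intro kernel_of_same_degree) (auto simp: quiverQ.awalk_simps)

lemma idealI_kernel: "idealI n \<subseteq> a_kernel A \<Lambda> \<Theta>"
  unfolding idealI_def by (rule \<Theta>.R.genideal_minimal[OF \<Theta>.kernel_is_ideal relations_kernel])

lemma relations_carrier: "(relations n :: (_ \<Rightarrow>\<^sub>0 'k) set) \<subseteq> carrier A"
  using relations_kernel by (auto simp: kernel_eq)

text \<open>On the span of the normal forms \<open>\<Theta>\<close> is injective: a normal form is determined by its type, so its
  coefficient can be read off from one matrix entry in one degree.\<close>

lemma \<Theta>_normal_eq_0:
  assumes y: "\<And>s. s \<in> Poly_Mapping.keys y \<Longrightarrow> s \<in> qpaths (quiverQ n) \<and>
      s = normal_qpath (fst s) (snd (snd s)) (path_degree arrow_degree s)"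
    and zero: "\<Theta> y = 0"
  shows "y = 0"
proof (rule ccontr)
  assume "y \<noteq> 0"
  then obtain t where t: "t \<in> Poly_Mapping.keys y"
    by (metis all_not_in_conv keys_eq_empty)
  define a b d where "a = fst t" and "b = snd (snd t)" and "d = path_degree arrow_degree t"
  have y_path: "s \<in> qpaths (quiverQ n)" if "s \<in> Poly_Mapping.keys y" for s
    using y[OF that] by blast
  have abd: "a \<in> {1..N}" "b \<in> {1..N}" "path_type a b d"
    using qpath_type y[OF t] unfolding a_def b_def d_def by blast+
  let ?K = "{s \<in> Poly_Mapping.keys y. path_degree arrow_degree s = d}"
  let ?f = "\<lambda>s. scl T (Poly_Mapping.lookup y s) (M (fst s) (snd (snd s)) d)"
  have V: "?f s \<in> V d" if "s \<in> ?K" for s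
    using that qpath_type[OF y_path, of s] by (intro M_scl_V) simp_all
  have "0 = Poly_Mapping.lookup (\<Theta> y) d"
    using zero by simp
  also have "\<dots> = (\<Sum>s\<in>Poly_Mapping.keys y. if path_degree arrow_degree s = d then ?f s else 0)"
    unfolding \<Theta>_def lookup_sum
    by (intro sum.cong refl) (auto simp: path_image_def lookup_single when_def)
  also have "\<dots> = (\<Sum>s\<in>?K. ?f s)"
    by (simp add: sum.inter_filter)
  finally have "entry a b d 0 = (\<Sum>s\<in>?K. entry a b d (?f s))"
    using entry_sum[OF abd(1,2), of ?K ?f d] V by simp
  also have "entry a b d 0 = 0"
    using entry_sum[OF abd(1,2), of "{}"] by simp
  also have "(\<Sum>s\<in>?K. entry a b d (?f s)) =
      (\<Sum>s\<in>?K. if s = t then scl T (Poly_Mapping.lookup y t) (E a b d) else 0)"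
  proof (intro sum.cong refl)
    fix s assume s: "s \<in> ?K"
    then have ty: "fst s \<in> {1..N}" "snd (snd s) \<in> {1..N}" "path_type (fst s) (snd (snd s)) d"
      using qpath_type[OF y_path, of s] by simp_all
    have "s = normal_qpath (fst s) (snd (snd s)) d" "t = normal_qpath a b d"
      using y[of s] s y[OF t] unfolding a_def b_def d_def by auto
    then have "s = t \<longleftrightarrow> fst s = a \<and> snd (snd s) = b"
      by (metis a_def b_def)
    then show "entry a b d (?f s) = (if s = t then scl T (Poly_Mapping.lookup y t) (E a b d) else 0)"
      using entry_embed[OF ty(1,2) abd(1,2) E_hom[OF ty]] entry_scl[OF abd(1,2) M_V[OF ty]]
      by (auto simp: M_def)
  qed
  also have "\<dots> = scl T (Poly_Mapping.lookup y t) (E a b d)"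
    using t by (simp add: d_def)
  finally have "Poly_Mapping.lookup y t = 0"
    using E_nonzero[OF abd] by (simp add: scl_eq_0_iff)
  with t show False by (simp add: in_keys_iff)
qed

lemma kernel_idealI: "a_kernel A \<Lambda> \<Theta> = idealI n"
proof
  show "a_kernel A \<Lambda> \<Theta> \<subseteq> idealI n"
  proof
    fix x assume x: "x \<in> a_kernel A \<Lambda> \<Theta>"
    interpret quiver_relations n "idealI n :: (_ \<Rightarrow>\<^sub>0 'k) set"
      using \<Theta>.R.genideal_ideal[OF relations_carrier] \<Theta>.R.genideal_self[OF relations_carrier]
      unfolding quiver_relations_def idealI_def by blast
    define nf where "nf s = normal_qpath (fst s) (snd (snd s)) (path_degree arrow_degree s)" for s
    have "Poly_Mapping.keys x \<subseteq> qpaths (quiverQ n)"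
      using x by (simp add: kernel_eq path_algebra_sel)
    then obtain y where y: "x - y \<in> idealI n" "\<Theta> y = \<Theta> x"
      "Poly_Mapping.keys y \<subseteq> nf ` qpaths (quiverQ n)"
    proof (induction x arbitrary: thesis rule: poly_mapping_single_induct)
      case zero
      then show ?case using zero[of 0] I_zero by simp
    next
      case (single s c)
      obtain u p v where s: "s = (u, p, v)" and p: "quiverQ.awalk n u p v"
        using single(1) by (cases s) (auto simp: qpaths_def)
      have "(pth u p v - pth u (normal_path u v (path_degree arrow_degree s)) v :: _ \<Rightarrow>\<^sub>0 'k) \<in> idealI n"
        using eqv_normal_path[OF p] by (simp add: eqv_def s path_degree_def)
      from I_scale[OF this, of c] have "Poly_Mapping.single s c - Poly_Mapping.single (nf s) c \<in> idealI n"
        by (rule back_subst[of "\<lambda>z. z \<in> idealI n"])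
          (auto intro!: poly_mapping_eqI simp: lookup_map_zero lookup_minus lookup_single when_def s nf_def normal_qpath_def)
      moreover have "path_degree arrow_degree (nf s) = path_degree arrow_degree s"
        by (simp add: nf_def normal_qpath_def path_degree_def degree_normal_path)
      then have "\<Theta> (Poly_Mapping.single (nf s) c) = \<Theta> (Poly_Mapping.single s c)"
        by (simp add: \<Theta>_single path_image_def) (simp add: nf_def normal_qpath_def)
      ultimately show ?case
        using single(1) by (intro single(2)[of "Poly_Mapping.single (nf s) c"]) auto
    next
      case (add x x')
      obtain y where y: "x - y \<in> idealI n" "\<Theta> y = \<Theta> x" "Poly_Mapping.keys y \<subseteq> nf ` qpaths (quiverQ n)"
        using add by blast
      obtain y' where y': "x' - y' \<in> idealI n" "\<Theta> y' = \<Theta> x'" "Poly_Mapping.keys y' \<subseteq> nf ` qpaths (quiverQ n)"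
        using add by blast
      have "(x + x') - (y + y') \<in> idealI n"
        using I_add[OF y(1) y'(1)] by (simp add: algebra_simps)
      then show ?case
        using y y' keys_add[of y y'] by (intro add.prems[of "y + y'"]) (auto simp: \<Theta>_add)
    qed
    have "nf s \<in> qpaths (quiverQ n) \<and> nf (nf s) = nf s" if "s \<in> qpaths (quiverQ n)" for s
      using normal_qpath[OF qpath_type[OF that]] by (simp add: nf_def) (simp add: normal_qpath_def)
    then have "s \<in> qpaths (quiverQ n) \<and> s = nf s" if "s \<in> Poly_Mapping.keys y" for s
      using y(3) that by auto
    then have "y = 0"
      using y(2) x unfolding kernel_eq nf_def by (intro \<Theta>_normal_eq_0) auto
    with y(1) show "x \<in> idealI n" by simp
  qed
qed (rule idealI_kernel)

theorem graded_algebra_isos_nonempty: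
  "graded_algebra_isos \<Lambda> (quotient_algebra A (idealI n)) \<noteq> {}"
proof -
  let ?I = "idealI n :: (_ \<Rightarrow>\<^sub>0 'k) set"
  interpret I: ideal ?I A
    using \<Theta>.kernel_is_ideal by (simp add: kernel_idealI)
  let ?\<psi> = "\<lambda>X. the_elem (\<Theta> ` X)"
  have \<psi>: "?\<psi> \<in> ring_iso (A Quot ?I) \<Lambda>"
    using \<Theta>.FactRing_iso_set[OF \<Theta>_surj] by (simp add: kernel_idealI)
  define \<phi> where "\<phi> = inv_into (carrier (A Quot ?I)) ?\<psi>"
  have \<phi>: "\<phi> \<in> ring_iso \<Lambda> (A Quot ?I)"
    unfolding \<phi>_def by (rule ring_iso_set_sym[OF I.quotient_is_ring \<psi>])
  have \<phi>_\<Theta>: "\<phi> (\<Theta> x) = ?I +>\<^bsub>A\<^esub> x" if x: "x \<in> carrier A" for x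
  proof -
    have "?I +>\<^bsub>A\<^esub> x \<in> carrier (A Quot ?I)"
      using x by (auto simp: FactRing_def A_RCOSETS_def')
    moreover have "?\<psi> (?I +>\<^bsub>A\<^esub> x) = \<Theta> x"
      using \<Theta>.the_elem_simp[OF x] by (simp add: kernel_idealI)
    moreover have "inj_on ?\<psi> (carrier (A Quot ?I))"
      using \<psi> by (auto simp: ring_iso_def bij_betw_def)
    ultimately show ?thesis
      unfolding \<phi>_def using inv_into_f_f by fastforce
  qed
  have coset: "y \<in> carrier A \<and> \<Theta> y = \<Theta> x" if "y \<in> ?I +>\<^bsub>A\<^esub> x" "x \<in> carrier A" for x y
  proof -
    have "\<exists>i\<in>?I. y = i \<oplus>\<^bsub>A\<^esub> x"
      using that(1) by (simp only: a_r_coset_def' UN_iff singleton_iff)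
    then obtain i where i: "i \<in> ?I" "y = i \<oplus>\<^bsub>A\<^esub> x"
      by (elim bexE)
    then have "i \<in> carrier A" "\<Theta> i = 0"
      using idealI_kernel by (auto simp: kernel_eq)
    with i(2) that(2) show ?thesis
      using \<Theta>.R.add.m_closed[of i x] by (simp add: path_algebra_sel(3) \<Theta>_add)
  qed
  have smult_closed: "c \<odot>\<^bsub>A\<^esub> x \<in> carrier A" if "x \<in> carrier A" for c x
    using that by (auto simp: path_algebra_sel lookup_map_zero in_keys_iff subset_iff)
  have smult: "\<phi> (c \<odot>\<^bsub>\<Lambda>\<^esub> u) = c \<odot>\<^bsub>quotient_algebra A ?I\<^esub> \<phi> u" if u: "u \<in> carrier \<Lambda>" for c u
  proof -
    obtain x where x: "x \<in> carrier A" "u = \<Theta> x"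
      using u \<Theta>_surj by blast
    have "\<phi> (c \<odot>\<^bsub>\<Lambda>\<^esub> u) = \<phi> (\<Theta> (c \<odot>\<^bsub>A\<^esub> y))" if "y \<in> ?I +>\<^bsub>A\<^esub> x" for y
      using coset[OF that x(1)] x(2) by (simp add: graded_end_algebra_sel path_algebra_sel \<Theta>_smult)
    also have "\<phi> (\<Theta> (c \<odot>\<^bsub>A\<^esub> y)) = ?I +>\<^bsub>A\<^esub> (c \<odot>\<^bsub>A\<^esub> y)" if "y \<in> ?I +>\<^bsub>A\<^esub> x" for y
      using coset[OF that x(1)] by (intro \<phi>_\<Theta> smult_closed) simp
    finally have "?I +>\<^bsub>A\<^esub> (c \<odot>\<^bsub>A\<^esub> y) = \<phi> (c \<odot>\<^bsub>\<Lambda>\<^esub> u)" if "y \<in> ?I +>\<^bsub>A\<^esub> x" for y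
      using that by simp
    moreover have "x \<in> ?I +>\<^bsub>A\<^esub> x"
      using I.a_rcos_self[OF x(1)] .
    ultimately have "(\<Union>y\<in>?I +>\<^bsub>A\<^esub> x. ?I +>\<^bsub>A\<^esub> (c \<odot>\<^bsub>A\<^esub> y)) = \<phi> (c \<odot>\<^bsub>\<Lambda>\<^esub> u)"
      by blast
    then show ?thesis
      by (simp add: quotient_algebra_def x(2) \<phi>_\<Theta>[OF x(1)])
  qed
  have hpart: "\<phi> ` hpart \<Lambda> d = hpart (quotient_algebra A ?I) d" for d
    unfolding \<Theta>_hpart[symmetric] image_image
    using \<phi>_\<Theta> hpart_carrier by (auto simp: quotient_algebra_def intro!: image_cong)
  have "\<phi> \<in> ring_iso \<Lambda> (quotient_algebra A ?I)"
    using \<phi> by (simp add: ring_iso_def ring_hom_def quotient_algebra_def)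
  with smult hpart have "\<phi> \<in> graded_algebra_isos \<Lambda> (quotient_algebra A ?I)"
    by (simp add: graded_algebra_isos_def)
  then show ?thesis by blast
qed

end

text \<open>The case in which the summands are listed upwards along the order.\<close>

lemma graded_algebra_isos_of_increasing:
  fixes T :: "('k::field, 'o, 'm::ab_group_add) tcat"
  assumes n: "n \<ge> 1"
    and "triangulated_category T" and lin: "linear_generator T H"
    and sum: "direct_sum T H {1..2 * n - 1} P"
    and ind: "\<And>i. i \<in> {1..2 * n - 1} \<Longrightarrow> indecomposable T (P i)"
    and even: "\<And>i. i \<in> {1..2 * n - 1} \<Longrightarrow> iso_obj T (P i) (sh T 1 (P i)) \<longleftrightarrow> even i"
    and le: "\<And>i j. 1 \<le> i \<Longrightarrow> i < j \<Longrightarrow> j \<le> 2 * n - 1 \<Longrightarrow> gen_le T (P i) (P j)"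
  shows "graded_algebra_isos (graded_end_algebra T H)
           (quotient_algebra (kQ n :: ('k, (nat, arrow) qpath \<Rightarrow>\<^sub>0 'k) graded_algebra) (idealI n)) \<noteq> {}"
proof -
  interpret triangulated_category T by fact
  interpret linearly_generated T H by unfold_locales (rule lin)
  interpret ordered_summands T H "2 * n - 1" P
    by unfold_locales (use n even le shifted_ind_summand[OF sum] ind in auto)
  obtain inc prj where ip: "H \<in> obj T"
    "\<And>i. i \<in> {1..2 * n - 1} \<Longrightarrow> inc i \<in> mor T (P i) H"
    "\<And>i. i \<in> {1..2 * n - 1} \<Longrightarrow> prj i \<in> mor T H (P i)"
    "\<And>i j. i \<in> {1..2 * n - 1} \<Longrightarrow> j \<in> {1..2 * n - 1} \<Longrightarrow>
       prj j \<cdot>\<^bsub>T\<^esub> inc i = (if i = j then ident T (P i) else 0)"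
    "(\<Sum>i\<in>{1..2 * n - 1}. inc i \<cdot>\<^bsub>T\<^esub> prj i) = ident T H"
    using sum unfolding direct_sum_def by blast
  obtain E where E:
    "\<And>a b d. a \<in> {1..2 * n - 1} \<Longrightarrow> b \<in> {1..2 * n - 1} \<Longrightarrow> path_type a b d \<Longrightarrow> E a b d \<in> ghom a b d \<and> E a b d \<noteq> 0"
    "\<And>a. a \<in> {1..2 * n - 1} \<Longrightarrow> E a a 0 = ident T (P a)"
    "\<And>a b c d e. a \<in> {1..2 * n - 1} \<Longrightarrow> b \<in> {1..2 * n - 1} \<Longrightarrow> c \<in> {1..2 * n - 1} \<Longrightarrow>
      path_type a b d \<Longrightarrow> path_type b c e \<Longrightarrow> gprod e (E a b d) (E b c e) = E a c (d + e)"
    using ex_multiplicative_basis by blast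
  interpret basis_of_summands T H "2 * n - 1" P n inc prj E
    by unfold_locales (use ip E in blast)+
  show ?thesis by (rule graded_algebra_isos_nonempty)
qed

theorem theorem3p7:
  fixes T :: "('k::alg_closed_field, 'o, 'm::ab_group_add) tcat"
    and n :: nat and H :: 'o and P :: "nat \<Rightarrow> 'o"
  assumes "n \<ge> 1"
    and "triangulated_category T" and "hom_finite T" and "krull_schmidt T"
    and "linear_generator T H" and "minimal_generator T H"
    and "direct_sum T H {1..2 * n - 1} P"
    and "\<And>i. i \<in> {1..2 * n - 1} \<Longrightarrow> indecomposable T (P i)"
    and "\<And>i. i \<in> {1..2 * n - 1} \<Longrightarrow> iso_obj T (P i) (sh T 1 (P i)) \<longleftrightarrow> i mod 2 = 0"
    and "listed_in_order T (2 * n - 1) P"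
  shows "graded_algebra_isos (graded_end_algebra T H)
           (quotient_algebra (kQ n :: ('k, (nat, arrow) qpath \<Rightarrow>\<^sub>0 'k) graded_algebra) (idealI n)) \<noteq> {}"
proof -
  have even: "iso_obj T (P i) (sh T 1 (P i)) \<longleftrightarrow> even i" if "i \<in> {1..2 * n - 1}" for i
    using assms(9)[OF that] by presburger
  have "(\<forall>i j. 1 \<le> i \<and> i < j \<and> j \<le> 2 * n - 1 \<longrightarrow> gen_le T (P i) (P j)) \<or>
    (\<forall>i j. 1 \<le> i \<and> i < j \<and> j \<le> 2 * n - 1 \<longrightarrow> gen_le T (P j) (P i))"
    using assms(10) by (simp add: listed_in_order_def)
  then show ?thesis
  proof
    assume "\<forall>i j. 1 \<le> i \<and> i < j \<and> j \<le> 2 * n - 1 \<longrightarrow> gen_le T (P i) (P j)"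
    then show ?thesis
      using graded_algebra_isos_of_increasing[OF assms(1,2,5,7,8)] even by blast
  next
    assume down: "\<forall>i j. 1 \<le> i \<and> i < j \<and> j \<le> 2 * n - 1 \<longrightarrow> gen_le T (P j) (P i)"
    \<comment> \<open>The reversal \<open>i \<mapsto> 2n - i\<close> preserves parity and turns a downward list into an upward one.\<close>
    let ?r = "\<lambda>i. 2 * n - i"
    have r: "bij_betw ?r {1..2 * n - 1} {1..2 * n - 1}"
      by (rule bij_betwI[where g = ?r]) auto
    then have r_in: "?r i \<in> {1..2 * n - 1}" if "i \<in> {1..2 * n - 1}" for i
      using that by (auto simp: bij_betw_def)
    show ?thesis
    proof (rule graded_algebra_isos_of_increasing[OF assms(1,2,5), where P = "\<lambda>i. P (?r i)"])
      show "direct_sum T H {1..2 * n - 1} (\<lambda>i. P (?r i))"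
        using linear_category.direct_sum_reindex[OF triangulated_category.axioms(1)[OF assms(2)] r assms(7)] .
      show "indecomposable T (P (?r i))" if "i \<in> {1..2 * n - 1}" for i
        using assms(8)[OF r_in[OF that]] .
      show "iso_obj T (P (?r i)) (sh T 1 (P (?r i))) \<longleftrightarrow> even i" if "i \<in> {1..2 * n - 1}" for i
        using even[OF r_in[OF that]] that by auto
      show "gen_le T (P (?r i)) (P (?r j))" if "1 \<le> i" "i < j" "j \<le> 2 * n - 1" for i j
        using that by (intro down[rule_format] conjI) linarith+
    qed
  qed
qed

end
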